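(* Let $(M,g)$ be a Riemannian manifold with Riemannian distance $d$, and fix $y_0\in M$. Let $\mathcal{U}_{y_0}\subset M$ be a geodesically convex set and let $X$ be a smooth vector field on $M$ satisfying the monotonicity condition $\langle\nabla_{v_x}X,v_x\rangle\le\nu\|v_x\|^2$ for all $x\in\mathcal{U}_{y_0}$, $v_x\in T_xM$, with constant $\nu\in\mathbb{R}$. Let $y(t)=\exp(tX)y_0$ be defined and contained in $\mathcal{U}_{y_0}$ for $t\in[0,t^*]$, where $t^*>0$. Let $\phi_{h,X}$ be a numerical method, $y_{j+1}=\phi_{h,X}(y_j)$, $j=0,\ldots,k-1$, which is well defined and contained in $\mathcal{U}_{y_0}$ for any $h$ such that $0<h\le h^*\le t^*$, $t^*=hk$, and whose local error can be bounded, for some $p\in\mathbb{N}$ and $C\in\mathbb{R}$, as $$d\left(\exp(hX)y,\phi_{h,X}(y)\right)\le C h^{p+1}\qquad\text{for all } y\in\mathcal{U}_{y_0},\ h\in(0,h^*].$$ Then, for all $k>0$ (with $t^*=hk$) and $h\in(0,h^*]$, the global error is bounded as $$d\left(y(t^* ),y_k\right)\le\begin{cases}\dfrac{C}{\nu}\left(\mathrm{e}^{t^*\nu}-1\right)h^p & \text{for }\nu>0,\\[2mm] C\,t^*h^p & \text{for }\nu=0,\\[1mm] \dfrac{C\,\mathrm{e}^{-\nu h}}{\nu}\left(\mathrm{e}^{t^*\nu}-1\right)h^p & \text{for }\nu<0.\end{cases}$$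
   Context: $M$ is a finite-dimensional smooth manifold with Riemannian metric $g=\langle\cdot,\cdot\rangle$, norm $\|v\|=\langle v,v\rangle^{1/2}$, and Levi-Civita connection $\nabla$; $d(p,q)$ is the infimum of lengths of curves connecting $p$ and $q$. A set $\mathcal{U}\subseteq M$ is geodesically convex if for each $p,q\in\mathcal{U}$ there is a unique minimizing geodesic segment from $p$ to $q$ contained entirely in $\mathcal{U}$. $\exp(tX)$ denotes the $t$-flow of the vector field $X$: $\exp(tX)p=y(t)$ where $\dot y=X|_y$, $y(0)=p$. A numerical method is a family of maps $\phi_{h,X}:M\to M$, depending on the step size $h>0$, intended to approximate $\exp(hX)$. The integer $k\geq 1$ is the number of steps.
   Formalization: It is additionally assumed that the exact flow arcs exp(sX)y_j, 0≤s≤h, j<k, issued from the numerical iterates are defined and stay in U_{y_0}; without this the bound can fail, since exp(sX)y_j may leave U_{y_0}, where X is not controlled, and return far away. *)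

theory Defs
  imports "HOL-Analysis.Analysis"
begin

section \<open>Smooth maps between Euclidean spaces\<close>

text \<open>Both predicates are only meaningful for open \<open>S\<close>.\<close>

primrec Ck_on :: "nat \<Rightarrow> 'a::euclidean_space set \<Rightarrow> ('a \<Rightarrow> 'b::real_normed_vector) \<Rightarrow> bool" where
  "Ck_on 0 S f = continuous_on S f"
| "Ck_on (Suc k) S f = ((\<forall>x\<in>S. f differentiable (at x)) \<and>
     (\<forall>v. Ck_on k S (\<lambda>x. frechet_derivative f (at x) v)))"

definition smooth_on :: "'a::euclidean_space set \<Rightarrow> ('a \<Rightarrow> 'b::real_normed_vector) \<Rightarrow> bool" where
  "smooth_on S f = (\<forall>k. Ck_on k S f)"

section \<open>Smooth manifolds\<close>

text \<open>The manifold is the whole of a second countable Hausdorff type \<open>'m\<close>; it is modelled on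
  the Euclidean space \<open>'e\<close>, so its dimension is \<open>DIM('e)\<close>. A chart is a pair of its domain and
  its coordinate map (whose values outside the domain are irrelevant). A smooth structure is
  given by any atlas, not necessarily a maximal one.\<close>

type_synonym ('m, 'e) chart = "'m set \<times> ('m \<Rightarrow> 'e)"

definition inv_chart :: "('m, 'e) chart \<Rightarrow> 'e \<Rightarrow> 'm" where
  "inv_chart c = inv_into (fst c) (snd c)"

definition is_chart :: "('m::topological_space, 'e::euclidean_space) chart \<Rightarrow> bool" where
  "is_chart c \<longleftrightarrow> open (fst c) \<and> open (snd c ` fst c) \<and>
     homeomorphism (fst c) (snd c ` fst c) (snd c) (inv_chart c)"

definition smooth_atlas ::
  "('m::{second_countable_topology,t2_space}, 'e::euclidean_space) chart set \<Rightarrow> bool" where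
  "smooth_atlas A \<longleftrightarrow> (\<forall>c\<in>A. is_chart c) \<and> (\<Union>c\<in>A. fst c) = UNIV \<and>
     (\<forall>c\<in>A. \<forall>c'\<in>A. smooth_on (snd c ` (fst c \<inter> fst c')) (snd c' \<circ> inv_chart c))"

section \<open>Tangent vectors, vector fields and functions\<close>

text \<open>A tangent vector is the family of its components in all charts of the atlas around its base
  point, related by the derivatives of the transition maps. Components in other charts are
  normalised to 0, so that a tangent vector is determined by its components in one chart around
  the base point. The base point itself is not recorded.\<close>

type_synonym ('m, 'e) tvec = "('m, 'e) chart \<Rightarrow> 'e"
type_synonym ('m, 'e) vfield = "'m \<Rightarrow> ('m, 'e) tvec"

definition tangent_space ::
  "('m::topological_space, 'e::euclidean_space) chart set \<Rightarrow> 'm \<Rightarrow> ('m, 'e) tvec set" where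
  "tangent_space A p = {v.
     (\<forall>c. c \<notin> A \<or> p \<notin> fst c \<longrightarrow> v c = 0) \<and>
     (\<forall>c\<in>A. \<forall>c'\<in>A. p \<in> fst c \<and> p \<in> fst c' \<longrightarrow>
        v c' = frechet_derivative (snd c' \<circ> inv_chart c) (at (snd c p)) (v c))}"

definition tv_add :: "('m, 'e::euclidean_space) tvec \<Rightarrow> ('m, 'e) tvec \<Rightarrow> ('m, 'e) tvec" where
  "tv_add u v = (\<lambda>c. u c + v c)"

definition tv_diff :: "('m, 'e::euclidean_space) tvec \<Rightarrow> ('m, 'e) tvec \<Rightarrow> ('m, 'e) tvec" where
  "tv_diff u v = (\<lambda>c. u c - v c)"

definition tv_scale :: "real \<Rightarrow> ('m, 'e::euclidean_space) tvec \<Rightarrow> ('m, 'e) tvec" where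
  "tv_scale a v = (\<lambda>c. a *\<^sub>R v c)"

definition smooth_fun_on ::
  "('m::topological_space, 'e::euclidean_space) chart set \<Rightarrow> 'm set \<Rightarrow> ('m \<Rightarrow> real) \<Rightarrow> bool" where
  "smooth_fun_on A W f \<longleftrightarrow>
     open W \<and> (\<forall>c\<in>A. smooth_on (snd c ` (fst c \<inter> W)) (\<lambda>x. f (inv_chart c x)))"

definition smooth_vfield_on ::
  "('m::topological_space, 'e::euclidean_space) chart set \<Rightarrow> 'm set \<Rightarrow> ('m, 'e) vfield \<Rightarrow> bool" where
  "smooth_vfield_on A W Y \<longleftrightarrow>
     open W \<and> (\<forall>p\<in>W. Y p \<in> tangent_space A p) \<and>
     (\<forall>c\<in>A. smooth_on (snd c ` (fst c \<inter> W)) (\<lambda>x. Y (inv_chart c x) c))"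

text \<open>The derivative \<open>v(f)\<close> of a function \<open>f\<close> along a tangent vector \<open>v\<close> at \<open>p\<close>, computed in a
  chart \<open>c\<close> around \<open>p\<close>; the value does not depend on \<open>c\<close>.\<close>

definition vec_deriv :: "('m, 'e::euclidean_space) chart \<Rightarrow> 'm \<Rightarrow> ('m, 'e) tvec \<Rightarrow> ('m \<Rightarrow> real) \<Rightarrow> real" where
  "vec_deriv c p v f = frechet_derivative (\<lambda>x. f (inv_chart c x)) (at (snd c p)) (v c)"

definition lie_bracket ::
  "('m, 'e::euclidean_space) chart set \<Rightarrow> ('m, 'e) vfield \<Rightarrow> ('m, 'e) vfield \<Rightarrow> ('m, 'e) vfield" where
  "lie_bracket A Y Z = (\<lambda>p c. if c \<in> A \<and> p \<in> fst c
     then frechet_derivative (\<lambda>x. Z (inv_chart c x) c) (at (snd c p)) (Y p c) -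
          frechet_derivative (\<lambda>x. Y (inv_chart c x) c) (at (snd c p)) (Z p c)
     else 0)"

section \<open>Riemannian metrics and the Levi-Civita connection\<close>

definition riemannian_metric ::
  "('m::topological_space, 'e::euclidean_space) chart set \<Rightarrow>
   ('m \<Rightarrow> ('m, 'e) tvec \<Rightarrow> ('m, 'e) tvec \<Rightarrow> real) \<Rightarrow> bool" where
  "riemannian_metric A g \<longleftrightarrow>
     (\<forall>p. \<forall>u\<in>tangent_space A p. \<forall>v\<in>tangent_space A p.
        g p u v = g p v u \<and>
        (\<forall>w\<in>tangent_space A p. \<forall>a. g p (tv_add (tv_scale a u) v) w = a * g p u w + g p v w)) \<and>
     (\<forall>p. \<forall>v\<in>tangent_space A p. v \<noteq> (\<lambda>_. 0) \<longrightarrow> g p v v > 0) \<and>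
     (\<forall>W Y Z. smooth_vfield_on A W Y \<and> smooth_vfield_on A W Z \<longrightarrow>
        smooth_fun_on A W (\<lambda>p. g p (Y p) (Z p)))"

definition riemannian_manifold ::
  "('m::{second_countable_topology,t2_space}, 'e::euclidean_space) chart set \<Rightarrow>
   ('m \<Rightarrow> ('m, 'e) tvec \<Rightarrow> ('m, 'e) tvec \<Rightarrow> real) \<Rightarrow> bool" where
  "riemannian_manifold A g \<longleftrightarrow> smooth_atlas A \<and> riemannian_metric A g"

definition tv_norm ::
  "('m \<Rightarrow> ('m, 'e) tvec \<Rightarrow> ('m, 'e) tvec \<Rightarrow> real) \<Rightarrow> 'm \<Rightarrow> ('m, 'e) tvec \<Rightarrow> real" where
  "tv_norm g p v = sqrt (g p v v)"

text \<open>\<open>nabla p v Y\<close> is the covariant derivative at \<open>p\<close> of the vector field \<open>Y\<close> in the direction of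
  \<open>v \<in> tangent_space A p\<close>. As a covariant derivative is local, it is axiomatised for fields that
  are smooth on some open neighbourhood \<open>W\<close> of \<open>p\<close>, so that it can be applied to the coordinate
  fields of a chart.\<close>

definition affine_connection ::
  "('m::topological_space, 'e::euclidean_space) chart set \<Rightarrow>
   ('m \<Rightarrow> ('m, 'e) tvec \<Rightarrow> ('m, 'e) vfield \<Rightarrow> ('m, 'e) tvec) \<Rightarrow> bool" where
  "affine_connection A nabla \<longleftrightarrow>
     (\<forall>W Y Z f. smooth_vfield_on A W Y \<and> smooth_vfield_on A W Z \<and> smooth_fun_on A W f \<longrightarrow>
        smooth_vfield_on A W (\<lambda>p. nabla p (Z p) Y) \<and>
        (\<forall>p\<in>W. \<forall>v\<in>tangent_space A p.
           nabla p v Y \<in> tangent_space A p \<and>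
           (\<forall>w\<in>tangent_space A p. \<forall>a. nabla p (tv_add (tv_scale a v) w) Y =
              tv_add (tv_scale a (nabla p v Y)) (nabla p w Y)) \<and>
           nabla p v (\<lambda>q. tv_add (Y q) (Z q)) = tv_add (nabla p v Y) (nabla p v Z) \<and>
           (\<forall>c\<in>A. p \<in> fst c \<longrightarrow> nabla p v (\<lambda>q. tv_scale (f q) (Y q)) =
              tv_add (tv_scale (vec_deriv c p v f) (Y p)) (tv_scale (f p) (nabla p v Y))) \<and>
           ((\<forall>q\<in>W. Y q = Z q) \<longrightarrow> nabla p v Y = nabla p v Z)))"

definition torsion_free ::
  "('m::topological_space, 'e::euclidean_space) chart set \<Rightarrow>
   ('m \<Rightarrow> ('m, 'e) tvec \<Rightarrow> ('m, 'e) vfield \<Rightarrow> ('m, 'e) tvec) \<Rightarrow> bool" where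
  "torsion_free A nabla \<longleftrightarrow>
     (\<forall>W Y Z. smooth_vfield_on A W Y \<and> smooth_vfield_on A W Z \<longrightarrow>
        (\<forall>p\<in>W. tv_diff (nabla p (Y p) Z) (nabla p (Z p) Y) = lie_bracket A Y Z p))"

definition metric_compatible ::
  "('m::topological_space, 'e::euclidean_space) chart set \<Rightarrow>
   ('m \<Rightarrow> ('m, 'e) tvec \<Rightarrow> ('m, 'e) tvec \<Rightarrow> real) \<Rightarrow>
   ('m \<Rightarrow> ('m, 'e) tvec \<Rightarrow> ('m, 'e) vfield \<Rightarrow> ('m, 'e) tvec) \<Rightarrow> bool" where
  "metric_compatible A g nabla \<longleftrightarrow>
     (\<forall>W Y Z. smooth_vfield_on A W Y \<and> smooth_vfield_on A W Z \<longrightarrow>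
        (\<forall>p\<in>W. \<forall>v\<in>tangent_space A p. \<forall>c\<in>A. p \<in> fst c \<longrightarrow>
           vec_deriv c p v (\<lambda>q. g q (Y q) (Z q)) =
             g p (nabla p v Y) (Z p) + g p (Y p) (nabla p v Z)))"

definition levi_civita ::
  "('m::topological_space, 'e::euclidean_space) chart set \<Rightarrow>
   ('m \<Rightarrow> ('m, 'e) tvec \<Rightarrow> ('m, 'e) tvec \<Rightarrow> real) \<Rightarrow>
   ('m \<Rightarrow> ('m, 'e) tvec \<Rightarrow> ('m, 'e) vfield \<Rightarrow> ('m, 'e) tvec) \<Rightarrow> bool" where
  "levi_civita A g nabla \<longleftrightarrow>
     affine_connection A nabla \<and> torsion_free A nabla \<and> metric_compatible A g nabla"

section \<open>Curves, length and distance\<close>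

definition velocity ::
  "('m, 'e::euclidean_space) chart set \<Rightarrow> real set \<Rightarrow> (real \<Rightarrow> 'm) \<Rightarrow> real \<Rightarrow> ('m, 'e) tvec" where
  "velocity A S \<gamma> t = (\<lambda>c. if c \<in> A \<and> \<gamma> t \<in> fst c
     then vector_derivative (snd c \<circ> \<gamma>) (at t within S) else 0)"

definition C1_curve ::
  "('m::topological_space, 'e::euclidean_space) chart set \<Rightarrow> real set \<Rightarrow> (real \<Rightarrow> 'm) \<Rightarrow> bool" where
  "C1_curve A S \<gamma> \<longleftrightarrow> continuous_on S \<gamma> \<and>
     (\<forall>c\<in>A. \<forall>t\<in>S. \<gamma> t \<in> fst c \<longrightarrow>
        (snd c \<circ> \<gamma>) differentiable (at t within S) \<and>
        continuous (at t within S) (\<lambda>s. velocity A S \<gamma> s c))"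

definition piecewise_C1_curve ::
  "('m::topological_space, 'e::euclidean_space) chart set \<Rightarrow> (real \<Rightarrow> 'm) \<Rightarrow> bool" where
  "piecewise_C1_curve A \<gamma> \<longleftrightarrow>
     (\<exists>(n::nat) s. s 0 = 0 \<and> s n = 1 \<and>
        (\<forall>i<n. s i < s (Suc i) \<and> C1_curve A {s i..s (Suc i)} \<gamma>))"

definition curve_length ::
  "('m, 'e::euclidean_space) chart set \<Rightarrow> ('m \<Rightarrow> ('m, 'e) tvec \<Rightarrow> ('m, 'e) tvec \<Rightarrow> real) \<Rightarrow>
   (real \<Rightarrow> 'm) \<Rightarrow> real" where
  "curve_length A g \<gamma> = integral {0..1} (\<lambda>t. tv_norm g (\<gamma> t) (velocity A {0..1} \<gamma> t))"

text \<open>The distance is extended-real-valued: \<open>M\<close> need not be connected, and the distance between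
  different components is \<open>\<infinity>\<close>, the infimum of the empty set.\<close>

definition riemannian_dist ::
  "('m::topological_space, 'e::euclidean_space) chart set \<Rightarrow>
   ('m \<Rightarrow> ('m, 'e) tvec \<Rightarrow> ('m, 'e) tvec \<Rightarrow> real) \<Rightarrow> 'm \<Rightarrow> 'm \<Rightarrow> ereal" where
  "riemannian_dist A g p q =
     (INF \<gamma>\<in>{\<gamma>. piecewise_C1_curve A \<gamma> \<and> \<gamma> 0 = p \<and> \<gamma> 1 = q}. ereal (curve_length A g \<gamma>))"

section \<open>Geodesics and geodesic convexity\<close>

definition coord_field ::
  "('m, 'e::euclidean_space) chart set \<Rightarrow> ('m, 'e) chart \<Rightarrow> 'e \<Rightarrow> ('m, 'e) vfield" where
  "coord_field A c u = (\<lambda>p c'. if c' \<in> A \<and> p \<in> fst c \<and> p \<in> fst c'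
     then frechet_derivative (snd c' \<circ> inv_chart c) (at (snd c p)) u else 0)"

definition christoffel ::
  "('m, 'e::euclidean_space) chart set \<Rightarrow>
   ('m \<Rightarrow> ('m, 'e) tvec \<Rightarrow> ('m, 'e) vfield \<Rightarrow> ('m, 'e) tvec) \<Rightarrow>
   ('m, 'e) chart \<Rightarrow> 'm \<Rightarrow> 'e \<Rightarrow> 'e \<Rightarrow> 'e" where
  "christoffel A nabla c p u w = nabla p (coord_field A c u p) (coord_field A c w) c"

text \<open>A geodesic segment is parametrised affinely on \<open>[0, 1]\<close>. The equation below is the coordinate
  form \<open>\<gamma>'' + \<Gamma>(\<gamma>', \<gamma>') = 0\<close> of the statement that the covariant derivative of \<open>\<gamma>'\<close> along \<open>\<gamma>\<close>
  vanishes. Constant curves are included.\<close>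

definition geodesic_segment ::
  "('m::topological_space, 'e::euclidean_space) chart set \<Rightarrow>
   ('m \<Rightarrow> ('m, 'e) tvec \<Rightarrow> ('m, 'e) vfield \<Rightarrow> ('m, 'e) tvec) \<Rightarrow> (real \<Rightarrow> 'm) \<Rightarrow> bool" where
  "geodesic_segment A nabla \<gamma> \<longleftrightarrow> continuous_on {0..1} \<gamma> \<and>
     (\<forall>c\<in>A. \<forall>t\<in>{0..1}. \<gamma> t \<in> fst c \<longrightarrow>
        (snd c \<circ> \<gamma>) differentiable (at t within {0..1}) \<and>
        ((\<lambda>s. velocity A {0..1} \<gamma> s c) has_vector_derivative
           - christoffel A nabla c (\<gamma> t) (velocity A {0..1} \<gamma> t c) (velocity A {0..1} \<gamma> t c))
          (at t within {0..1}))"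

definition minimizing_geodesic ::
  "('m::topological_space, 'e::euclidean_space) chart set \<Rightarrow>
   ('m \<Rightarrow> ('m, 'e) tvec \<Rightarrow> ('m, 'e) tvec \<Rightarrow> real) \<Rightarrow>
   ('m \<Rightarrow> ('m, 'e) tvec \<Rightarrow> ('m, 'e) vfield \<Rightarrow> ('m, 'e) tvec) \<Rightarrow>
   'm \<Rightarrow> 'm \<Rightarrow> (real \<Rightarrow> 'm) \<Rightarrow> bool" where
  "minimizing_geodesic A g nabla p q \<gamma> \<longleftrightarrow> geodesic_segment A nabla \<gamma> \<and> \<gamma> 0 = p \<and> \<gamma> 1 = q \<and>
     ereal (curve_length A g \<gamma>) = riemannian_dist A g p q"

text \<open>Curves are total functions on \<open>real\<close>, hence uniqueness is equality on \<open>[0, 1]\<close>. Uniqueness is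
  required among the minimizing geodesics contained in \<open>U\<close>.\<close>

definition geodesically_convex ::
  "('m::topological_space, 'e::euclidean_space) chart set \<Rightarrow>
   ('m \<Rightarrow> ('m, 'e) tvec \<Rightarrow> ('m, 'e) tvec \<Rightarrow> real) \<Rightarrow>
   ('m \<Rightarrow> ('m, 'e) tvec \<Rightarrow> ('m, 'e) vfield \<Rightarrow> ('m, 'e) tvec) \<Rightarrow> 'm set \<Rightarrow> bool" where
  "geodesically_convex A g nabla U \<longleftrightarrow>
     (\<forall>p\<in>U. \<forall>q\<in>U. \<exists>\<gamma>. minimizing_geodesic A g nabla p q \<gamma> \<and> \<gamma> ` {0..1} \<subseteq> U \<and>
        (\<forall>\<gamma>'. minimizing_geodesic A g nabla p q \<gamma>' \<and> \<gamma>' ` {0..1} \<subseteq> U \<longrightarrow>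
           (\<forall>t\<in>{0..1}. \<gamma>' t = \<gamma> t)))"

section \<open>Flows\<close>

definition integral_curve ::
  "('m::topological_space, 'e::euclidean_space) chart set \<Rightarrow> ('m, 'e) vfield \<Rightarrow> real set \<Rightarrow>
   (real \<Rightarrow> 'm) \<Rightarrow> bool" where
  "integral_curve A X S y \<longleftrightarrow> continuous_on S y \<and>
     (\<forall>c\<in>A. \<forall>s\<in>S. y s \<in> fst c \<longrightarrow>
        ((snd c \<circ> y) has_vector_derivative X (y s) c) (at s within S))"

definition flow_defined ::
  "('m::topological_space, 'e::euclidean_space) chart set \<Rightarrow> ('m, 'e) vfield \<Rightarrow> real \<Rightarrow> 'm \<Rightarrow> bool" where
  "flow_defined A X t p \<longleftrightarrow> (\<exists>y. integral_curve A X (closed_segment 0 t) y \<and> y 0 = p)"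

text \<open>\<open>flow A X t p\<close> is \<open>exp(tX)p\<close>; it is only meaningful if \<open>flow_defined A X t p\<close>.\<close>

definition flow ::
  "('m::topological_space, 'e::euclidean_space) chart set \<Rightarrow> ('m, 'e) vfield \<Rightarrow> real \<Rightarrow> 'm \<Rightarrow> 'm" where
  "flow A X t p = (THE q. \<exists>y. integral_curve A X (closed_segment 0 t) y \<and> y 0 = p \<and> y t = q)"

end

theory Submission
  imports Defs
begin

text \<open>Let \<open>y\<close> and \<open>z\<close> be integral curves of \<open>X\<close> in \<open>U\<close> and let \<open>\<gamma>\<close> be a minimizing geodesic in \<open>U\<close> from
  \<open>y t\<close> to \<open>z t\<close>. Moving \<open>\<gamma>\<close> for a short time \<open>\<tau>\<close> along \<open>X\<close> gives a curve whose end points are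
  \<open>o(\<tau>)\<close>-close to \<open>y (t + \<tau>)\<close> and \<open>z (t + \<tau>)\<close>. Its length is at most \<open>1 + \<tau> \<nu> + o(\<tau>)\<close> times that of
  \<open>\<gamma>\<close>, because the Lie derivative of the metric along \<open>X\<close> is \<open>2 \<langle>\<nabla>\<^sub>v X, v\<rangle>\<close>. Hence the upper right
  derivative of the distance is at most \<open>\<nu>\<close> times the distance, and the time \<open>h\<close> flow expands
  distances by at most \<open>e\<^sup>\<nu>\<^sup>h\<close>. The errors then satisfy \<open>e\<^sub>j\<^sub>+\<^sub>1 \<le> e\<^sup>\<nu>\<^sup>h e\<^sub>j + C h\<^sup>p\<^sup>+\<^sup>1\<close>, and a geometric sum
  gives the bound. To move \<open>\<gamma>\<close>, single Euler steps in charts replace the flow of \<open>X\<close>, so that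
  smooth dependence of the flow on initial values is not needed.\<close>

section \<open>Calculus of smooth maps\<close>

text \<open>The distance of two moving points need not be differentiable in time, so it is
  controlled through its upper right Dini derivative. For this an upper bound is enough, and any one
  competing curve provides it. That curve may leave \<open>U\<close> at once, as \<open>U\<close>
  need not be open. This is harmless: the distance is an infimum over all curves of the manifold,
  while monotonicity is applied only on the trace of \<open>\<gamma>\<close>, a compact subset of
  \<open>U\<close>, and reaches small positive \<open>\<tau>\<close> by uniform continuity. Euler
  steps depend on the chart, so the moved curve is torn wherever two charts meet; each gap is closed
  by a coordinate segment of length \<open>o(\<tau>)\<close>. The distance may be infinite in
  general, but convexity makes it finite, attained and hence real-valued along the two integral
  curves.\<close>

lemma Ck_on_cong:
  assumes "open S" "\<And>x. x \<in> S \<Longrightarrow> f x = g x"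
  shows "Ck_on k S f = Ck_on k S g"
proof -
  have *: "Ck_on k S g" if "Ck_on k S f" "\<And>x. x \<in> S \<Longrightarrow> f x = g x" for f g :: "'a \<Rightarrow> 'b"
    using that
  proof (induction k arbitrary: f g)
    case 0
    then show ?case by (auto cong: continuous_on_cong)
  next
    case (Suc k)
    have d: "f differentiable at x" if "x \<in> S" for x using Suc.prems that by simp
    have eq: "frechet_derivative f (at x) = frechet_derivative g (at x)" if "x \<in> S" for x
      using frechet_derivative_transform_within_open[OF d[OF that] assms(1) that] Suc.prems(2) by blast
    have "g differentiable at x" if "x \<in> S" for x
      using d[OF that] Suc.prems(2) that assms(1)
      by (meson differentiable_def has_derivative_transform_within_open)
    moreover have "Ck_on k S (\<lambda>x. frechet_derivative g (at x) v)" for v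
      by (rule Suc.IH[of "\<lambda>x. frechet_derivative f (at x) v"]) (use Suc.prems eq in auto)
    ultimately show ?case by simp
  qed
  show ?thesis using *[of f g] *[of g f] assms(2) by metis
qed

lemma Ck_on_subset: "Ck_on k S f \<Longrightarrow> T \<subseteq> S \<Longrightarrow> Ck_on k T f"
  by (induction k arbitrary: f) (auto intro: continuous_on_subset)

lemma Ck_on_Suc_imp: "Ck_on (Suc k) S f \<Longrightarrow> Ck_on k S f"
proof (induction k arbitrary: f)
  case 0
  then show ?case
    by (auto intro!: continuous_at_imp_continuous_on differentiable_imp_continuous_within)
qed auto

lemma Ck_on_const: "Ck_on k S (\<lambda>x. c)"
  by (induction k arbitrary: c) auto

lemma Ck_on_add:
  assumes "open S" "Ck_on k S f" "Ck_on k S g"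
  shows "Ck_on k S (\<lambda>x. f x + g x)"
  using assms(2,3)
proof (induction k arbitrary: f g)
  case 0
  then show ?case by (auto intro: continuous_intros)
next
  case (Suc k)
  have hd: "((\<lambda>x. f x + g x) has_derivative
     (\<lambda>v. frechet_derivative f (at x) v + frechet_derivative g (at x) v)) (at x)"
    if "x \<in> S" for x
    using Suc.prems that by (intro has_derivative_add) (auto simp: frechet_derivative_works[symmetric])
  have fd: "frechet_derivative f (at x) v + frechet_derivative g (at x) v =
     frechet_derivative (\<lambda>x. f x + g x) (at x) v" if "x \<in> S" for x v
    by (rule fun_cong[OF frechet_derivative_at[OF hd[OF that]]])
  have "Ck_on k S (\<lambda>x. frechet_derivative f (at x) v + frechet_derivative g (at x) v)" for v
    using Suc by auto
  then have "Ck_on k S (\<lambda>x. frechet_derivative (\<lambda>x. f x + g x) (at x) v)" for v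
    by (rule Ck_on_cong[OF assms(1), THEN iffD1, rotated]) (rule fd)
  then show ?case using hd by (auto simp: differentiable_def)
qed

lemma Ck_on_scaleR:
  assumes "open S" "Ck_on k S f" "Ck_on k S g"
  shows "Ck_on k S (\<lambda>x. f x *\<^sub>R g x)"
  using assms(2,3)
proof (induction k arbitrary: f g)
  case 0
  then show ?case by (auto intro: continuous_intros)
next
  case (Suc k)
  have hd: "((\<lambda>x. f x *\<^sub>R g x) has_derivative
     (\<lambda>v. f x *\<^sub>R frechet_derivative g (at x) v + frechet_derivative f (at x) v *\<^sub>R g x)) (at x)"
    if "x \<in> S" for x
    using Suc.prems that by (intro has_derivative_scaleR) (auto simp: frechet_derivative_works[symmetric])
  have fd: "f x *\<^sub>R frechet_derivative g (at x) v + frechet_derivative f (at x) v *\<^sub>R g x =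
     frechet_derivative (\<lambda>x. f x *\<^sub>R g x) (at x) v" if "x \<in> S" for x v
    by (rule fun_cong[OF frechet_derivative_at[OF hd[OF that]]])
  have "Ck_on k S (\<lambda>x. f x *\<^sub>R frechet_derivative g (at x) v + frechet_derivative f (at x) v *\<^sub>R g x)" for v
    using Suc.prems by (intro Ck_on_add[OF assms(1)] Suc.IH) (auto dest: Ck_on_Suc_imp intro: Ck_on_Suc_imp)
  then have "Ck_on k S (\<lambda>x. frechet_derivative (\<lambda>x. f x *\<^sub>R g x) (at x) v)" for v
    by (rule Ck_on_cong[OF assms(1), THEN iffD1, rotated]) (rule fd)
  then show ?case using hd by (auto simp: differentiable_def)
qed

lemma Ck_on_inner:
  assumes "open S" "Ck_on k S f"
  shows "Ck_on k S (\<lambda>x. f x \<bullet> b)"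
  using assms(2)
proof (induction k arbitrary: f)
  case 0
  then show ?case by (auto intro: continuous_intros)
next
  case (Suc k)
  have hd: "((\<lambda>x. f x \<bullet> b) has_derivative (\<lambda>v. frechet_derivative f (at x) v \<bullet> b)) (at x)"
    if "x \<in> S" for x
    using Suc.prems that by (intro has_derivative_inner_left) (auto simp: frechet_derivative_works[symmetric])
  have fd: "frechet_derivative f (at x) v \<bullet> b = frechet_derivative (\<lambda>x. f x \<bullet> b) (at x) v"
    if "x \<in> S" for x v
    by (rule fun_cong[OF frechet_derivative_at[OF hd[OF that]]])
  have "Ck_on k S (\<lambda>x. frechet_derivative f (at x) v \<bullet> b)" for v
    using Suc by auto
  then have "Ck_on k S (\<lambda>x. frechet_derivative (\<lambda>x. f x \<bullet> b) (at x) v)" for v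
    by (rule Ck_on_cong[OF assms(1), THEN iffD1, rotated]) (rule fd)
  then show ?case using hd by (auto simp: differentiable_def)
qed

lemma Ck_on_sum:
  assumes "open S" "\<And>i. i \<in> I \<Longrightarrow> Ck_on k S (f i)"
  shows "Ck_on k S (\<lambda>x. \<Sum>i\<in>I. f i x)"
  using assms(2)
proof (induction I rule: infinite_finite_induct)
  case (insert i I)
  then show ?case by (auto intro!: Ck_on_add[OF assms(1)])
qed (auto intro: Ck_on_const)

text \<open>\<open>Ck_on\<close> differentiates only in fixed directions. Expanding in a basis
  reduces a direction that varies with the point to finitely many fixed ones.\<close>

lemma linear_eq_sum_Basis:
  fixes l :: "'a::euclidean_space \<Rightarrow> 'b::real_vector"
  assumes "linear l"
  shows "l v = (\<Sum>b\<in>Basis. (v \<bullet> b) *\<^sub>R l b)"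
proof -
  have "l v = l (\<Sum>b\<in>Basis. (v \<bullet> b) *\<^sub>R b)" by (simp add: euclidean_representation)
  also have "\<dots> = (\<Sum>b\<in>Basis. (v \<bullet> b) *\<^sub>R l b)"
    using assms by (simp add: linear_sum linear_scale)
  finally show ?thesis .
qed

lemma Ck_on_compose:
  fixes f :: "'a::euclidean_space \<Rightarrow> 'b::euclidean_space" and g :: "'b \<Rightarrow> 'c::real_normed_vector"
  assumes "open S" "open T" "Ck_on k S f" "Ck_on k T g" "f ` S \<subseteq> T"
  shows "Ck_on k S (\<lambda>x. g (f x))"
  using assms(3,4)
proof (induction k arbitrary: g)
  case 0
  then show ?case using assms(5) by (auto intro: continuous_on_compose2)
next
  case (Suc k)
  \<comment> \<open>The chain rule differentiates \<open>g\<close> in the direction of the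
    derivative of \<open>f\<close>, which moves with \<open>x\<close>. The expansion leaves
    derivatives of \<open>g\<close> in basis directions only, to which the induction hypothesis
    applies.\<close>
  let ?F = "\<lambda>x v. \<Sum>b\<in>Basis. (frechet_derivative f (at x) v \<bullet> b) *\<^sub>R frechet_derivative g (at (f x)) b"
  have gd: "(g has_derivative frechet_derivative g (at (f x))) (at (f x))" if "x \<in> S" for x
    using Suc.prems that assms(5) by (auto simp: image_subset_iff frechet_derivative_works[symmetric])
  have hd: "((\<lambda>x. g (f x)) has_derivative ?F x) (at x)" if "x \<in> S" for x
  proof -
    have "(f has_derivative frechet_derivative f (at x)) (at x)"
      using Suc.prems that by (auto simp: frechet_derivative_works[symmetric])
    from has_derivative_compose[OF this gd[OF that]]
    show ?thesis
      by (subst (asm) linear_eq_sum_Basis[OF has_derivative_linear[OF gd[OF that]]])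
  qed
  have fd: "?F x v = frechet_derivative (\<lambda>x. g (f x)) (at x) v" if "x \<in> S" for x v
    by (rule fun_cong[OF frechet_derivative_at[OF hd[OF that]]])
  have "Ck_on k S (\<lambda>x. ?F x v)" for v
    using Suc.prems
    by (intro Ck_on_sum Ck_on_scaleR Ck_on_inner Suc.IH assms(1)) (auto intro: Ck_on_Suc_imp)
  then have "Ck_on k S (\<lambda>x. frechet_derivative (\<lambda>x. g (f x)) (at x) v)" for v
    by (rule Ck_on_cong[OF assms(1), THEN iffD1, rotated]) (rule fd)
  then show ?case using hd by (auto simp: differentiable_def)
qed

lemma smooth_on_cong:
  "open S \<Longrightarrow> (\<And>x. x \<in> S \<Longrightarrow> f x = g x) \<Longrightarrow> smooth_on S f = smooth_on S g"
  unfolding smooth_on_def using Ck_on_cong by metis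

lemma smooth_on_subset: "smooth_on S f \<Longrightarrow> T \<subseteq> S \<Longrightarrow> smooth_on T f"
  unfolding smooth_on_def using Ck_on_subset by metis

lemma smooth_on_const: "smooth_on S (\<lambda>x. c)"
  unfolding smooth_on_def by (simp add: Ck_on_const)

lemma smooth_on_compose:
  fixes f :: "'a::euclidean_space \<Rightarrow> 'b::euclidean_space"
  assumes "open S" "open T" "smooth_on S f" "smooth_on T g" "f ` S \<subseteq> T"
  shows "smooth_on S (\<lambda>x. g (f x))"
  using assms unfolding smooth_on_def by (auto intro: Ck_on_compose)

lemma smooth_on_frechet_derivative:
  "smooth_on S f \<Longrightarrow> smooth_on S (\<lambda>x. frechet_derivative f (at x) v)"
  unfolding smooth_on_def by (metis Ck_on.simps(2))

lemma smooth_on_has_derivative: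
  "smooth_on S f \<Longrightarrow> x \<in> S \<Longrightarrow> (f has_derivative frechet_derivative f (at x)) (at x)"
  unfolding smooth_on_def by (metis Ck_on.simps(2) frechet_derivative_works)

lemma smooth_on_imp_continuous_on: "smooth_on S f \<Longrightarrow> continuous_on S f"
  unfolding smooth_on_def by (metis Ck_on.simps(1))

text \<open>The basis expansion turns continuity for each fixed direction into joint continuity, on
  which the compactness arguments over pairs of a point and a vector rest.\<close>

lemma smooth_on_continuous_derivative:
  assumes "smooth_on S f"
  shows "continuous_on (S \<times> UNIV) (\<lambda>(x, v). frechet_derivative f (at x) v)"
proof -
  have *: "continuous_on (S \<times> UNIV) (\<lambda>z. frechet_derivative f (at (fst z)) b)" for b
    using smooth_on_imp_continuous_on[OF smooth_on_frechet_derivative[OF assms]]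
    by (rule continuous_on_compose2) (auto intro: continuous_on_fst)
  have "continuous_on (S \<times> UNIV) (\<lambda>z. \<Sum>b\<in>Basis. (snd z \<bullet> b) *\<^sub>R frechet_derivative f (at (fst z)) b)"
    by (intro continuous_on_sum continuous_on_scaleR continuous_on_inner continuous_on_snd continuous_on_const
      continuous_on_id *)
  then show ?thesis
    by (rule continuous_on_eq)
      (auto simp: linear_eq_sum_Basis[OF has_derivative_linear[OF smooth_on_has_derivative[OF assms]], symmetric])
qed

section \<open>Euclidean estimates\<close>

text \<open>For fixed \<open>e\<close> the set where \<open>f t - e * t \<le> f 0\<close> is closed
  and contains 0. Its last point cannot lie before \<open>h\<close>, since \<open>dini\<close>
  extends the inequality a little to the right. Then \<open>e\<close> tends to 0.\<close>

lemma nonincreasing_if_upper_derivative_nonpos: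
  fixes f :: "real \<Rightarrow> real"
  assumes h: "0 \<le> h" and cont: "continuous_on {0..h} f"
    and dini: "\<And>t e. 0 \<le> t \<Longrightarrow> t < h \<Longrightarrow> 0 < e \<Longrightarrow>
      \<exists>d>0. \<forall>\<tau>. 0 < \<tau> \<and> \<tau> < d \<and> t + \<tau> \<le> h \<longrightarrow> f (t + \<tau>) \<le> f t + \<tau> * e"
  shows "f h \<le> f 0"
proof -
  have main: "f h \<le> f 0 + e * h" if e: "e > 0" for e
  proof -
    define S where "S = {t \<in> {0..h}. f t - e * t \<le> f 0}"
    have "closed S"
      unfolding S_def by (intro continuous_on_closed_Collect_le) (auto intro!: continuous_intros cont)
    moreover have "bounded S" by (rule bounded_subset[of "{0..h}"]) (auto simp: S_def)
    ultimately have "compact S" by (simp add: compact_eq_bounded_closed)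
    moreover have "0 \<in> S" using h by (auto simp: S_def)
    ultimately obtain t where t: "t \<in> S" "\<And>s. s \<in> S \<Longrightarrow> s \<le> t"
      using compact_attains_sup[of S] by blast
    have "t = h"
    proof (rule ccontr)
      assume "t \<noteq> h"
      then have th: "0 \<le> t" "t < h" using t(1) by (auto simp: S_def)
      then obtain d where d: "d > 0"
        "\<And>\<tau>. 0 < \<tau> \<Longrightarrow> \<tau> < d \<Longrightarrow> t + \<tau> \<le> h \<Longrightarrow> f (t + \<tau>) \<le> f t + \<tau> * e"
        using dini[OF th e] by blast
      define \<tau> where "\<tau> = min (d / 2) (h - t)"
      have \<tau>: "0 < \<tau>" "\<tau> < d" "t + \<tau> \<le> h" using d th by (auto simp: \<tau>_def)
      then have "t + \<tau> \<in> S" using d(2)[OF \<tau>] t(1) th by (auto simp: S_def algebra_simps)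
      then show False using t(2) \<tau>(1) by fastforce
    qed
    then show ?thesis using t(1) by (auto simp: S_def)
  qed
  show ?thesis
  proof (rule field_le_epsilon)
    fix e :: real assume "0 < e"
    \<comment> \<open>Dividing by \<open>h + 1\<close> instead of \<open>h\<close> covers
      \<open>h = 0\<close>.\<close>
    have "f h \<le> f 0 + e / (h + 1) * h" by (rule main) (use \<open>0 < e\<close> h in auto)
    also have "\<dots> \<le> f 0 + e" using \<open>0 < e\<close> h by (simp add: field_simps)
    finally show "f h \<le> f 0 + e" .
  qed
qed

text \<open>The weight \<open>exp (- \<nu> * t)\<close> turns growth at rate \<nu> into growth at
  rate 0, up to an error that can be chosen small.\<close>

lemma exponential_bound_if_upper_derivative_le:
  fixes D :: "real \<Rightarrow> real"
  assumes h: "0 \<le> h" and cont: "continuous_on {0..h} D"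
    and nonneg: "\<And>t. t \<in> {0..h} \<Longrightarrow> 0 \<le> D t"
    and dini: "\<And>t e. 0 \<le> t \<Longrightarrow> t < h \<Longrightarrow> 0 < e \<Longrightarrow>
      \<exists>d>0. \<forall>\<tau>. 0 < \<tau> \<and> \<tau> < d \<and> t + \<tau> \<le> h \<longrightarrow> D (t + \<tau>) \<le> D t + \<tau> * (\<nu> * D t + e)"
  shows "D h \<le> exp (\<nu> * h) * D 0"
proof -
  define f where "f t = exp (- \<nu> * t) * D t" for t
  have "f h \<le> f 0"
  proof (rule nonincreasing_if_upper_derivative_nonpos[OF h])
    show "continuous_on {0..h} f"
      unfolding f_def by (intro continuous_intros cont)
    fix t e :: real assume t: "0 \<le> t" "t < h" and e: "0 < e"
    \<comment> \<open>\<open>M\<close> bounds the weight at time \<open>t + \<tau>\<close> for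
      either sign of \<nu>, so that the error \<open>e / M\<close> is at most \<open>e\<close> after
      weighting.\<close>
    define M where "M = exp (\<bar>\<nu>\<bar> * h)"
    have M: "M > 0" by (simp add: M_def)
    obtain d where d: "d > 0" "\<And>\<tau>. 0 < \<tau> \<Longrightarrow> \<tau> < d \<Longrightarrow> t + \<tau> \<le> h \<Longrightarrow>
        D (t + \<tau>) \<le> D t + \<tau> * (\<nu> * D t + e / M)"
      using dini[OF t, of "e / M"] e M by auto
    have "f (t + \<tau>) \<le> f t + \<tau> * e" if \<tau>: "0 < \<tau>" "\<tau> < d" "t + \<tau> \<le> h" for \<tau>
    proof -
      let ?E = "exp (- \<nu> * (t + \<tau>))"
      have "- \<nu> * (t + \<tau>) \<le> \<bar>\<nu>\<bar> * (t + \<tau>)" using t \<tau> by (intro mult_right_mono) auto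
      also have "\<dots> \<le> \<bar>\<nu>\<bar> * h" using \<tau> by (intro mult_left_mono) auto
      finally have EM: "?E \<le> M" by (simp add: M_def)
      have "f (t + \<tau>) \<le> ?E * (D t + \<tau> * (\<nu> * D t + e / M))"
        unfolding f_def by (intro mult_left_mono d(2) \<tau>) auto
      also have "\<dots> = exp (- \<nu> * t) * (exp (- (\<nu> * \<tau>)) * (1 + \<nu> * \<tau>)) * D t + ?E * (\<tau> * (e / M))"
        by (simp add: algebra_simps exp_add[symmetric] add_divide_distrib)
      \<comment> \<open>The weight absorbs the first-order growth factor by
        \<open>1 + x \<le> exp x\<close>; replacing the product by 1 uses
        \<open>0 \<le> D t\<close>.\<close>
      also have "\<dots> \<le> exp (- \<nu> * t) * 1 * D t + M * (\<tau> * (e / M))"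
      proof (intro add_mono mult_right_mono mult_left_mono)
        have "1 + \<nu> * \<tau> \<le> exp (\<nu> * \<tau>)" by (rule exp_ge_add_one_self)
        then show "exp (- (\<nu> * \<tau>)) * (1 + \<nu> * \<tau>) \<le> 1"
          by (simp add: exp_minus divide_simps mult.commute)
      qed (use EM e M \<tau> t nonneg[of t] in auto)
      also have "\<dots> = f t + \<tau> * e" using M by (simp add: f_def)
      finally show ?thesis .
    qed
    then show "\<exists>d>0. \<forall>\<tau>. 0 < \<tau> \<and> \<tau> < d \<and> t + \<tau> \<le> h \<longrightarrow> f (t + \<tau>) \<le> f t + \<tau> * e"
      using d(1) by blast
  qed
  then show ?thesis by (simp add: f_def exp_minus field_simps)
qed

section \<open>The metric in one coordinate domain\<close>

locale coordinate_metric =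
  fixes \<Omega> :: "'e::euclidean_space set" and G :: "'e \<Rightarrow> 'e \<Rightarrow> 'e \<Rightarrow> real"
  assumes open_domain: "open \<Omega>"
    and bilinear_G: "\<And>x. x \<in> \<Omega> \<Longrightarrow> bilinear (G x)"
    and G_sym: "\<And>x u v. x \<in> \<Omega> \<Longrightarrow> G x u v = G x v u"
    and G_pos: "\<And>x v. x \<in> \<Omega> \<Longrightarrow> v \<noteq> 0 \<Longrightarrow> 0 < G x v v"
    and smooth_G: "\<And>u v. smooth_on \<Omega> (\<lambda>x. G x u v)"
begin

lemmas G_simps = bilinear_ladd[OF bilinear_G] bilinear_radd[OF bilinear_G]
  bilinear_lmul[OF bilinear_G] bilinear_rmul[OF bilinear_G]

lemma G_nonneg: "x \<in> \<Omega> \<Longrightarrow> 0 \<le> G x v v"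
  using G_pos[of x v] bilinear_lzero[OF bilinear_G] by (cases "v = 0") (auto intro: less_imp_le)

text \<open>Smoothness of \<open>G\<close> is given for constant arguments only. The expansion
  reduces arguments that vary with the point to this case, here and for the derivative
  \<open>DG\<close>.\<close>

lemma G_expand:
  assumes "x \<in> \<Omega>"
  shows "G x u w = (\<Sum>i\<in>Basis. \<Sum>j\<in>Basis. (u \<bullet> i) * (w \<bullet> j) * G x i j)"
proof -
  have l: "linear (\<lambda>u. G x u w)" "linear (G x u)" for u w
    using bilinear_G[OF assms] by (auto simp: bilinear_def)
  have "G x u w = (\<Sum>i\<in>Basis. (u \<bullet> i) * G x i w)"
    using linear_eq_sum_Basis[OF l(1), of u w] by simp
  also have "\<dots> = (\<Sum>i\<in>Basis. (u \<bullet> i) * (\<Sum>j\<in>Basis. (w \<bullet> j) * G x i j))"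
    using linear_eq_sum_Basis[OF l(2), of _ w] by simp
  finally show ?thesis by (simp add: sum_distrib_left mult.assoc)
qed

abbreviation DG :: "'e \<Rightarrow> 'e \<Rightarrow> 'e \<Rightarrow> 'e \<Rightarrow> real" where
  "DG x u w \<equiv> frechet_derivative (\<lambda>y. G y u w) (at x)"

lemma has_derivative_G: "x \<in> \<Omega> \<Longrightarrow> ((\<lambda>y. G y u w) has_derivative DG x u w) (at x)"
  by (rule smooth_on_has_derivative[OF smooth_G])

lemma DG_expand:
  assumes "x \<in> \<Omega>"
  shows "DG x u w z = (\<Sum>i\<in>Basis. \<Sum>j\<in>Basis. (u \<bullet> i) * (w \<bullet> j) * DG x i j z)"
proof -
  have "((\<lambda>y. \<Sum>i\<in>Basis. \<Sum>j\<in>Basis. (u \<bullet> i) * (w \<bullet> j) * G y i j) has_derivative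
    (\<lambda>z. \<Sum>i\<in>Basis. \<Sum>j\<in>Basis. (u \<bullet> i) * (w \<bullet> j) * DG x i j z)) (at x)"
    by (intro has_derivative_sum has_derivative_mult_right has_derivative_G assms)
  then have "((\<lambda>y. G y u w) has_derivative
    (\<lambda>z. \<Sum>i\<in>Basis. \<Sum>j\<in>Basis. (u \<bullet> i) * (w \<bullet> j) * DG x i j z)) (at x)"
    by (rule has_derivative_transform_within_open[OF _ open_domain assms]) (simp add: G_expand)
  from fun_cong[OF frechet_derivative_at[OF this]] show ?thesis by simp
qed

lemma continuous_on_G:
  assumes "continuous_on S x" "continuous_on S u" "continuous_on S w" "x ` S \<subseteq> \<Omega>"
  shows "continuous_on S (\<lambda>s. G (x s) (u s) (w s))"
proof -
  have "continuous_on S (\<lambda>s. G (x s) i j)" for i j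
    by (rule continuous_on_compose2[OF smooth_on_imp_continuous_on[OF smooth_G] assms(1,4)])
  then have "continuous_on S (\<lambda>s. \<Sum>i\<in>Basis. \<Sum>j\<in>Basis. (u s \<bullet> i) * (w s \<bullet> j) * G (x s) i j)"
    by (intro continuous_on_sum continuous_on_mult continuous_on_inner continuous_on_const assms)
  then show ?thesis
    by (rule continuous_on_eq) (use assms(4) in \<open>simp add: G_expand[symmetric] image_subset_iff\<close>)
qed

lemma continuous_on_DG:
  assumes "continuous_on S x" "continuous_on S u" "continuous_on S w" "continuous_on S z" "x ` S \<subseteq> \<Omega>"
  shows "continuous_on S (\<lambda>s. DG (x s) (u s) (w s) (z s))"
proof -
  have "continuous_on S (\<lambda>s. DG (x s) i j (z s))" for i j
    using continuous_on_compose2[OF smooth_on_continuous_derivative[OF smooth_G[of i j]],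
      of S "\<lambda>s. (x s, z s)"] assms by (auto intro!: continuous_on_Pair)
  then have "continuous_on S (\<lambda>s. \<Sum>i\<in>Basis. \<Sum>j\<in>Basis. (u s \<bullet> i) * (w s \<bullet> j) * DG (x s) i j (z s))"
    by (intro continuous_on_sum continuous_on_mult continuous_on_inner continuous_on_const assms)
  then show ?thesis
    by (rule continuous_on_eq) (use assms(5) in \<open>simp add: DG_expand[symmetric] image_subset_iff\<close>)
qed

text \<open>By compactness \<open>X\<close> is bounded by some \<open>B\<close> on \<open>K\<close>,
  and one radius \<open>r\<close> of balls inside the domain serves all points; a step of size at
  most \<open>r / B\<close> moves a point by at most \<open>r\<close>.\<close>

lemma euler_step_in_domain:
  assumes "compact K" "K \<subseteq> \<Omega>" "continuous_on K X"
  obtains \<delta> where "0 < \<delta>" "\<And>x \<tau>. x \<in> K \<Longrightarrow> \<bar>\<tau>\<bar> \<le> \<delta> \<Longrightarrow> x + \<tau> *\<^sub>R X x \<in> \<Omega>"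
proof -
  obtain r where r: "r > 0" "(\<Union>x\<in>K. cball x r) \<subseteq> \<Omega>"
    using compact_subset_open_imp_cball_epsilon_subset[OF assms(1) open_domain assms(2)] by metis
  obtain B where B: "B > 0" "\<And>x. x \<in> K \<Longrightarrow> norm (X x) \<le> B"
    using compact_imp_bounded[OF compact_continuous_image[OF assms(3,1)]]
    by (auto simp: bounded_pos)
  show ?thesis
  proof
    show "0 < r / B" using r B by simp
    fix x \<tau> assume x: "x \<in> K" and \<tau>: "\<bar>\<tau>\<bar> \<le> r / B"
    have "norm (\<tau> *\<^sub>R X x) \<le> r / B * B"
      using B r mult_mono[OF \<tau> B(2)[OF x]] by simp
    then have "x + \<tau> *\<^sub>R X x \<in> cball x r" using B by (simp add: dist_norm)
    then show "x + \<tau> *\<^sub>R X x \<in> \<Omega>" using r x by blast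
  qed
qed

text \<open>The hypothesis \<open>lie\<close> bounds the Lie derivative of the metric along \<open>X\<close>; it is the
  coordinate form of the monotonicity condition.\<close>

lemma euler_step_growth:
  assumes K: "compact K" "K \<subseteq> \<Omega>" and X: "smooth_on \<Omega> X"
    and lie: "\<And>x v. x \<in> K \<Longrightarrow>
      DG x v v (X x) + 2 * G x (frechet_derivative X (at x) v) v \<le> 2 * \<nu> * G x v v"
    and e: "0 < e"
  obtains \<delta> where "0 < \<delta>" "\<And>x \<tau>. x \<in> K \<Longrightarrow> 0 \<le> \<tau> \<Longrightarrow> \<tau> \<le> \<delta> \<Longrightarrow> x + \<tau> *\<^sub>R X x \<in> \<Omega>"
    "\<And>x \<tau> v. x \<in> K \<Longrightarrow> 0 \<le> \<tau> \<Longrightarrow> \<tau> \<le> \<delta> \<Longrightarrow>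
      G (x + \<tau> *\<^sub>R X x) (v + \<tau> *\<^sub>R frechet_derivative X (at x) v) (v + \<tau> *\<^sub>R frechet_derivative X (at x) v)
      \<le> (1 + \<tau> * (2 * \<nu> + e)) * G x v v"
proof -
  define A where "A x = frechet_derivative X (at x)" for x
  have linA: "linear (A x)" if "x \<in> \<Omega>" for x
    unfolding A_def by (rule has_derivative_linear[OF smooth_on_has_derivative[OF X that]])
  have contX: "continuous_on K X"
    using smooth_on_imp_continuous_on[OF X] K(2) by (rule continuous_on_subset)
  obtain d0 where d0: "0 < d0" "\<And>x \<tau>. x \<in> K \<Longrightarrow> \<bar>\<tau>\<bar> \<le> d0 \<Longrightarrow> x + \<tau> *\<^sub>R X x \<in> \<Omega>"
    using euler_step_in_domain[OF K contX] by metis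
  \<comment> \<open>\<open>E\<close> is the squared norm after the step. By bilinearity it is a
    quadratic polynomial in \<tau> whose coefficients are evaluated at the moving base point.
    \<open>E'\<close> is its derivative by the product rule; at \<tau> = 0 it is the left side of
    \<open>lie\<close>.\<close>
  define E where "E \<tau> x v = G (x + \<tau> *\<^sub>R X x) (v + \<tau> *\<^sub>R A x v) (v + \<tau> *\<^sub>R A x v)" for \<tau> x v
  define E' where "E' \<tau> x v = (let y = x + \<tau> *\<^sub>R X x; w = A x v in
      DG y v v (X x) + 2 * G y w v + 2 * \<tau> * DG y w v (X x) + 2 * \<tau> * G y w w + \<tau>\<^sup>2 * DG y w w (X x))"
    for \<tau> x v
  have deriv: "((\<lambda>\<tau>. E \<tau> x v) has_real_derivative E' \<tau> x v) (at \<tau> within {0..d0})"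
    if x: "x \<in> K" and \<tau>: "\<tau> \<in> {0..d0}" for x \<tau> v
  proof -
    let ?w = "A x v"
    have y: "((\<lambda>\<tau>. x + \<tau> *\<^sub>R X x) has_derivative (\<lambda>s. s *\<^sub>R X x)) (at \<tau> within {0..d0})"
      by (auto intro!: derivative_eq_intros)
    have g: "((\<lambda>\<tau>. G (x + \<tau> *\<^sub>R X x) a b) has_real_derivative DG (x + \<tau> *\<^sub>R X x) a b (X x))
        (at \<tau> within {0..d0})" for a b
    proof -
      have in\<Omega>: "x + \<tau> *\<^sub>R X x \<in> \<Omega>" using d0(2)[OF x] \<tau> by simp
      show ?thesis
        using has_derivative_compose[OF y has_derivative_G[OF in\<Omega>, of a b]]
          linear_scale[OF has_derivative_linear[OF has_derivative_G[OF in\<Omega>, of a b]]]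
        by (simp add: has_field_derivative_def mult_commute_abs)
    qed
    have "((\<lambda>\<tau>. G (x + \<tau> *\<^sub>R X x) v v + 2 * \<tau> * G (x + \<tau> *\<^sub>R X x) ?w v + \<tau>\<^sup>2 * G (x + \<tau> *\<^sub>R X x) ?w ?w)
       has_real_derivative E' \<tau> x v) (at \<tau> within {0..d0})"
      by (auto intro!: derivative_eq_intros g simp: E'_def Let_def algebra_simps)
    then show ?thesis
    proof (rule has_field_derivative_transform_within[OF _ zero_less_one \<tau>])
      fix s assume "s \<in> {0..d0}"
      then have "x + s *\<^sub>R X x \<in> \<Omega>" using d0(2)[OF x] by simp
      then show "G (x + s *\<^sub>R X x) v v + 2 * s * G (x + s *\<^sub>R X x) ?w v + s\<^sup>2 * G (x + s *\<^sub>R X x) ?w ?w = E s x v"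
        using G_sym[of "x + s *\<^sub>R X x" v ?w]
        by (simp add: E_def G_simps algebra_simps power2_eq_square)
    qed
  qed
  \<comment> \<open>Both sides of the claim are homogeneous of degree two in \<open>v\<close>, so
    unit vectors suffice, and with them the parameter set is compact.\<close>
  let ?T = "{0..d0} \<times> (K \<times> sphere (0::'e) 1)"
  have cont: "continuous_on ?T (\<lambda>(\<tau>, x, v). E' \<tau> x v)"
  proof -
    have fs: "continuous_on ?T (\<lambda>z. fst z)" "continuous_on ?T (\<lambda>z. fst (snd z))"
      "continuous_on ?T (\<lambda>z. snd (snd z))"
      by (intro continuous_intros)+
    have cX: "continuous_on ?T (\<lambda>z. X (fst (snd z)))"
      by (rule continuous_on_compose2[OF contX fs(2)]) auto
    have cA: "continuous_on ?T (\<lambda>z. A (fst (snd z)) (snd (snd z)))"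
    proof -
      have "continuous_on ?T (\<lambda>z. snd z)" "(\<lambda>z. snd z) ` ?T \<subseteq> \<Omega> \<times> UNIV"
        using K(2) by (auto intro!: continuous_intros)
      from continuous_on_compose2[OF smooth_on_continuous_derivative[OF X] this]
      show ?thesis by (simp add: A_def case_prod_beta)
    qed
    have cy: "continuous_on ?T (\<lambda>z. fst (snd z) + fst z *\<^sub>R X (fst (snd z)))"
      by (intro continuous_intros fs cX)
    have im: "(\<lambda>z. fst (snd z) + fst z *\<^sub>R X (fst (snd z))) ` ?T \<subseteq> \<Omega>"
      using d0(2) by auto
    show ?thesis
      unfolding E'_def Let_def case_prod_beta
      by (intro continuous_on_add continuous_on_mult continuous_on_power continuous_on_const
        continuous_on_G continuous_on_DG fs cX cA cy im)
  qed
  have comp: "compact ?T" by (intro compact_Times K) auto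
  have cG: "continuous_on (K \<times> sphere (0::'e) 1) (\<lambda>z. G (fst z) (snd z) (snd z))"
    using K(2) by (intro continuous_on_G continuous_intros) auto
  \<comment> \<open>The lower bound \<open>m\<close> converts the additive error
    \<open>e * m\<close> of uniform continuity into the relative error \<open>e * G x v v\<close>.
    If there are no parameters, any \<open>m\<close> works.\<close>
  obtain m where m: "m > 0" "\<And>x v. x \<in> K \<Longrightarrow> norm v = 1 \<Longrightarrow> m \<le> G x v v"
  proof (cases "K \<times> sphere (0::'e) 1 = {}")
    case False
    obtain z where z: "z \<in> K \<times> sphere (0::'e) 1"
      "\<And>z'. z' \<in> K \<times> sphere (0::'e) 1 \<Longrightarrow> G (fst z) (snd z) (snd z) \<le> G (fst z') (snd z') (snd z')"
      using continuous_attains_inf[OF _ False cG] K(1) by (auto simp: compact_Times)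
    show ?thesis
    proof (rule that)
      show "0 < G (fst z) (snd z) (snd z)" using z(1) K(2) by (intro G_pos) auto
    qed (use z(2) in force)
  next
    case True
    then have "False" if "x \<in> K" "norm v = 1" for x v :: 'e using that by auto
    then show ?thesis using that[of 1] by auto
  qed
  \<comment> \<open>\<open>lie\<close> is information at \<tau> = 0 only; uniform continuity carries
    it to all \<tau> below a bound that is independent of \<open>x\<close> and
    \<open>v\<close>.\<close>
  have uc: "uniformly_continuous_on ?T (\<lambda>(\<tau>, x, v). E' \<tau> x v)"
    by (rule compact_uniformly_continuous[OF cont comp])
  have "0 < e * m" using e m(1) by simp
  from uc[unfolded uniformly_continuous_on_def, rule_format, OF this]
  obtain d1 where d1: "d1 > 0"
    "\<forall>z\<in>?T. \<forall>z'\<in>?T. dist z' z < d1 \<longrightarrow>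
      dist ((\<lambda>(\<tau>, x, v). E' \<tau> x v) z') ((\<lambda>(\<tau>, x, v). E' \<tau> x v) z) < e * m"
    by (elim exE conjE)
  define \<delta> where "\<delta> = min d0 (d1 / 2)"
  have \<delta>: "0 < \<delta>" "\<delta> \<le> d0" "\<delta> < d1" using d0 d1 by (auto simp: \<delta>_def)
  have E'_le: "E' \<tau> x v \<le> (2 * \<nu> + e) * G x v v"
    if "x \<in> K" "norm v = 1" "0 \<le> \<tau>" "\<tau> \<le> \<delta>" for \<tau> x v
  proof -
    have "dist (E' \<tau> x v) (E' 0 x v) < e * m"
      using d1(2)[rule_format, of "(0, x, v)" "(\<tau>, x, v)"] that \<delta> by (auto simp: dist_Pair_Pair)
    then have "E' \<tau> x v \<le> E' 0 x v + e * m" by (auto simp: dist_real_def)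
    also have "E' 0 x v \<le> 2 * \<nu> * G x v v"
      using lie[OF that(1), of v] by (simp add: E'_def A_def Let_def)
    also have "e * m \<le> e * G x v v" using m(2)[OF that(1,2)] e by simp
    finally show ?thesis by (simp add: algebra_simps)
  qed
  have unit: "E \<tau> x v \<le> (1 + \<tau> * (2 * \<nu> + e)) * G x v v"
    if "x \<in> K" "norm v = 1" "0 \<le> \<tau>" "\<tau> \<le> \<delta>" for \<tau> x v
  proof (cases "\<tau> = 0")
    case False
    then have "0 < \<tau>" using that by simp
    moreover have "((\<lambda>s. E s x v) has_derivative (*) (E' s x v)) (at s within {0..\<tau>})"
      if "0 \<le> s" "s \<le> \<tau>" for s
    proof -
      have "s \<in> {0..d0}" "{0..\<tau>} \<subseteq> {0..d0}" using that \<open>\<tau> \<le> \<delta>\<close> \<delta> by auto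
      then show ?thesis
        using deriv[OF \<open>x \<in> K\<close>, of s v] by (meson has_derivative_subset has_field_derivative_def)
    qed
    ultimately obtain \<theta> where "\<theta> \<in> {0<..<\<tau>}" "E \<tau> x v - E 0 x v = E' \<theta> x v * (\<tau> - 0)"
      using mvt_simple[of 0 \<tau> "\<lambda>s. E s x v" "\<lambda>s. (*) (E' s x v)"] by auto
    moreover have "E 0 x v = G x v v" by (simp add: E_def)
    ultimately have "E \<tau> x v = G x v v + \<tau> * E' \<theta> x v" "\<theta> \<in> {0<..<\<tau>}"
      by (auto simp: algebra_simps)
    moreover have "\<tau> * E' \<theta> x v \<le> \<tau> * ((2 * \<nu> + e) * G x v v)"
      using that \<open>\<theta> \<in> {0<..<\<tau>}\<close> by (intro mult_left_mono E'_le) auto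
    ultimately show ?thesis by (simp add: algebra_simps)
  qed (simp add: E_def)
  have gen: "E \<tau> x v \<le> (1 + \<tau> * (2 * \<nu> + e)) * G x v v"
    if x: "x \<in> K" and \<tau>: "0 \<le> \<tau>" "\<tau> \<le> \<delta>" for \<tau> x v
  proof (cases "v = 0")
    case True
    then show ?thesis
      using linear_0[OF linA] bilinear_lzero[OF bilinear_G] d0(2)[OF x, of \<tau>] \<tau> \<delta> x K(2)
      by (auto simp: E_def)
  next
    case False
    define u where "u = v /\<^sub>R norm v"
    have u: "norm u = 1" "v = norm v *\<^sub>R u" using False by (auto simp: u_def)
    have y: "x + \<tau> *\<^sub>R X x \<in> \<Omega>" using d0(2)[OF x, of \<tau>] \<tau> \<delta> by simp
    have x\<Omega>: "x \<in> \<Omega>" using x K(2) by blast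
    have "v + \<tau> *\<^sub>R A x v = norm v *\<^sub>R (u + \<tau> *\<^sub>R A x u)"
      by (subst (1 2) u(2)) (simp add: linear_scale[OF linA[OF x\<Omega>]] scaleR_add_right mult.commute)
    then have "E \<tau> x v = (norm v)\<^sup>2 * E \<tau> x u"
      by (simp add: E_def G_simps(3,4)[OF y] power2_eq_square)
    also have "\<dots> \<le> (norm v)\<^sup>2 * ((1 + \<tau> * (2 * \<nu> + e)) * G x u u)"
      by (intro mult_left_mono unit x u \<tau>) auto
    also have "\<dots> = (1 + \<tau> * (2 * \<nu> + e)) * G x v v"
      by (subst (2 3) u(2)) (simp add: G_simps(3,4)[OF x\<Omega>] power2_eq_square)
    finally show ?thesis .
  qed
  show ?thesis
  proof (rule that[OF \<delta>(1)])
    show "x + \<tau> *\<^sub>R X x \<in> \<Omega>" if "x \<in> K" "0 \<le> \<tau>" "\<tau> \<le> \<delta>" for x \<tau>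
      using d0(2)[OF that(1), of \<tau>] that \<delta> by simp
  qed (use gen in \<open>auto simp: E_def A_def\<close>)
qed

text \<open>With \<open>a = \<tau> * (\<nu> + e)\<close>, the bound on squared norms is
  \<open>1 + 2 * a\<close>, which is at most the square of \<open>1 + a\<close>; so roots grow at
  half the rate.\<close>

lemma euler_step_norm_growth:
  assumes "compact K" "K \<subseteq> \<Omega>" and X: "smooth_on \<Omega> X"
    and lie: "\<And>x v. x \<in> K \<Longrightarrow>
      DG x v v (X x) + 2 * G x (frechet_derivative X (at x) v) v \<le> 2 * \<nu> * G x v v"
    and e: "0 < e"
  obtains \<delta> where "0 < \<delta>" "\<And>x \<tau>. x \<in> K \<Longrightarrow> 0 \<le> \<tau> \<Longrightarrow> \<tau> \<le> \<delta> \<Longrightarrow> x + \<tau> *\<^sub>R X x \<in> \<Omega>"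
    "\<And>x \<tau> v. x \<in> K \<Longrightarrow> 0 \<le> \<tau> \<Longrightarrow> \<tau> \<le> \<delta> \<Longrightarrow>
      sqrt (G (x + \<tau> *\<^sub>R X x) (v + \<tau> *\<^sub>R frechet_derivative X (at x) v) (v + \<tau> *\<^sub>R frechet_derivative X (at x) v))
      \<le> (1 + \<tau> * (\<nu> + e)) * sqrt (G x v v)"
proof -
  obtain \<delta> where \<delta>: "0 < \<delta>" "\<And>x \<tau>. x \<in> K \<Longrightarrow> 0 \<le> \<tau> \<Longrightarrow> \<tau> \<le> \<delta> \<Longrightarrow> x + \<tau> *\<^sub>R X x \<in> \<Omega>"
    "\<And>x \<tau> v. x \<in> K \<Longrightarrow> 0 \<le> \<tau> \<Longrightarrow> \<tau> \<le> \<delta> \<Longrightarrow>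
      G (x + \<tau> *\<^sub>R X x) (v + \<tau> *\<^sub>R frechet_derivative X (at x) v) (v + \<tau> *\<^sub>R frechet_derivative X (at x) v)
      \<le> (1 + \<tau> * (2 * \<nu> + 2 * e)) * G x v v"
    using euler_step_growth[OF assms(1-3) lie, of "2 * e"] e by auto
  \<comment> \<open>The second bound keeps \<open>1 + \<tau> * (\<nu> + e)\<close> nonnegative for
    negative \<nu>, so that it is the root of its square.\<close>
  define d where "d = min \<delta> (1 / (\<bar>\<nu>\<bar> + e))"
  show ?thesis
  proof (rule that)
    show "0 < d" using \<delta> e by (auto simp: d_def)
    show "x + \<tau> *\<^sub>R X x \<in> \<Omega>" if "x \<in> K" "0 \<le> \<tau>" "\<tau> \<le> d" for x \<tau>
      using \<delta>(2) that by (auto simp: d_def)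
    fix x \<tau> v assume x: "x \<in> K" and \<tau>: "0 \<le> \<tau>" "\<tau> \<le> d"
    have "\<tau> * (\<bar>\<nu>\<bar> + e) \<le> 1" using \<tau> e by (auto simp: d_def field_simps)
    moreover have "- (\<tau> * (\<nu> + e)) \<le> \<tau> * (\<bar>\<nu>\<bar> + e)"
      using mult_left_mono[OF _ \<tau>(1), of "- (\<nu> + e)" "\<bar>\<nu>\<bar> + e"] e by (simp add: algebra_simps)
    ultimately have nn: "0 \<le> 1 + \<tau> * (\<nu> + e)" by linarith
    let ?v = "v + \<tau> *\<^sub>R frechet_derivative X (at x) v"
    have "G (x + \<tau> *\<^sub>R X x) ?v ?v \<le> (1 + \<tau> * (2 * \<nu> + 2 * e)) * G x v v"
      using \<delta>(3)[OF x \<tau>(1)] \<tau> by (simp add: d_def)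
    also have "\<dots> \<le> (1 + \<tau> * (\<nu> + e))\<^sup>2 * G x v v"
    proof (intro mult_right_mono G_nonneg)
      have "(1 + \<tau> * (\<nu> + e))\<^sup>2 = 1 + \<tau> * (2 * \<nu> + 2 * e) + (\<tau> * (\<nu> + e))\<^sup>2"
        by (simp add: power2_eq_square algebra_simps)
      then show "1 + \<tau> * (2 * \<nu> + 2 * e) \<le> (1 + \<tau> * (\<nu> + e))\<^sup>2" by simp
    qed (use x assms(2) in auto)
    finally have "sqrt (G (x + \<tau> *\<^sub>R X x) ?v ?v) \<le> sqrt ((1 + \<tau> * (\<nu> + e))\<^sup>2 * G x v v)"
      by simp
    then show "sqrt (G (x + \<tau> *\<^sub>R X x) ?v ?v) \<le> (1 + \<tau> * (\<nu> + e)) * sqrt (G x v v)"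
      using nn by (simp add: real_sqrt_mult)
  qed
qed

text \<open>Compactness of \<open>K\<close> times the unit sphere, then homogeneity. This compares
  Riemannian with Euclidean lengths in coordinates.\<close>

lemma G_upper_bound:
  assumes "compact K" "K \<subseteq> \<Omega>"
  obtains B where "0 \<le> B" "\<And>x v. x \<in> K \<Longrightarrow> sqrt (G x v v) \<le> B * norm v"
proof -
  let ?T = "K \<times> sphere (0::'e) 1"
  have cont: "continuous_on ?T (\<lambda>z. G (fst z) (snd z) (snd z))"
    using assms(2) by (intro continuous_on_G continuous_intros) auto
  have "compact ?T" using assms(1) by (simp add: compact_Times)
  from compact_imp_bounded[OF compact_continuous_image[OF cont this]]
  obtain B where B: "B > 0" "\<And>x v. x \<in> K \<Longrightarrow> norm v = 1 \<Longrightarrow> \<bar>G x v v\<bar> \<le> B"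
    by (auto simp: bounded_pos)
  have "sqrt (G x v v) \<le> sqrt B * norm v" if x: "x \<in> K" for x v
  proof (cases "v = 0")
    case True
    then show ?thesis using bilinear_lzero[OF bilinear_G] x assms(2) by auto
  next
    case False
    define u where "u = v /\<^sub>R norm v"
    have u: "norm u = 1" "v = norm v *\<^sub>R u" using False by (auto simp: u_def)
    have "x \<in> \<Omega>" using x assms(2) by blast
    have "G x v v = (norm v)\<^sup>2 * G x u u"
      by (subst (1 2) u(2)) (simp add: G_simps(3,4)[OF \<open>x \<in> \<Omega>\<close>] power2_eq_square)
    also have "\<dots> \<le> (norm v)\<^sup>2 * B" using B(2)[OF x u(1)] by (intro mult_left_mono) auto
    finally have "sqrt (G x v v) \<le> sqrt ((norm v)\<^sup>2 * B)" by simp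
    then show ?thesis by (simp add: real_sqrt_mult mult.commute)
  qed
  then show ?thesis using that[of "sqrt B"] B(1) by auto
qed

end

section \<open>Charts and the metric in coordinates\<close>

locale riemannian =
  fixes A :: "('m::{second_countable_topology,t2_space}, 'e::euclidean_space) chart set"
    and g :: "'m \<Rightarrow> ('m, 'e) tvec \<Rightarrow> ('m, 'e) tvec \<Rightarrow> real"
  assumes manifold: "riemannian_manifold A g"
begin

abbreviation coords :: "('m, 'e) chart \<Rightarrow> 'e set" where
  "coords c \<equiv> snd c ` fst c"

abbreviation transition :: "('m, 'e) chart \<Rightarrow> ('m, 'e) chart \<Rightarrow> 'e \<Rightarrow> 'e" where
  "transition c c' \<equiv> snd c' \<circ> inv_chart c"

abbreviation jacobian :: "('m, 'e) chart \<Rightarrow> ('m, 'e) chart \<Rightarrow> 'e \<Rightarrow> 'e \<Rightarrow> 'e" where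
  "jacobian c c' x \<equiv> frechet_derivative (transition c c') (at x)"

text \<open>Tangent vectors are families of components, so \<open>u\<close> is first turned into the
  tangent vector at that point whose component in \<open>c\<close> is \<open>u\<close>.\<close>

definition metric_coords :: "('m, 'e) chart \<Rightarrow> 'e \<Rightarrow> 'e \<Rightarrow> 'e \<Rightarrow> real" where
  "metric_coords c x u w =
    g (inv_chart c x) (coord_field A c u (inv_chart c x)) (coord_field A c w (inv_chart c x))"

lemma atlas: "smooth_atlas A" and metric: "riemannian_metric A g"
  using manifold by (auto simp: riemannian_manifold_def)

lemma chart_around: obtains c where "c \<in> A" "p \<in> fst c"
  using atlas unfolding smooth_atlas_def by blast

context
  fixes c assumes c: "c \<in> A"
begin

lemma chart_homeomorphism: "homeomorphism (fst c) (coords c) (snd c) (inv_chart c)"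
  and open_chart_domain: "open (fst c)" and open_coords: "open (coords c)"
  using atlas c by (auto simp: smooth_atlas_def is_chart_def)

lemma inv_chart_chart [simp]: "p \<in> fst c \<Longrightarrow> inv_chart c (snd c p) = p"
  using chart_homeomorphism by (simp add: homeomorphism_def)

lemma chart_inv_chart [simp]: "x \<in> coords c \<Longrightarrow> snd c (inv_chart c x) = x"
  using chart_homeomorphism by (rule homeomorphism_apply2)

lemma inv_chart_in [simp]: "x \<in> coords c \<Longrightarrow> inv_chart c x \<in> fst c"
  by auto

lemma continuous_on_chart: "continuous_on (fst c) (snd c)"
  and continuous_on_inv_chart: "continuous_on (coords c) (inv_chart c)"
  using chart_homeomorphism by (simp_all add: homeomorphism_def)

lemma chart_image_Int: "snd c ` (fst c \<inter> W) = coords c \<inter> inv_chart c -` W"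
proof
  show "coords c \<inter> inv_chart c -` W \<subseteq> snd c ` (fst c \<inter> W)"
  proof
    fix x assume "x \<in> coords c \<inter> inv_chart c -` W"
    then have "inv_chart c x \<in> fst c \<inter> W" "snd c (inv_chart c x) = x" by auto
    then show "x \<in> snd c ` (fst c \<inter> W)" by (metis imageI)
  qed
qed auto

lemma open_chart_image: "open W \<Longrightarrow> open (snd c ` (fst c \<inter> W))"
  unfolding chart_image_Int
  by (rule continuous_open_preimage[OF continuous_on_inv_chart open_coords])

end

lemma smooth_transition:
  "c \<in> A \<Longrightarrow> c' \<in> A \<Longrightarrow> smooth_on (snd c ` (fst c \<inter> fst c')) (transition c c')"
  using atlas by (simp add: smooth_atlas_def)

lemma transition_deriv:
  assumes "c \<in> A" "c' \<in> A" "p \<in> fst c" "p \<in> fst c'"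
  shows "(transition c c' has_derivative jacobian c c' (snd c p)) (at (snd c p))"
  by (rule smooth_on_has_derivative[OF smooth_transition]) (use assms in auto)

lemma linear_jacobian:
  assumes "c \<in> A" "c' \<in> A" "p \<in> fst c" "p \<in> fst c'"
  shows "linear (jacobian c c' (snd c p))"
  using transition_deriv[OF assms] by (rule has_derivative_linear)

lemma jacobian_self:
  assumes "c \<in> A" "p \<in> fst c"
  shows "jacobian c c (snd c p) u = u"
proof -
  have "(transition c c has_derivative (\<lambda>u. u)) (at (snd c p))"
    by (rule has_derivative_transform_within_open[OF has_derivative_ident open_coords[OF assms(1)]])
      (use assms in auto)
  from fun_cong[OF frechet_derivative_at[OF this]] show ?thesis by simp
qed

text \<open>The cocycle condition of the tangent bundle, from the chain rule on the overlap of three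
  charts. It makes the values of a coordinate field compatible families, that is, tangent
  vectors.\<close>

lemma jacobian_chain:
  assumes c: "c \<in> A" "c' \<in> A" "c'' \<in> A" and p: "p \<in> fst c" "p \<in> fst c'" "p \<in> fst c''"
  shows "jacobian c' c'' (snd c' p) (jacobian c c' (snd c p) u) = jacobian c c'' (snd c p) u"
proof -
  have pc: "snd c' p = transition c c' (snd c p)" using c p by simp
  have "((\<lambda>x. transition c' c'' (transition c c' x)) has_derivative
     (\<lambda>u. jacobian c' c'' (snd c' p) (jacobian c c' (snd c p) u))) (at (snd c p))"
    using has_derivative_compose[OF transition_deriv[OF c(1,2) p(1,2)]]
      transition_deriv[OF c(2,3) p(2,3)] pc by metis
  then have "(transition c c'' has_derivative
     (\<lambda>u. jacobian c' c'' (snd c' p) (jacobian c c' (snd c p) u))) (at (snd c p))"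
  proof (rule has_derivative_transform_within_open)
    show "open (snd c ` (fst c \<inter> (fst c' \<inter> fst c'')))"
      using c by (intro open_chart_image open_Int open_chart_domain)
  qed (use c p in auto)
  from fun_cong[OF frechet_derivative_at[OF this]] show ?thesis by simp
qed

lemma coord_field_apply:
  "c' \<in> A \<Longrightarrow> p \<in> fst c \<Longrightarrow> p \<in> fst c' \<Longrightarrow> coord_field A c u p c' = jacobian c c' (snd c p) u"
  by (simp add: coord_field_def)

lemma coord_field_self: "c \<in> A \<Longrightarrow> p \<in> fst c \<Longrightarrow> coord_field A c u p c = u"
  by (simp add: coord_field_apply jacobian_self)

lemma tangentI:
  assumes "\<And>c. c \<notin> A \<or> p \<notin> fst c \<Longrightarrow> v c = 0"
    and "\<And>c c'. c \<in> A \<Longrightarrow> c' \<in> A \<Longrightarrow> p \<in> fst c \<Longrightarrow> p \<in> fst c' \<Longrightarrow> v c' = jacobian c c' (snd c p) (v c)"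
  shows "v \<in> tangent_space A p"
  using assms unfolding tangent_space_def by blast

lemma tangent_compatible:
  assumes "v \<in> tangent_space A p" "c \<in> A" "c' \<in> A" "p \<in> fst c" "p \<in> fst c'"
  shows "v c' = jacobian c c' (snd c p) (v c)"
  using assms unfolding tangent_space_def by blast

lemma tangent_zero:
  assumes "v \<in> tangent_space A p" "c \<notin> A \<or> p \<notin> fst c"
  shows "v c = 0"
  using assms unfolding tangent_space_def by blast

lemma coord_field_tangent:
  assumes "c \<in> A" "p \<in> fst c"
  shows "coord_field A c u p \<in> tangent_space A p"
proof (rule tangentI)
  fix c' c'' assume "c' \<in> A" "c'' \<in> A" "p \<in> fst c'" "p \<in> fst c''"
  then show "coord_field A c u p c'' = jacobian c' c'' (snd c' p) (coord_field A c u p c')"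
    using assms by (simp only: coord_field_apply jacobian_chain)
qed (auto simp: coord_field_def)

text \<open>One component determines a tangent vector: Jacobians give the components in the other
  charts around the point, and the rest are normalised to 0. Hence \<open>g\<close> can be computed
  in a single chart.\<close>

lemma tangent_eq_coord_field:
  assumes "c \<in> A" "p \<in> fst c" "v \<in> tangent_space A p"
  shows "coord_field A c (v c) p = v"
proof
  fix c'
  show "coord_field A c (v c) p c' = v c'"
  proof (cases "c' \<in> A \<and> p \<in> fst c'")
    case True
    then show ?thesis
      using tangent_compatible[of v p c c'] assms by (simp only: coord_field_apply)
  next
    case False
    then show ?thesis
      using tangent_zero[of v p c'] assms(3) by (auto simp: coord_field_def)
  qed
qed

lemma coord_field_linear:
  assumes "c \<in> A" "p \<in> fst c"
  shows "coord_field A c (a *\<^sub>R u + w) p = tv_add (tv_scale a (coord_field A c u p)) (coord_field A c w p)"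
proof
  fix c'
  show "coord_field A c (a *\<^sub>R u + w) p c' =
      tv_add (tv_scale a (coord_field A c u p)) (coord_field A c w p) c'"
  proof (cases "c' \<in> A \<and> p \<in> fst c'")
    case True
    then have "linear (jacobian c c' (snd c p))" using assms by (intro linear_jacobian) auto
    then show ?thesis using True assms
      by (simp add: tv_add_def tv_scale_def coord_field_apply linear_add linear_scale del: comp_apply)
  qed (auto simp: coord_field_def tv_add_def tv_scale_def)
qed

text \<open>In another chart the component is a Jacobian composed with a transition map. Smoothness
  on the chart domain is what allows the axioms of the metric and of the connection to be applied to
  coordinate fields.\<close>

lemma smooth_coord_field:
  assumes "c \<in> A"
  shows "smooth_vfield_on A (fst c) (coord_field A c u)"
  unfolding smooth_vfield_on_def
proof (intro conjI ballI)
  fix c' assume c': "c' \<in> A"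
  let ?S = "snd c' ` (fst c' \<inter> fst c)" and ?T = "snd c ` (fst c \<inter> fst c')"
  have o: "open ?S" "open ?T"
    using assms c' by (auto intro: open_chart_image open_chart_domain)
  have "smooth_on ?S (\<lambda>x. jacobian c c' (transition c' c x) u)"
    by (rule smooth_on_compose[OF o smooth_transition[OF c' assms]
       smooth_on_frechet_derivative[OF smooth_transition[OF assms c']]])
      (use c' in \<open>auto intro!: imageI\<close>)
  then show "smooth_on ?S (\<lambda>x. coord_field A c u (inv_chart c' x) c')"
    by (rule smooth_on_cong[OF o(1), THEN iffD1, rotated]) (use assms c' in \<open>auto simp: coord_field_def\<close>)
qed (use assms in \<open>auto intro: coord_field_tangent open_chart_domain\<close>)

lemma smooth_vfield_restrict:
  assumes "smooth_vfield_on A W Y" "open V" "V \<subseteq> W"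
  shows "smooth_vfield_on A V Y"
  using assms unfolding smooth_vfield_on_def
  by (meson Int_mono image_mono order_refl smooth_on_subset subsetD)

lemma metric_linear:
  assumes "u \<in> tangent_space A p" "v \<in> tangent_space A p" "w \<in> tangent_space A p"
  shows "g p (tv_add (tv_scale a u) v) w = a * g p u w + g p v w"
  using metric assms unfolding riemannian_metric_def by blast

lemma metric_commute:
  assumes "u \<in> tangent_space A p" "v \<in> tangent_space A p"
  shows "g p u v = g p v u"
  using metric assms unfolding riemannian_metric_def by blast

lemma metric_pos:
  assumes "v \<in> tangent_space A p" "v \<noteq> (\<lambda>_. 0)"
  shows "0 < g p v v"
  using metric assms unfolding riemannian_metric_def by blast

lemma metric_eq_coords:
  assumes "c \<in> A" "p \<in> fst c" "v \<in> tangent_space A p" "w \<in> tangent_space A p"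
  shows "g p v w = metric_coords c (snd c p) (v c) (w c)"
  using assms by (simp add: metric_coords_def tangent_eq_coord_field)

lemma coordinate_metric_coords:
  assumes c: "c \<in> A"
  shows "coordinate_metric (coords c) (metric_coords c)"
proof
  show "open (coords c)" using c by (rule open_coords)
next
  fix x assume x: "x \<in> coords c"
  let ?p = "inv_chart c x"
  have p: "?p \<in> fst c" using x c by simp
  note T = coord_field_tangent[OF c p]
  note lin = coord_field_linear[OF c p]
  show sym: "metric_coords c x u v = metric_coords c x v u" for u v
    unfolding metric_coords_def by (rule metric_commute[OF T T])
  have l: "metric_coords c x (a *\<^sub>R u + w) v = a * metric_coords c x u v + metric_coords c x w v" for a u w v
    unfolding metric_coords_def lin by (rule metric_linear[OF T T T])
  \<comment> \<open>All vectors are 0, and the factor -1 makes the two terms on the right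
    cancel.\<close>
  have l0: "metric_coords c x 0 v = 0" for v using l[of "-1" 0 0 v] by simp
  have L1: "linear (\<lambda>u. metric_coords c x u v)" for v
    using l[of 1 _ _ v] l[of _ _ 0 v] l0 by (intro linearI) auto
  have L2: "linear (metric_coords c x v)" for v
  proof -
    have eq: "metric_coords c x v = (\<lambda>u. metric_coords c x u v)"
      by (intro ext sym)
    show ?thesis by (subst eq) (rule L1)
  qed
  show "bilinear (metric_coords c x)"
    unfolding bilinear_def using L1 L2 by blast
  fix v :: 'e assume "v \<noteq> 0"
  then have "coord_field A c v ?p \<noteq> (\<lambda>_. 0)"
    using coord_field_self[OF c p, of v] by metis
  then show "0 < metric_coords c x v v"
    unfolding metric_coords_def by (rule metric_pos[OF T])
next
  fix u v
  have "smooth_fun_on A (fst c) (\<lambda>p. g p (coord_field A c u p) (coord_field A c v p))"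
    using metric smooth_coord_field[OF c] unfolding riemannian_metric_def by blast
  then show "smooth_on (coords c) (\<lambda>x. metric_coords c x u v)"
    using c unfolding smooth_fun_on_def metric_coords_def by fastforce
qed

lemma metric_nonneg: "v \<in> tangent_space A p \<Longrightarrow> 0 \<le> g p v v"
  by (metis chart_around coordinate_metric.G_nonneg coordinate_metric_coords imageI metric_eq_coords)

text \<open>Torsion-freeness turns \<open>\<nabla>\<^sub>X V\<close> for a coordinate field \<open>V\<close> into \<open>\<nabla>\<^sub>V X + [X, V]\<close>, so metric
  compatibility gives \<open>X\<langle>V, V\<rangle> = 2 \<langle>\<nabla>\<^sub>V X, V\<rangle> + 2 \<langle>[X, V], V\<rangle>\<close>.\<close>

lemma lie_derivative_metric:
  assumes conn: "levi_civita A g nabla" and X: "smooth_vfield_on A UNIV X"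
    and c: "c \<in> A" and p: "p \<in> fst c"
  defines "x \<equiv> snd c p" and "Xc \<equiv> \<lambda>x. X (inv_chart c x) c"
  shows "frechet_derivative (\<lambda>y. metric_coords c y v v) (at x) (Xc x)
      + 2 * metric_coords c x (frechet_derivative Xc (at x) v) v
    = 2 * g p (nabla p (coord_field A c v p) X) (coord_field A c v p)"
proof -
  interpret coordinate_metric "coords c" "metric_coords c" by (rule coordinate_metric_coords[OF c])
  let ?V = "coord_field A c v"
  have o: "open (fst c)" using c by (rule open_chart_domain)
  have V: "smooth_vfield_on A (fst c) ?V" using c by (rule smooth_coord_field)
  have Xs: "smooth_vfield_on A (fst c) X" by (rule smooth_vfield_restrict[OF X o]) simp
  have x: "x \<in> coords c" "inv_chart c x = p" using c p by (auto simp: x_def)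
  have TX: "X p \<in> tangent_space A p" using X unfolding smooth_vfield_on_def by blast
  have TV: "?V p \<in> tangent_space A p" by (rule coord_field_tangent[OF c p])
  \<comment> \<open>The axioms of a connection speak of two fields and a function at once, so some
    smooth function has to be supplied.\<close>
  have f1: "smooth_fun_on A (fst c) (\<lambda>_. 0)"
    using o by (simp add: smooth_fun_on_def smooth_on_const)
  have TN: "nabla p w Y \<in> tangent_space A p"
    if "w \<in> tangent_space A p" "smooth_vfield_on A (fst c) Y" for w Y
    using conn that p f1 unfolding levi_civita_def affine_connection_def by blast
  have TXV: "nabla p (X p) ?V \<in> tangent_space A p" and TVX: "nabla p (?V p) X \<in> tangent_space A p"
    using TN TX TV V Xs by auto
  have "tv_diff (nabla p (X p) ?V) (nabla p (?V p) X) = lie_bracket A X ?V p"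
    using conn V Xs p unfolding levi_civita_def torsion_free_def by blast
  from fun_cong[OF this, of c]
  have "nabla p (X p) ?V c - nabla p (?V p) X c =
    frechet_derivative (\<lambda>y. ?V (inv_chart c y) c) (at x) (X p c) - frechet_derivative Xc (at x) (?V p c)"
    using c p by (simp add: tv_diff_def lie_bracket_def x_def Xc_def)
  \<comment> \<open>The component of a coordinate field in its own chart is constant, so only the
    derivative of \<open>X\<close> remains of the Lie bracket.\<close>
  moreover have "frechet_derivative (\<lambda>y. ?V (inv_chart c y) c) (at x) = (\<lambda>_. 0)"
  proof -
    have "((\<lambda>y. ?V (inv_chart c y) c) has_derivative (\<lambda>_. 0)) (at x)"
      by (rule has_derivative_transform_within_open[OF has_derivative_const[of v] open_coords[OF c] x(1)])
        (use c in \<open>simp add: coord_field_self\<close>)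
    from frechet_derivative_at[OF this] show ?thesis by simp
  qed
  ultimately have comp: "nabla p (X p) ?V c = nabla p (?V p) X c - frechet_derivative Xc (at x) v"
    using coord_field_self[OF c p, of v] by (simp add: algebra_simps)
  have "vec_deriv c p (X p) (\<lambda>q. g q (?V q) (?V q)) =
      g p (nabla p (X p) ?V) (?V p) + g p (?V p) (nabla p (X p) ?V)"
    using conn V c p TX unfolding levi_civita_def metric_compatible_def by blast
  also have "g p (?V p) (nabla p (X p) ?V) = g p (nabla p (X p) ?V) (?V p)"
    by (rule metric_commute[OF TV TXV])
  finally have "vec_deriv c p (X p) (\<lambda>q. g q (?V q) (?V q)) = 2 * g p (nabla p (X p) ?V) (?V p)"
    by simp
  moreover have "vec_deriv c p (X p) (\<lambda>q. g q (?V q) (?V q)) =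
      frechet_derivative (\<lambda>y. metric_coords c y v v) (at x) (Xc x)"
    using x by (simp add: vec_deriv_def metric_coords_def x_def Xc_def)
  moreover have "g p (nabla p (X p) ?V) (?V p) =
      metric_coords c x (nabla p (?V p) X c) v - metric_coords c x (frechet_derivative Xc (at x) v) v"
    unfolding metric_eq_coords[OF c p TXV TV] comp coord_field_self[OF c p] x_def[symmetric]
    by (rule bilinear_lsub[OF bilinear_G[OF x(1)]])
  moreover have "metric_coords c x (nabla p (?V p) X c) v = g p (nabla p (?V p) X) (?V p)"
    unfolding metric_eq_coords[OF c p TVX TV] coord_field_self[OF c p] x_def ..
  ultimately show ?thesis by simp
qed

end

section \<open>Curves and their lengths\<close>

lemma continuous_within_open_Int:
  assumes "continuous_on (S \<inter> V) f" "open V" "t \<in> S" "t \<in> V"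
  shows "continuous (at t within S) f"
proof -
  have "at t within (S \<inter> V) = at t within S"
    by (rule at_within_nhd[of t V]) (use assms in auto)
  moreover have "continuous (at t within (S \<inter> V)) f"
    using assms(1,3,4) unfolding continuous_on_eq_continuous_within by blast
  ultimately show ?thesis by (simp only:)
qed

text \<open>Turns the condition that a curve lies in a chart into an open condition on its
  parameter, valid up to the end points of the interval.\<close>

lemma continuous_on_preimage_open:
  assumes "continuous_on S f" "open B"
  obtains V where "open V" "\<And>t. t \<in> S \<Longrightarrow> t \<in> V \<longleftrightarrow> f t \<in> B"
proof -
  obtain V where "open V" "V \<inter> S = f -` B \<inter> S"
    using assms unfolding continuous_on_open_invariant by blast
  then show ?thesis using that[of V] by blast
qed

context riemannian
begin

section \<open>Velocity and arc length\<close>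

abbreviation speed :: "real set \<Rightarrow> (real \<Rightarrow> 'm) \<Rightarrow> real \<Rightarrow> real" where
  "speed S \<gamma> t \<equiv> tv_norm g (\<gamma> t) (velocity A S \<gamma> t)"

text \<open>The velocity is formed within \<open>{a..b}\<close>, so it is one-sided at the ends and
  the pieces of a broken curve do not see its corners.\<close>

definition arc_length :: "real \<Rightarrow> real \<Rightarrow> (real \<Rightarrow> 'm) \<Rightarrow> real" where
  "arc_length a b \<gamma> = integral {a..b} (speed {a..b} \<gamma>)"

text \<open>By \<open>ev\<close> nearby points stay in the domain of \<open>c\<close>, where the
  second coordinate representation is the transition map applied to the first; outside,
  \<open>snd c\<close> is arbitrary.\<close>

lemma chart_change_deriv:
  assumes c: "c \<in> A" "c' \<in> A" "\<gamma> t \<in> fst c" "\<gamma> t \<in> fst c'"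
    and t: "t \<in> S" and ev: "\<forall>\<^sub>F s in at t within S. \<gamma> s \<in> fst c"
    and d: "((snd c \<circ> \<gamma>) has_vector_derivative w) (at t within S)"
  shows "((snd c' \<circ> \<gamma>) has_vector_derivative jacobian c c' (snd c (\<gamma> t)) w) (at t within S)"
proof -
  have tr: "(transition c c' has_derivative jacobian c c' (snd c (\<gamma> t))) (at ((snd c \<circ> \<gamma>) t))"
    using transition_deriv[OF c] by simp
  have "((\<lambda>s. transition c c' ((snd c \<circ> \<gamma>) s)) has_derivative
      (\<lambda>h. jacobian c c' (snd c (\<gamma> t)) (h *\<^sub>R w))) (at t within S)"
    by (rule has_derivative_compose[OF d[unfolded has_vector_derivative_def] tr])
  then have "((\<lambda>s. transition c c' ((snd c \<circ> \<gamma>) s)) has_vector_derivative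
      jacobian c c' (snd c (\<gamma> t)) w) (at t within S)"
    by (simp add: has_vector_derivative_def linear_scale[OF linear_jacobian[OF c]] del: comp_apply)
  then show ?thesis
    unfolding has_vector_derivative_def
  proof (rule has_derivative_transform_eventually)
    show "\<forall>\<^sub>F s in at t within S. transition c c' ((snd c \<circ> \<gamma>) s) = (snd c' \<circ> \<gamma>) s"
      using ev by eventually_elim (use c in simp)
  qed (use c t in auto)
qed

lemma eventually_in_chart:
  assumes "c \<in> A" "continuous (at t within S) \<gamma>" "\<gamma> t \<in> fst c"
  shows "\<forall>\<^sub>F s in at t within S. \<gamma> s \<in> fst c"
  using assms(2,3) open_chart_domain[OF assms(1)]
  by (simp add: continuous_within tendsto_def)

lemma velocity_eq:
  assumes "a < b" "t \<in> {a..b}" "c \<in> A" "\<gamma> t \<in> fst c"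
    and "((snd c \<circ> \<gamma>) has_vector_derivative w) (at t within {a..b})"
  shows "velocity A {a..b} \<gamma> t c = w"
  using vector_derivative_within_cbox[of a b t "snd c \<circ> \<gamma>" w] assms by (simp add: velocity_def)

lemma C1_curve_deriv:
  assumes "C1_curve A S \<gamma>" "t \<in> S" "c \<in> A" "\<gamma> t \<in> fst c"
  shows "((snd c \<circ> \<gamma>) has_vector_derivative velocity A S \<gamma> t c) (at t within S)"
  using assms by (simp add: C1_curve_def velocity_def vector_derivative_works del: comp_apply)

lemma C1_curve_continuous: "C1_curve A S \<gamma> \<Longrightarrow> continuous_on S \<gamma>"
  by (simp add: C1_curve_def)

lemma C1_velocity_continuous:
  "C1_curve A S \<gamma> \<Longrightarrow> t \<in> S \<Longrightarrow> c \<in> A \<Longrightarrow> \<gamma> t \<in> fst c \<Longrightarrow>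
    continuous (at t within S) (\<lambda>s. velocity A S \<gamma> s c)"
  by (simp add: C1_curve_def)

lemma velocity_tangent:
  assumes \<gamma>: "C1_curve A {a..b} \<gamma>" and "a < b" and t: "t \<in> {a..b}"
  shows "velocity A {a..b} \<gamma> t \<in> tangent_space A (\<gamma> t)"
proof (rule tangentI)
  fix c c' assume c: "c \<in> A" "c' \<in> A" "\<gamma> t \<in> fst c" "\<gamma> t \<in> fst c'"
  have "continuous (at t within {a..b}) \<gamma>"
    using C1_curve_continuous[OF \<gamma>] t by (simp add: continuous_on_eq_continuous_within)
  from eventually_in_chart[OF c(1) this c(3)]
  show "velocity A {a..b} \<gamma> t c' = jacobian c c' (snd c (\<gamma> t)) (velocity A {a..b} \<gamma> t c)"
    using \<gamma> c t \<open>a < b\<close> by (intro velocity_eq chart_change_deriv C1_curve_deriv) auto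
qed (auto simp: velocity_def)

lemma speed_coords:
  assumes "C1_curve A {a..b} \<gamma>" "a < b" "t \<in> {a..b}" "c \<in> A" "\<gamma> t \<in> fst c"
  shows "speed {a..b} \<gamma> t =
    sqrt (metric_coords c (snd c (\<gamma> t)) (velocity A {a..b} \<gamma> t c) (velocity A {a..b} \<gamma> t c))"
  using velocity_tangent[OF assms(1-3)] assms(4,5) by (simp add: tv_norm_def metric_eq_coords)

lemma speed_nonneg:
  assumes "C1_curve A {a..b} \<gamma>" "a < b" "t \<in> {a..b}"
  shows "0 \<le> speed {a..b} \<gamma> t"
  using metric_nonneg[OF velocity_tangent[OF assms]] by (simp add: tv_norm_def)

text \<open>Continuity is local, and near each parameter the curve stays in one chart, where the
  speed is a continuous expression in coordinates.\<close>

lemma continuous_on_speed: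
  assumes \<gamma>: "C1_curve A {a..b} \<gamma>" and ab: "a < b"
  shows "continuous_on {a..b} (speed {a..b} \<gamma>)"
  unfolding continuous_on_eq_continuous_within
proof
  fix t assume t: "t \<in> {a..b}"
  obtain c where c: "c \<in> A" "\<gamma> t \<in> fst c" by (rule chart_around)
  interpret coordinate_metric "coords c" "metric_coords c" by (rule coordinate_metric_coords[OF c(1)])
  obtain V where V: "open V" "\<And>s. s \<in> {a..b} \<Longrightarrow> s \<in> V \<longleftrightarrow> \<gamma> s \<in> fst c"
    using continuous_on_preimage_open[OF C1_curve_continuous[OF \<gamma>] open_chart_domain[OF c(1)]] by metis
  let ?T = "{a..b} \<inter> V"
  have T: "\<gamma> ` ?T \<subseteq> fst c" using V(2) by auto
  have "continuous_on ?T \<gamma>"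
    using C1_curve_continuous[OF \<gamma>] by (rule continuous_on_subset) auto
  then have 1: "continuous_on ?T (\<lambda>s. snd c (\<gamma> s))"
    by (rule continuous_on_compose2[OF continuous_on_chart[OF c(1)] _ T])
  have 2: "continuous_on ?T (\<lambda>s. velocity A {a..b} \<gamma> s c)"
    unfolding continuous_on_eq_continuous_within
  proof
    fix s assume s: "s \<in> ?T"
    then have "continuous (at s within {a..b}) (\<lambda>s. velocity A {a..b} \<gamma> s c)"
      using T by (intro C1_velocity_continuous[OF \<gamma> _ c(1)]) auto
    then show "continuous (at s within ?T) (\<lambda>s. velocity A {a..b} \<gamma> s c)"
      by (rule continuous_within_subset) auto
  qed
  have "continuous_on ?T (\<lambda>s. sqrt (metric_coords c (snd c (\<gamma> s))
      (velocity A {a..b} \<gamma> s c) (velocity A {a..b} \<gamma> s c)))"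
    using T by (intro continuous_on_real_sqrt continuous_on_G 1 2) auto
  then have "continuous_on ?T (speed {a..b} \<gamma>)"
    by (rule continuous_on_eq) (use T in \<open>simp add: speed_coords[OF \<gamma> ab _ c(1)] image_subset_iff\<close>)
  then show "continuous (at t within {a..b}) (speed {a..b} \<gamma>)"
    by (rule continuous_within_open_Int[OF _ V(1) t]) (use V(2) t c in auto)
qed

lemma has_integral_speed:
  assumes "C1_curve A {a..b} \<gamma>" "a < b"
  shows "(speed {a..b} \<gamma> has_integral arc_length a b \<gamma>) {a..b}"
  unfolding arc_length_def
  by (intro integrable_integral integrable_continuous_interval continuous_on_speed assms)

lemma arc_length_nonneg:
  assumes "C1_curve A {a..b} \<gamma>" "a < b"
  shows "0 \<le> arc_length a b \<gamma>"
  by (rule has_integral_nonneg[OF has_integral_speed[OF assms]]) (rule speed_nonneg[OF assms])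

text \<open>The device by which curves are constructed. The definition of a C1 curve inspects every
  chart of the atlas, so the joint continuity of the Jacobians is used to pass from \<open>c\<close>
  to the others.\<close>

lemma C1_curve_chart:
  assumes c: "c \<in> A" and ab: "a < b" and x: "x ` {a..b} \<subseteq> coords c"
    and x': "\<And>s. s \<in> {a..b} \<Longrightarrow> (x has_vector_derivative x' s) (at s within {a..b})"
    and cx': "continuous_on {a..b} x'"
  defines "\<gamma> \<equiv> \<lambda>s. inv_chart c (x s)"
  shows "C1_curve A {a..b} \<gamma>"
    and "\<And>s. s \<in> {a..b} \<Longrightarrow> velocity A {a..b} \<gamma> s c = x' s"
proof -
  have cx: "continuous_on {a..b} x"
    unfolding continuous_on_eq_continuous_within
    using x' has_vector_derivative_continuous by blast
  have in_c: "\<gamma> s \<in> fst c" "snd c (\<gamma> s) = x s" if "s \<in> {a..b}" for s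
  proof -
    have "x s \<in> coords c" using x that by blast
    then show "\<gamma> s \<in> fst c" "snd c (\<gamma> s) = x s" using c by (simp_all add: \<gamma>_def)
  qed
  have c\<gamma>: "continuous_on {a..b} \<gamma>"
    unfolding \<gamma>_def by (rule continuous_on_compose2[OF continuous_on_inv_chart[OF c] cx x])
  have d: "((snd c \<circ> \<gamma>) has_vector_derivative x' s) (at s within {a..b})" if "s \<in> {a..b}" for s
    by (rule has_vector_derivative_transform[OF that _ x'[OF that]]) (simp add: in_c)
  have d': "((snd c' \<circ> \<gamma>) has_vector_derivative jacobian c c' (x s) (x' s)) (at s within {a..b})"
    if "s \<in> {a..b}" "c' \<in> A" "\<gamma> s \<in> fst c'" for s c'
  proof -
    have "\<forall>\<^sub>F s in at s within {a..b}. \<gamma> s \<in> fst c"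
      using c\<gamma> that(1) in_c
      by (intro eventually_in_chart[OF c]) (auto simp: continuous_on_eq_continuous_within)
    from chart_change_deriv[OF c that(2) in_c(1)[OF that(1)] that(3,1) this d[OF that(1)]]
    show ?thesis using in_c that by simp
  qed
  have v: "velocity A {a..b} \<gamma> s c' = jacobian c c' (x s) (x' s)"
    if "s \<in> {a..b}" "c' \<in> A" "\<gamma> s \<in> fst c'" for s c'
    using velocity_eq[OF ab that d'[OF that]] .
  show "velocity A {a..b} \<gamma> s c = x' s" if "s \<in> {a..b}" for s
    using velocity_eq[OF ab that c in_c(1)[OF that] d[OF that]] .
  show "C1_curve A {a..b} \<gamma>"
    unfolding C1_curve_def
  proof (intro conjI ballI impI c\<gamma>)
    fix c' t assume c': "c' \<in> A" and t: "t \<in> {a..b}" "\<gamma> t \<in> fst c'"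
    show "(snd c' \<circ> \<gamma>) differentiable (at t within {a..b})"
      using d'[OF t(1) c' t(2)] by (rule differentiableI_vector)
    obtain V where V: "open V" "\<And>s. s \<in> {a..b} \<Longrightarrow> s \<in> V \<longleftrightarrow> \<gamma> s \<in> fst c'"
      using continuous_on_preimage_open[OF c\<gamma> open_chart_domain[OF c']] by metis
    let ?T = "{a..b} \<inter> V"
    have "continuous_on ?T (\<lambda>s. (x s, x' s))"
      by (intro continuous_on_Pair continuous_on_subset[OF cx] continuous_on_subset[OF cx']) auto
    moreover have "(\<lambda>s. (x s, x' s)) ` ?T \<subseteq> snd c ` (fst c \<inter> fst c') \<times> UNIV"
      using V(2) x in_c by (force simp: chart_image_Int[OF c] \<gamma>_def)
    ultimately have "continuous_on ?T (\<lambda>s. jacobian c c' (x s) (x' s))"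
      using continuous_on_compose2[OF smooth_on_continuous_derivative[OF smooth_transition[OF c c']],
        of ?T "\<lambda>s. (x s, x' s)"] by (simp del: comp_apply)
    then have "continuous_on ?T (\<lambda>s. velocity A {a..b} \<gamma> s c')"
    proof (rule continuous_on_eq)
      fix s assume "s \<in> ?T"
      then have "s \<in> {a..b}" "\<gamma> s \<in> fst c'" using V(2) by auto
      then show "jacobian c c' (x s) (x' s) = velocity A {a..b} \<gamma> s c'" by (simp only: v[OF _ c'])
    qed
    then show "continuous (at t within {a..b}) (\<lambda>s. velocity A {a..b} \<gamma> s c')"
      by (rule continuous_within_open_Int[OF _ V(1) t(1)]) (use V(2) t in auto)
  qed
qed

section \<open>Restriction and reparametrisation of curves\<close>

text \<open>Derivatives within \<open>S\<close> see only values on \<open>S\<close>. This matters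
  because curves are total functions, and a joined curve agrees with each of its parts on one half
  only.\<close>

lemma velocity_cong:
  assumes "\<And>s. s \<in> S \<Longrightarrow> \<gamma> s = \<gamma>' s" "t \<in> S"
  shows "velocity A S \<gamma> t = velocity A S \<gamma>' t"
proof -
  have "vector_derivative (snd c \<circ> \<gamma>) (at t within S) = vector_derivative (snd c \<circ> \<gamma>') (at t within S)"
    for c :: "('m, 'e) chart"
    by (rule vector_derivative_cong_eq) (use assms in auto)
  then show ?thesis
    unfolding velocity_def using assms by (intro ext) (auto split: if_split)
qed

lemma C1_curve_cong:
  assumes "\<And>s. s \<in> S \<Longrightarrow> \<gamma> s = \<gamma>' s"
  shows "C1_curve A S \<gamma> \<longleftrightarrow> C1_curve A S \<gamma>'"
proof -
  have *: "C1_curve A S \<gamma>'" if C: "C1_curve A S \<gamma>" and eq: "\<And>s. s \<in> S \<Longrightarrow> \<gamma> s = \<gamma>' s" for \<gamma> \<gamma>'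
    unfolding C1_curve_def
  proof (intro conjI ballI impI)
    show "continuous_on S \<gamma>'"
      using C1_curve_continuous[OF C] by (rule continuous_on_eq) (rule eq)
    fix c t assume ct: "c \<in> A" "t \<in> S" "\<gamma>' t \<in> fst c"
    then have ct': "\<gamma> t \<in> fst c" using eq by simp
    have "((snd c \<circ> \<gamma>') has_vector_derivative velocity A S \<gamma> t c) (at t within S)"
      by (rule has_vector_derivative_transform[OF ct(2) _ C1_curve_deriv[OF C ct(2,1) ct']])
        (simp add: eq)
    then show "(snd c \<circ> \<gamma>') differentiable (at t within S)" by (rule differentiableI_vector)
    show "continuous (at t within S) (\<lambda>s. velocity A S \<gamma>' s c)"
      by (rule continuous_transform_within[OF C1_velocity_continuous[OF C ct(2,1) ct'] zero_less_one ct(2)])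
        (use velocity_cong[of S \<gamma> \<gamma>'] eq in simp)
  qed
  show ?thesis
    by (rule iffI; erule *) (simp_all add: assms)
qed

lemma arc_length_cong:
  assumes "\<And>s. s \<in> {a..b} \<Longrightarrow> \<gamma> s = \<gamma>' s"
  shows "arc_length a b \<gamma> = arc_length a b \<gamma>'"
  unfolding arc_length_def
  by (rule integral_cong) (use velocity_cong[of "{a..b}" \<gamma> \<gamma>'] assms in simp)

lemma tv_norm_scale:
  assumes "v \<in> tangent_space A p" "0 \<le> m" "w = (\<lambda>c. m *\<^sub>R v c)"
  shows "tv_norm g p w = m * tv_norm g p v"
proof -
  obtain c where c: "c \<in> A" "p \<in> fst c" by (rule chart_around)
  interpret coordinate_metric "coords c" "metric_coords c" by (rule coordinate_metric_coords[OF c(1)])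
  have x: "snd c p \<in> coords c" using c by simp
  \<comment> \<open>The summand 0 fits the form of \<open>coord_field_linear\<close>, whose instance
    at 1, 0, 0 shows that the coordinate field of 0 vanishes.\<close>
  have "w = coord_field A c (m *\<^sub>R v c + 0) p"
    unfolding coord_field_linear[OF c]
    using tangent_eq_coord_field[OF c assms(1)] coord_field_linear[OF c, of 1 0 0]
    by (auto simp: tv_add_def tv_scale_def assms(3) fun_eq_iff)
  then have w: "w \<in> tangent_space A p" using coord_field_tangent[OF c] by simp
  have "g p w w = m\<^sup>2 * g p v v"
    unfolding metric_eq_coords[OF c w w] metric_eq_coords[OF c assms(1,1)]
    by (simp add: assms(3) G_simps(3,4)[OF x] power2_eq_square)
  then show ?thesis using assms(2) by (simp add: tv_norm_def real_sqrt_mult)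
qed

text \<open>The velocity is multiplied by \<open>m\<close> and the interval shrinks by the same
  factor, so the substitution rule leaves the length unchanged.\<close>

lemma C1_curve_affine:
  fixes d :: real
  assumes \<gamma>: "C1_curve A {a..b} \<gamma>" and ab: "a < b" and m: "0 < m"
  defines "a' \<equiv> (a - d) / m" and "b' \<equiv> (b - d) / m" and "\<gamma>' \<equiv> \<lambda>t. \<gamma> (m * t + d)"
  shows "C1_curve A {a'..b'} \<gamma>'" and "arc_length a' b' \<gamma>' = arc_length a b \<gamma>"
proof -
  have ab': "a' < b'" using ab m by (simp add: a'_def b'_def divide_strict_right_mono)
  have im: "m * t + d \<in> {a..b}" if "t \<in> {a'..b'}" for t
    using that m by (auto simp: a'_def b'_def field_simps)
  let ?f = "\<lambda>t. m * t + d"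
  have cf: "continuous_on {a'..b'} ?f" by (intro continuous_intros)
  have im': "?f ` {a'..b'} \<subseteq> {a..b}" using im by auto
  have c\<gamma>: "continuous_on {a'..b'} \<gamma>'"
    unfolding \<gamma>'_def by (rule continuous_on_compose2[OF C1_curve_continuous[OF \<gamma>] cf im'])
  have d: "((snd c \<circ> \<gamma>') has_vector_derivative m *\<^sub>R velocity A {a..b} \<gamma> (?f t) c) (at t within {a'..b'})"
    if "t \<in> {a'..b'}" "c \<in> A" "\<gamma>' t \<in> fst c" for t c
  proof -
    have "((snd c \<circ> \<gamma>) has_vector_derivative velocity A {a..b} \<gamma> (?f t) c) (at (?f t) within {a..b})"
      by (rule C1_curve_deriv[OF \<gamma> im]) (use that in \<open>auto simp: \<gamma>'_def\<close>)
    then have "((snd c \<circ> \<gamma>) has_vector_derivative velocity A {a..b} \<gamma> (?f t) c) (at (?f t) within ?f ` {a'..b'})"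
      by (rule has_vector_derivative_within_subset[OF _ im'])
    moreover have "(?f has_vector_derivative m) (at t within {a'..b'})"
      unfolding has_real_derivative_iff_has_vector_derivative[symmetric]
      by (auto intro!: derivative_eq_intros)
    ultimately have "((snd c \<circ> \<gamma>) \<circ> ?f has_vector_derivative m *\<^sub>R velocity A {a..b} \<gamma> (?f t) c)
        (at t within {a'..b'})"
      by (intro vector_diff_chain_within)
    then show ?thesis by (simp add: \<gamma>'_def o_def)
  qed
  \<comment> \<open>Charts that miss the point are included: there both velocities are 0 by
    definition.\<close>
  have v: "velocity A {a'..b'} \<gamma>' t c = m *\<^sub>R velocity A {a..b} \<gamma> (?f t) c" if "t \<in> {a'..b'}" for t c
  proof (cases "c \<in> A \<and> \<gamma>' t \<in> fst c")
    case True
    then show ?thesis using velocity_eq[OF ab' that] d[OF that] by blast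
  qed (auto simp: velocity_def \<gamma>'_def)
  show "C1_curve A {a'..b'} \<gamma>'"
    unfolding C1_curve_def
  proof (intro conjI ballI impI c\<gamma>)
    fix c t assume ct: "c \<in> A" "t \<in> {a'..b'}" "\<gamma>' t \<in> fst c"
    show "(snd c \<circ> \<gamma>') differentiable (at t within {a'..b'})"
      using d[OF ct(2,1,3)] by (rule differentiableI_vector)
    have "continuous (at (?f t) within {a..b}) (\<lambda>s. velocity A {a..b} \<gamma> s c)"
      by (rule C1_velocity_continuous[OF \<gamma> im]) (use ct in \<open>auto simp: \<gamma>'_def\<close>)
    then have "continuous (at (?f t) within ?f ` {a'..b'}) (\<lambda>s. velocity A {a..b} \<gamma> s c)"
      by (rule continuous_within_subset[OF _ im'])
    then have "continuous (at t within {a'..b'}) (\<lambda>t. velocity A {a..b} \<gamma> (?f t) c)"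
      by (rule continuous_within_compose2[rotated]) (intro continuous_intros)
    then have "continuous (at t within {a'..b'}) (\<lambda>t. m *\<^sub>R velocity A {a..b} \<gamma> (?f t) c)"
      by (intro continuous_intros)
    then show "continuous (at t within {a'..b'}) (\<lambda>t. velocity A {a'..b'} \<gamma>' t c)"
      by (rule continuous_transform_within[OF _ zero_less_one ct(2)]) (simp add: v)
  qed
  have "((\<lambda>t. speed {a..b} \<gamma> (?f t)) has_integral (arc_length a b \<gamma> / m)) {a'..b'}"
    using has_integral_affinity'[OF has_integral_speed[OF \<gamma> ab, folded box_real] m, of d]
    by (simp add: a'_def b'_def divide_inverse mult.commute)
  from has_integral_mult_right[OF this, of m]
  have "((\<lambda>t. m * speed {a..b} \<gamma> (?f t)) has_integral arc_length a b \<gamma>) {a'..b'}"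
    using m by simp
  then have "(speed {a'..b'} \<gamma>' has_integral arc_length a b \<gamma>) {a'..b'}"
  proof (rule has_integral_eq[rotated])
    fix t assume t: "t \<in> {a'..b'}"
    show "m * speed {a..b} \<gamma> (?f t) = speed {a'..b'} \<gamma>' t"
      using tv_norm_scale[OF velocity_tangent[OF \<gamma> ab im[OF t]] less_imp_le[OF m], of "velocity A {a'..b'} \<gamma>' t"]
        v[OF t] by (simp add: \<gamma>'_def fun_eq_iff)
  qed
  then show "arc_length a' b' \<gamma>' = arc_length a b \<gamma>"
    unfolding arc_length_def by (rule integral_unique)
qed

end

section \<open>The Riemannian distance\<close>

lemma partition_mono:
  fixes s :: "nat \<Rightarrow> real"
  assumes "\<And>i. i < n \<Longrightarrow> s i < s (Suc i)" "i \<le> j" "j \<le> n"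
  shows "s i \<le> s j"
  using assms(2,3)
proof (induction j rule: dec_induct)
  case (step j)
  then show ?case using assms(1)[of j] by simp
qed simp

context riemannian
begin

abbreviation rdist :: "'m \<Rightarrow> 'm \<Rightarrow> ereal" where
  "rdist \<equiv> riemannian_dist A g"

text \<open>The velocity within \<open>{0..1}\<close> and the velocity within a piece can differ
  only at the end points of the piece, a finite set that the integral ignores.\<close>

lemma has_integral_speed_sum:
  assumes s: "s 0 = 0" "s n = 1" and C1: "\<And>i. i < n \<Longrightarrow> s i < s (Suc i) \<and> C1_curve A {s i..s (Suc i)} \<gamma>"
    and "k \<le> n"
  shows "(speed {0..1} \<gamma> has_integral (\<Sum>i<k. arc_length (s i) (s (Suc i)) \<gamma>)) {0..s k}"
  using \<open>k \<le> n\<close>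
proof (induction k)
  case 0
  then show ?case by (simp add: s has_integral_refl(2))
next
  case (Suc k)
  have k: "s k < s (Suc k)" "C1_curve A {s k..s (Suc k)} \<gamma>" using C1 Suc.prems by auto
  have bounds: "0 \<le> s k" "s (Suc k) \<le> 1"
    using partition_mono[of n s 0 k] partition_mono[of n s "Suc k" n] C1 Suc.prems s by auto
  have "(speed {0..1} \<gamma> has_integral arc_length (s k) (s (Suc k)) \<gamma>) {s k..s (Suc k)}"
  proof (rule has_integral_spike_finite[OF _ _ has_integral_speed[OF k(2,1)]])
    fix t assume "t \<in> {s k..s (Suc k)} - {s k, s (Suc k)}"
    then have t: "s k < t" "t < s (Suc k)" by auto
    then have eq: "at t within {0..1} = at t within {s k..s (Suc k)}"
      using bounds by (simp add: at_within_Icc_at)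
    show "speed {0..1} \<gamma> t = speed {s k..s (Suc k)} \<gamma> t" unfolding velocity_def eq ..
  qed simp
  with Suc show ?case
    using has_integral_combine[OF bounds(1) less_imp_le[OF k(1)]] by simp
qed

lemma curve_length_sum:
  assumes "s 0 = 0" "s n = 1" "\<And>i. i < n \<Longrightarrow> s i < s (Suc i) \<and> C1_curve A {s i..s (Suc i)} \<gamma>"
  shows "curve_length A g \<gamma> = (\<Sum>i<n. arc_length (s i) (s (Suc i)) \<gamma>)"
  using has_integral_speed_sum[OF assms order_refl] assms(2)
  by (simp add: curve_length_def integral_unique)

lemma piecewise_C1_curve_join:
  assumes "piecewise_C1_curve A \<gamma>1" "piecewise_C1_curve A \<gamma>2" and join: "\<gamma>1 1 = \<gamma>2 0"
  obtains \<gamma> where "piecewise_C1_curve A \<gamma>" "\<gamma> 0 = \<gamma>1 0" "\<gamma> 1 = \<gamma>2 1"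
    "curve_length A g \<gamma> = curve_length A g \<gamma>1 + curve_length A g \<gamma>2"
proof -
  obtain n s where s: "s 0 = 0" "s n = 1"
    "\<And>i. i < n \<Longrightarrow> s i < s (Suc i) \<and> C1_curve A {s i..s (Suc i)} \<gamma>1"
    using assms(1) unfolding piecewise_C1_curve_def by blast
  obtain m r where r: "r 0 = 0" "r m = 1"
    "\<And>i. i < m \<Longrightarrow> r i < r (Suc i) \<and> C1_curve A {r i..r (Suc i)} \<gamma>2"
    using assms(2) unfolding piecewise_C1_curve_def by blast
  \<comment> \<open>The summands 0 and -1 are written out, here and in \<open>\<sigma>\<close>, to
    match \<open>C1_curve_affine\<close> with \<open>m = 2\<close>.\<close>
  define \<gamma> where "\<gamma> t = (if t \<le> 1/2 then \<gamma>1 (2 * t + 0) else \<gamma>2 (2 * t + (-1)))" for t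
  define \<sigma> where "\<sigma> i = (if i \<le> n then (s i - 0) / 2 else (r (i - n) - (-1)) / 2)" for i
  have \<sigma>_right: "\<sigma> (n + i) = (r i - (-1)) / 2" for i
    using s(2) r(1) by (cases i) (auto simp: \<sigma>_def)
  have left: "\<sigma> i < \<sigma> (Suc i) \<and> C1_curve A {\<sigma> i..\<sigma> (Suc i)} \<gamma> \<and>
      arc_length (\<sigma> i) (\<sigma> (Suc i)) \<gamma> = arc_length (s i) (s (Suc i)) \<gamma>1" if "i < n" for i
  proof -
    have i: "s i < s (Suc i)" "C1_curve A {s i..s (Suc i)} \<gamma>1" using s(3)[OF that] by auto
    have \<sigma>: "\<sigma> i = (s i - 0) / 2" "\<sigma> (Suc i) = (s (Suc i) - 0) / 2" using that by (auto simp: \<sigma>_def)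
    have "s (Suc i) \<le> 1" using partition_mono[of n s "Suc i" n] s that by auto
    then have eq: "\<gamma> t = \<gamma>1 (2 * t + 0)" if "t \<in> {\<sigma> i..\<sigma> (Suc i)}" for t
      using that by (auto simp: \<gamma>_def \<sigma>)
    have "C1_curve A {\<sigma> i..\<sigma> (Suc i)} \<gamma> = C1_curve A {\<sigma> i..\<sigma> (Suc i)} (\<lambda>t. \<gamma>1 (2 * t + 0))"
      "arc_length (\<sigma> i) (\<sigma> (Suc i)) \<gamma> = arc_length (\<sigma> i) (\<sigma> (Suc i)) (\<lambda>t. \<gamma>1 (2 * t + 0))"
      by (intro C1_curve_cong arc_length_cong eq; assumption)+
    then show ?thesis using C1_curve_affine[OF i(2,1), of 2 0] i(1) unfolding \<sigma> by simp
  qed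
  have right: "\<sigma> (n + i) < \<sigma> (n + Suc i) \<and> C1_curve A {\<sigma> (n + i)..\<sigma> (n + Suc i)} \<gamma> \<and>
      arc_length (\<sigma> (n + i)) (\<sigma> (n + Suc i)) \<gamma> = arc_length (r i) (r (Suc i)) \<gamma>2" if "i < m" for i
  proof -
    have i: "r i < r (Suc i)" "C1_curve A {r i..r (Suc i)} \<gamma>2" using r(3)[OF that] by auto
    have "0 \<le> r i" using partition_mono[of m r 0 i] r that by auto
    then have eq: "\<gamma> t = \<gamma>2 (2 * t + (-1))" if "t \<in> {\<sigma> (n + i)..\<sigma> (n + Suc i)}" for t
    proof (cases "t = 1/2")
      case True
      \<comment> \<open>At the junction the definition takes the end of \<open>\<gamma>1\<close>,
        which \<open>join\<close> identifies with the start of \<open>\<gamma>2\<close>.\<close>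
      then show ?thesis unfolding True \<gamma>_def using join by simp
    next
      case False
      moreover have "1/2 \<le> t" using that \<open>0 \<le> r i\<close> unfolding \<sigma>_right by simp
      ultimately show ?thesis by (simp add: \<gamma>_def)
    qed
    have "C1_curve A {\<sigma> (n + i)..\<sigma> (n + Suc i)} \<gamma> =
        C1_curve A {\<sigma> (n + i)..\<sigma> (n + Suc i)} (\<lambda>t. \<gamma>2 (2 * t + (-1)))"
      "arc_length (\<sigma> (n + i)) (\<sigma> (n + Suc i)) \<gamma> =
        arc_length (\<sigma> (n + i)) (\<sigma> (n + Suc i)) (\<lambda>t. \<gamma>2 (2 * t + (-1)))"
      by (intro C1_curve_cong arc_length_cong eq; assumption)+
    then show ?thesis using C1_curve_affine[OF i(2,1), of 2 "-1"] i(1) unfolding \<sigma>_right by simp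
  qed
  have \<sigma>_ends: "\<sigma> 0 = 0" "\<sigma> (n + m) = 1" using s r by (simp add: \<sigma>_def, simp add: \<sigma>_right)
  have all: "\<sigma> i < \<sigma> (Suc i) \<and> C1_curve A {\<sigma> i..\<sigma> (Suc i)} \<gamma>" if "i < n + m" for i
    using left[of i] right[of "i - n"] that by (cases "i < n") auto
  have sum_split: "(\<Sum>i<n + k. f i) = (\<Sum>i<n. f i) + (\<Sum>i<k. f (n + i))" for k and f :: "nat \<Rightarrow> real"
    by (induction k) auto
  show ?thesis
  proof (rule that)
    show "piecewise_C1_curve A \<gamma>"
      unfolding piecewise_C1_curve_def using \<sigma>_ends all by blast
    show "\<gamma> 0 = \<gamma>1 0" "\<gamma> 1 = \<gamma>2 1" by (simp_all add: \<gamma>_def)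
    have "curve_length A g \<gamma> = (\<Sum>i<n + m. arc_length (\<sigma> i) (\<sigma> (Suc i)) \<gamma>)"
      by (rule curve_length_sum[OF \<sigma>_ends all])
    also have "\<dots> = (\<Sum>i<n. arc_length (s i) (s (Suc i)) \<gamma>1) + (\<Sum>i<m. arc_length (r i) (r (Suc i)) \<gamma>2)"
      unfolding sum_split using left right by simp
    also have "\<dots> = curve_length A g \<gamma>1 + curve_length A g \<gamma>2"
      using curve_length_sum[OF s] curve_length_sum[OF r] by simp
    finally show "curve_length A g \<gamma> = curve_length A g \<gamma>1 + curve_length A g \<gamma>2" .
  qed
qed

text \<open>Nearly optimal curves are joined, each with half of the allowed excess. Real bounds in
  place of the distances avoid sums with infinity.\<close>

lemma rdist_triangle_le:
  assumes "rdist p q \<le> ereal a" "rdist q r \<le> ereal b"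
  shows "rdist p r \<le> ereal (a + b)"
proof (rule ereal_le_epsilon2)
  fix e :: real assume e: "0 < e"
  have "rdist p q < ereal (a + e / 2)" using assms(1) e by (auto intro: le_less_trans)
  then obtain \<gamma>1 where 1: "piecewise_C1_curve A \<gamma>1" "\<gamma>1 0 = p" "\<gamma>1 1 = q"
    "curve_length A g \<gamma>1 < a + e / 2"
    unfolding riemannian_dist_def INF_less_iff by auto
  have "rdist q r < ereal (b + e / 2)" using assms(2) e by (auto intro: le_less_trans)
  then obtain \<gamma>2 where 2: "piecewise_C1_curve A \<gamma>2" "\<gamma>2 0 = q" "\<gamma>2 1 = r"
    "curve_length A g \<gamma>2 < b + e / 2"
    unfolding riemannian_dist_def INF_less_iff by auto
  obtain \<gamma> where \<gamma>: "piecewise_C1_curve A \<gamma>" "\<gamma> 0 = p" "\<gamma> 1 = r"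
    "curve_length A g \<gamma> = curve_length A g \<gamma>1 + curve_length A g \<gamma>2"
    using piecewise_C1_curve_join[OF 1(1) 2(1)] 1(2,3) 2(2,3) by metis
  have "rdist p r \<le> ereal (curve_length A g \<gamma>)"
    unfolding riemannian_dist_def by (rule INF_lower) (use \<gamma> in simp)
  also have "\<dots> \<le> ereal (a + b) + ereal e" using \<gamma>(4) 1(4) 2(4) by simp
  finally show "rdist p r \<le> ereal (a + b) + ereal e" .
qed

lemma C1_imp_piecewise_C1: "C1_curve A {0..1} \<gamma> \<Longrightarrow> piecewise_C1_curve A \<gamma>"
  unfolding piecewise_C1_curve_def by (intro exI[of _ 1] exI[of _ real]) auto

section \<open>Bounds for the distance from explicit curves\<close>

lemma rdist_le_arc_length:
  assumes "C1_curve A {a..b} \<gamma>" "a < b"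
  shows "rdist (\<gamma> a) (\<gamma> b) \<le> ereal (arc_length a b \<gamma>)"
proof -
  let ?\<gamma> = "\<lambda>t. \<gamma> ((b - a) * t + a)"
  have C: "C1_curve A {0..1} ?\<gamma>" "arc_length 0 1 ?\<gamma> = arc_length a b \<gamma>"
    using C1_curve_affine[OF assms, of "b - a" a] assms(2) by simp_all
  have "rdist (\<gamma> a) (\<gamma> b) \<le> ereal (curve_length A g ?\<gamma>)"
    unfolding riemannian_dist_def
    by (rule INF_lower) (use C1_imp_piecewise_C1[OF C(1)] in simp)
  then show ?thesis using C(2) by (simp add: curve_length_def arc_length_def)
qed

text \<open>Distances in a chart are bounded by exhibiting a coordinate curve together with a
  majorant \<open>f\<close> of its speed, so that lengths need not be computed.\<close>

lemma rdist_le_chart_curve: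
  assumes c: "c \<in> A" and ab: "a < b" and x: "x ` {a..b} \<subseteq> coords c"
    and x': "\<And>s. s \<in> {a..b} \<Longrightarrow> (x has_vector_derivative x' s) (at s within {a..b})"
    and cx': "continuous_on {a..b} x'"
    and f: "\<And>s. s \<in> {a..b} \<Longrightarrow> sqrt (metric_coords c (x s) (x' s) (x' s)) \<le> f s"
    and I: "(f has_integral I) {a..b}"
  shows "rdist (inv_chart c (x a)) (inv_chart c (x b)) \<le> ereal I"
proof -
  let ?\<gamma> = "\<lambda>s. inv_chart c (x s)"
  have C: "C1_curve A {a..b} ?\<gamma>"
    by (rule C1_curve_chart(1)[OF c ab x _ cx']) (rule x')
  have V: "velocity A {a..b} ?\<gamma> s c = x' s" if "s \<in> {a..b}" for s
    by (rule C1_curve_chart(2)[OF c ab x _ cx' that]) (rule x')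
  have "arc_length a b ?\<gamma> \<le> I"
  proof (rule has_integral_le[OF has_integral_speed[OF C ab] I])
    fix s assume s: "s \<in> {a..b}"
    then have "x s \<in> coords c" using x by blast
    then show "speed {a..b} ?\<gamma> s \<le> f s"
      using speed_coords[OF C ab s c] V[OF s] f[OF s] c by simp
  qed
  then show ?thesis using rdist_le_arc_length[OF C ab] by (auto intro: order_trans)
qed

text \<open>Straight coordinate segments inside a ball have Riemannian length at most
  \<open>B\<close> times their Euclidean length. Thus \<open>o(\<tau>)\<close> in coordinates
  becomes \<open>o(\<tau>)\<close> in the distance.\<close>

lemma rdist_chart_lipschitz:
  assumes c: "c \<in> A" and x0: "x0 \<in> coords c"
  obtains r B where "0 < r" "0 \<le> B" "ball x0 r \<subseteq> coords c"
    "\<And>x y. x \<in> ball x0 r \<Longrightarrow> y \<in> ball x0 r \<Longrightarrow>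
      rdist (inv_chart c x) (inv_chart c y) \<le> ereal (B * norm (y - x))"
proof -
  interpret coordinate_metric "coords c" "metric_coords c" by (rule coordinate_metric_coords[OF c])
  obtain r where r: "r > 0" "cball x0 r \<subseteq> coords c"
    using open_contains_cball[of "coords c"] open_coords[OF c] x0 by blast
  obtain B where B: "0 \<le> B" "\<And>x v. x \<in> cball x0 r \<Longrightarrow> sqrt (metric_coords c x v v) \<le> B * norm v"
    using G_upper_bound[OF compact_cball r(2)] by blast
  show ?thesis
  proof (rule that[OF r(1) B(1)])
    show "ball x0 r \<subseteq> coords c" using r(2) ball_subset_cball by blast
    fix x y assume xy: "x \<in> ball x0 r" "y \<in> ball x0 r"
    let ?x = "\<lambda>s::real. x + s *\<^sub>R (y - x)"
    have in_ball: "?x s \<in> cball x0 r" if "s \<in> {0..1}" for s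
    proof -
      have "?x s = (1 - s) *\<^sub>R x + s *\<^sub>R y" by (simp add: algebra_simps)
      then show ?thesis
        using convexD_alt[OF convex_ball xy, of s] that ball_subset_cball by auto
    qed
    have "rdist (inv_chart c (?x 0)) (inv_chart c (?x 1)) \<le> ereal (B * norm (y - x))"
    proof (rule rdist_le_chart_curve[OF c zero_less_one, where x = ?x and x' = "\<lambda>_. y - x"
          and f = "\<lambda>_. B * norm (y - x)"])
      show "(?x has_vector_derivative y - x) (at s within {0..1})" for s
        by (auto intro!: derivative_eq_intros)
      show "((\<lambda>_. B * norm (y - x)) has_integral B * norm (y - x)) {0..1::real}"
        using has_integral_const_real[of "B * norm (y - x)" 0 1] by simp
    qed (use in_ball r B in auto)
    then show "rdist (inv_chart c x) (inv_chart c y) \<le> ereal (B * norm (y - x))" by simp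
  qed
qed

lemma rdist_self: "rdist p p \<le> 0"
proof -
  obtain c where c: "c \<in> A" "p \<in> fst c" by (rule chart_around)
  then have "snd c p \<in> coords c" by simp
  then obtain r B where "0 < r" "\<And>x y. x \<in> ball (snd c p) r \<Longrightarrow> y \<in> ball (snd c p) r \<Longrightarrow>
      rdist (inv_chart c x) (inv_chart c y) \<le> ereal (B * norm (y - x))"
    using rdist_chart_lipschitz[OF c(1)] by metis
  from this(2)[of "snd c p" "snd c p"] this(1) show ?thesis using c by (simp add: zero_ereal_def)
qed

section \<open>Growth of the distance along a vector field\<close>

text \<open>First-order contact at time 0, from the right, with the integral curve through
  \<open>p\<close>. Two such curves stay \<open>o(\<tau>)\<close> close, so integral curves and
  Euler steps in different charts can replace one another.\<close>

definition starts_along :: "('m, 'e) vfield \<Rightarrow> 'm \<Rightarrow> (real \<Rightarrow> 'm) \<Rightarrow> bool" where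
  "starts_along X p \<alpha> \<longleftrightarrow> \<alpha> 0 = p \<and> continuous (at 0 within {0..}) \<alpha> \<and>
    (\<forall>c\<in>A. p \<in> fst c \<longrightarrow> ((snd c \<circ> \<alpha>) has_vector_derivative X p c) (at 0 within {0..}))"

text \<open>The value is meaningless once the step leaves the coordinate domain, so it is used for
  small \<tau> only.\<close>

definition euler_step :: "('m, 'e) vfield \<Rightarrow> ('m, 'e) chart \<Rightarrow> 'm \<Rightarrow> real \<Rightarrow> 'm" where
  "euler_step X c p \<tau> = inv_chart c (snd c p + \<tau> *\<^sub>R X p c)"

text \<open>In \<open>c\<close> the derivative is read off. In another chart the Jacobian maps
  \<open>X p c\<close> to \<open>X p c'\<close>, as \<open>X p\<close> is a tangent vector.\<close>

lemma starts_along_euler_step: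
  assumes c: "c \<in> A" "p \<in> fst c" and X: "X p \<in> tangent_space A p"
  shows "starts_along X p (euler_step X c p)"
proof -
  let ?x = "\<lambda>\<tau>. snd c p + \<tau> *\<^sub>R X p c" and ?F = "at 0 within {0::real..}"
  have cx: "continuous ?F ?x" by (intro continuous_intros)
  have p: "snd c p \<in> coords c" using c by simp
  have e0: "euler_step X c p 0 = p" using c by (simp add: euler_step_def)
  have ev: "\<forall>\<^sub>F \<tau> in ?F. ?x \<tau> \<in> coords c"
    using cx p open_coords[OF c(1)] by (simp add: continuous_within tendsto_def)
  have "isCont (inv_chart c) (?x 0)"
    using continuous_on_inv_chart[OF c(1)] c(2)
    unfolding continuous_on_eq_continuous_at[OF open_coords[OF c(1)]] by simp
  from continuous_within_compose3[OF this cx]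
  have cont: "continuous ?F (euler_step X c p)" by (simp add: euler_step_def[abs_def])
  have d: "((snd c \<circ> euler_step X c p) has_vector_derivative X p c) ?F"
    unfolding has_vector_derivative_def
  proof (rule has_derivative_transform_eventually)
    show "(?x has_derivative (\<lambda>h. h *\<^sub>R X p c)) ?F" by (auto intro!: derivative_eq_intros)
    show "\<forall>\<^sub>F \<tau> in ?F. ?x \<tau> = (snd c \<circ> euler_step X c p) \<tau>"
      using ev by eventually_elim (use c in \<open>simp add: euler_step_def\<close>)
  qed (use c in \<open>auto simp: euler_step_def\<close>)
  have "((snd c' \<circ> euler_step X c p) has_vector_derivative X p c') ?F"
    if c': "c' \<in> A" "p \<in> fst c'" for c'
    using chart_change_deriv[OF c(1) c'(1) _ _ _ eventually_in_chart[OF c(1) cont] d]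
      tangent_compatible[OF X c(1) c'(1) c(2) c'(2)] c c' by (simp add: e0)
  then show ?thesis using e0 cont by (simp add: starts_along_def)
qed

text \<open>In coordinates \<open>\<alpha>\<close> deviates from its tangent line by
  \<open>o(\<tau>)\<close>, and the Lipschitz bound carries this over to the distance. Giving both
  orders of the arguments stands in for the symmetry of the distance.\<close>

lemma starts_along_near_euler_step:
  assumes \<alpha>: "starts_along X p \<alpha>" and c: "c \<in> A" "p \<in> fst c" and e: "0 < e"
  obtains \<delta> where "0 < \<delta>" "\<And>\<tau>. 0 < \<tau> \<Longrightarrow> \<tau> < \<delta> \<Longrightarrow> rdist (\<alpha> \<tau>) (euler_step X c p \<tau>) \<le> ereal (e * \<tau>)"
    "\<And>\<tau>. 0 < \<tau> \<Longrightarrow> \<tau> < \<delta> \<Longrightarrow> rdist (euler_step X c p \<tau>) (\<alpha> \<tau>) \<le> ereal (e * \<tau>)"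
proof -
  let ?x = "\<lambda>\<tau>. snd c p + \<tau> *\<^sub>R X p c" and ?F = "at 0 within {0::real..}"
  have \<alpha>0: "\<alpha> 0 = p" and c\<alpha>: "continuous ?F \<alpha>"
    and d: "((snd c \<circ> \<alpha>) has_vector_derivative X p c) ?F"
    using \<alpha> c by (auto simp: starts_along_def)
  have p: "snd c p \<in> coords c" using c by simp
  obtain r B where rB: "0 < r" "0 \<le> B" "ball (snd c p) r \<subseteq> coords c"
    "\<And>x y. x \<in> ball (snd c p) r \<Longrightarrow> y \<in> ball (snd c p) r \<Longrightarrow>
      rdist (inv_chart c x) (inv_chart c y) \<le> ereal (B * norm (y - x))"
    using rdist_chart_lipschitz[OF c(1) p] by metis
  have ev1: "\<forall>\<^sub>F \<tau> in ?F. ?x \<tau> \<in> ball (snd c p) r"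
  proof -
    have "continuous ?F ?x" by (intro continuous_intros)
    then have "(?x \<longlongrightarrow> snd c p) ?F" by (simp add: continuous_within)
    from topological_tendstoD[OF this open_ball] show ?thesis using rB(1) by simp
  qed
  have ev2: "\<forall>\<^sub>F \<tau> in ?F. snd c (\<alpha> \<tau>) \<in> ball (snd c p) r"
  proof -
    have "((\<lambda>\<tau>. snd c (\<alpha> \<tau>)) \<longlongrightarrow> snd c p) ?F"
      using has_vector_derivative_continuous[OF d] \<alpha>0 by (simp add: continuous_within o_def)
    from topological_tendstoD[OF this open_ball] show ?thesis using rB(1) by simp
  qed
  have ev3: "\<forall>\<^sub>F \<tau> in ?F. \<alpha> \<tau> \<in> fst c"
    by (rule eventually_in_chart[OF c(1) c\<alpha>]) (simp add: \<alpha>0 c)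
  obtain d1 where d1: "d1 > 0" "\<And>\<tau>. 0 < \<tau> \<Longrightarrow> \<tau> < d1 \<Longrightarrow>
      ?x \<tau> \<in> ball (snd c p) r \<and> snd c (\<alpha> \<tau>) \<in> ball (snd c p) r \<and> \<alpha> \<tau> \<in> fst c"
    using eventually_conj[OF ev1 eventually_conj[OF ev2 ev3]]
    unfolding eventually_at by (force simp: dist_real_def)
  \<comment> \<open>\<open>B\<close> may be 0, hence \<open>B + 1\<close>.\<close>
  have "0 < e / (B + 1)" using e rB(2) by simp
  with d[unfolded has_vector_derivative_def has_derivative_within_alt]
  obtain d2 where d2: "d2 > 0" "\<And>\<tau>. 0 < \<tau> \<Longrightarrow> \<tau> < d2 \<Longrightarrow>
      norm (snd c (\<alpha> \<tau>) - ?x \<tau>) \<le> e / (B + 1) * \<tau>"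
    by (force simp: \<alpha>0 algebra_simps)
  have le: "B * norm v \<le> e * \<tau>" if "norm v \<le> e / (B + 1) * \<tau>" "0 < \<tau>" for v :: 'e and \<tau>
  proof -
    have "B * norm v \<le> (B + 1) * (e / (B + 1) * \<tau>)"
      by (intro mult_mono that) (use rB(2) in auto)
    then show ?thesis using rB(2) by simp
  qed
  show ?thesis
  proof (rule that)
    show "0 < min d1 d2" using d1 d2 by simp
    fix \<tau> assume \<tau>: "0 < \<tau>" "\<tau> < min d1 d2"
    have in_c: "inv_chart c (snd c (\<alpha> \<tau>)) = \<alpha> \<tau>" using d1(2)[of \<tau>] \<tau> c by simp
    have 1: "norm (snd c (\<alpha> \<tau>) - ?x \<tau>) \<le> e / (B + 1) * \<tau>" using d2(2) \<tau> by simp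
    then have 2: "norm (?x \<tau> - snd c (\<alpha> \<tau>)) \<le> e / (B + 1) * \<tau>" by (simp add: norm_minus_commute)
    show "rdist (\<alpha> \<tau>) (euler_step X c p \<tau>) \<le> ereal (e * \<tau>)"
      using rB(4)[of "snd c (\<alpha> \<tau>)" "?x \<tau>"] d1(2)[of \<tau>] \<tau> le[OF 2 \<tau>(1)] in_c
      by (auto simp: euler_step_def intro: order_trans)
    show "rdist (euler_step X c p \<tau>) (\<alpha> \<tau>) \<le> ereal (e * \<tau>)"
      using rB(4)[of "?x \<tau>" "snd c (\<alpha> \<tau>)"] d1(2)[of \<tau>] \<tau> le[OF 1 \<tau>(1)] in_c
      by (auto simp: euler_step_def intro: order_trans)
  qed
qed

end

section \<open>Arcs moved along a monotone vector field\<close>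

locale monotone_vfield = riemannian A g
  for A :: "('m::{second_countable_topology,t2_space}, 'e::euclidean_space) chart set"
    and g :: "'m \<Rightarrow> ('m, 'e) tvec \<Rightarrow> ('m, 'e) tvec \<Rightarrow> real" +
  fixes nabla :: "'m \<Rightarrow> ('m, 'e) tvec \<Rightarrow> ('m, 'e) vfield \<Rightarrow> ('m, 'e) tvec"
    and U :: "'m set" and X :: "('m, 'e) vfield" and \<nu> :: real
  assumes connection: "levi_civita A g nabla"
    and smooth_X: "smooth_vfield_on A UNIV X"
    and monotone: "\<forall>x\<in>U. \<forall>v\<in>tangent_space A x. g x (nabla x v X) v \<le> \<nu> * (tv_norm g x v)\<^sup>2"
begin

lemma X_tangent: "X p \<in> tangent_space A p"
  using smooth_X unfolding smooth_vfield_on_def by blast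

lemma smooth_X_coords: "c \<in> A \<Longrightarrow> smooth_on (coords c) (\<lambda>x. X (inv_chart c x) c)"
  using smooth_X unfolding smooth_vfield_on_def by auto

text \<open>Monotonicity is evaluated on the coordinate field of \<open>v\<close>; the result is the
  hypothesis \<open>lie\<close> of the Euclidean growth estimates.\<close>

lemma lie_derivative_le:
  assumes c: "c \<in> A" and p: "p \<in> fst c" "p \<in> U"
  shows "frechet_derivative (\<lambda>y. metric_coords c y v v) (at (snd c p)) (X p c)
      + 2 * metric_coords c (snd c p) (frechet_derivative (\<lambda>x. X (inv_chart c x) c) (at (snd c p)) v) v
    \<le> 2 * \<nu> * metric_coords c (snd c p) v v"
proof -
  let ?V = "coord_field A c v p"
  have T: "?V \<in> tangent_space A p" by (rule coord_field_tangent[OF c p(1)])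
  have "g p (nabla p ?V X) ?V \<le> \<nu> * (tv_norm g p ?V)\<^sup>2" using monotone p(2) T by blast
  also have "(tv_norm g p ?V)\<^sup>2 = metric_coords c (snd c p) v v"
    using metric_nonneg[OF T] metric_eq_coords[OF c p(1) T T] c p(1)
    by (simp add: tv_norm_def coord_field_self)
  finally show ?thesis
    using lie_derivative_metric[OF connection smooth_X c p(1), of v] c p(1) by simp
qed

text \<open>Moving the coordinate curve \<open>x\<close> by one Euler step gives a curve with
  derivative \<open>x' + \<tau> * DY x'\<close>, the very vector whose norm
  \<open>euler_step_norm_growth\<close> bounds; integration bounds the length of the moved
  arc.\<close>

lemma euler_steps_of_arc:
  assumes \<gamma>: "C1_curve A {0..1} \<gamma>" and ab: "0 \<le> a" "a < b" "b \<le> 1"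
    and c: "c \<in> A" and in_c: "\<gamma> ` {a..b} \<subseteq> fst c" and in_U: "\<gamma> ` {a..b} \<subseteq> U" and e: "0 < e"
  obtains \<delta> where "0 < \<delta>" "\<And>\<tau>. 0 < \<tau> \<Longrightarrow> \<tau> < \<delta> \<Longrightarrow>
    rdist (euler_step X c (\<gamma> a) \<tau>) (euler_step X c (\<gamma> b) \<tau>)
      \<le> ereal ((1 + \<tau> * (\<nu> + e)) * integral {a..b} (speed {0..1} \<gamma>))"
proof -
  interpret coordinate_metric "coords c" "metric_coords c" by (rule coordinate_metric_coords[OF c])
  define x where "x s = snd c (\<gamma> s)" for s
  define x' where "x' s = velocity A {0..1} \<gamma> s c" for s
  define Y where "Y y = X (inv_chart c y) c" for y
  define DY where "DY y = frechet_derivative Y (at y)" for y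
  have sub: "{a..b} \<subseteq> {0..1}" using ab by auto
  have Y: "smooth_on (coords c) Y" using smooth_X_coords[OF c] by (simp add: Y_def[abs_def])
  have x_in: "x s \<in> coords c" if "s \<in> {a..b}" for s
    using in_c that unfolding x_def by blast
  have dx: "(x has_vector_derivative x' s) (at s within {a..b})" if "s \<in> {a..b}" for s
  proof -
    have "((snd c \<circ> \<gamma>) has_vector_derivative x' s) (at s within {0..1})"
      unfolding x'_def by (rule C1_curve_deriv[OF \<gamma> _ c]) (use that sub in_c in auto)
    then show ?thesis
      by (auto simp: x_def[abs_def] o_def intro: has_vector_derivative_within_subset[OF _ sub])
  qed
  have cx: "continuous_on {a..b} x"
    unfolding continuous_on_eq_continuous_within using dx has_vector_derivative_continuous by blast
  have cx': "continuous_on {a..b} x'"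
    unfolding continuous_on_eq_continuous_within
  proof
    fix s assume s: "s \<in> {a..b}"
    have "continuous (at s within {0..1}) x'"
      unfolding x'_def by (rule C1_velocity_continuous[OF \<gamma> _ c]) (use s sub in_c in auto)
    then show "continuous (at s within {a..b}) x'" by (rule continuous_within_subset[OF _ sub])
  qed
  \<comment> \<open>The trace of the arc is compact, so one \<delta> serves all of its
    points.\<close>
  define K where "K = x ` {a..b}"
  have K: "compact K" "K \<subseteq> coords c"
    using compact_continuous_image[OF cx] x_in by (auto simp: K_def)
  have lie: "DG y v v (Y y) + 2 * metric_coords c y (frechet_derivative Y (at y) v) v
      \<le> 2 * \<nu> * metric_coords c y v v" if y: "y \<in> K" for y v
  proof -
    obtain s where s: "s \<in> {a..b}" "y = snd c (\<gamma> s)" using y by (auto simp: K_def x_def)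
    then have "\<gamma> s \<in> fst c" "\<gamma> s \<in> U" using in_c in_U by auto
    from lie_derivative_le[OF c this, of v] show ?thesis
      using \<open>\<gamma> s \<in> fst c\<close> c by (simp add: s(2) Y_def[abs_def])
  qed
  obtain \<delta> where \<delta>: "0 < \<delta>"
    "\<And>y \<tau>. y \<in> K \<Longrightarrow> 0 \<le> \<tau> \<Longrightarrow> \<tau> \<le> \<delta> \<Longrightarrow> y + \<tau> *\<^sub>R Y y \<in> coords c"
    "\<And>y \<tau> v. y \<in> K \<Longrightarrow> 0 \<le> \<tau> \<Longrightarrow> \<tau> \<le> \<delta> \<Longrightarrow>
      sqrt (metric_coords c (y + \<tau> *\<^sub>R Y y) (v + \<tau> *\<^sub>R DY y v) (v + \<tau> *\<^sub>R DY y v))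
        \<le> (1 + \<tau> * (\<nu> + e)) * sqrt (metric_coords c y v v)"
    unfolding DY_def using euler_step_norm_growth[OF K Y lie e] by blast
  have int: "(speed {0..1} \<gamma> has_integral integral {a..b} (speed {0..1} \<gamma>)) {a..b}"
    using continuous_on_subset[OF continuous_on_speed[OF \<gamma> zero_less_one] sub]
    by (intro integrable_integral integrable_continuous_interval)
  show ?thesis
  proof (rule that[OF \<delta>(1)])
    fix \<tau> assume \<tau>: "0 < \<tau>" "\<tau> < \<delta>"
    let ?y = "\<lambda>s. x s + \<tau> *\<^sub>R Y (x s)" and ?y' = "\<lambda>s. x' s + \<tau> *\<^sub>R DY (x s) (x' s)"
    let ?I = "(1 + \<tau> * (\<nu> + e)) * integral {a..b} (speed {0..1} \<gamma>)"
    have "rdist (inv_chart c (?y a)) (inv_chart c (?y b)) \<le> ereal ?I"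
    proof (rule rdist_le_chart_curve[OF c ab(2), where x = ?y and x' = ?y'])
      show "?y ` {a..b} \<subseteq> coords c" using \<delta>(2) \<tau> by (auto simp: K_def)
      show "(?y has_vector_derivative ?y' s) (at s within {a..b})" if s: "s \<in> {a..b}" for s
      proof -
        have DY: "(Y has_derivative DY (x s)) (at (x s))"
          unfolding DY_def by (rule smooth_on_has_derivative[OF Y x_in[OF s]])
        have "((\<lambda>s. Y (x s)) has_derivative (\<lambda>h. DY (x s) (h *\<^sub>R x' s))) (at s within {a..b})"
          by (rule has_derivative_compose[OF dx[OF s, unfolded has_vector_derivative_def] DY])
        then have "((\<lambda>s. Y (x s)) has_vector_derivative DY (x s) (x' s)) (at s within {a..b})"
          by (simp add: has_vector_derivative_def linear_scale[OF has_derivative_linear[OF DY]])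
        then show ?thesis
          using dx[OF s] by (auto intro!: derivative_eq_intros)
      qed
      have "continuous_on {a..b} (\<lambda>s. (x s, x' s))" by (intro continuous_on_Pair cx cx')
      moreover have "(\<lambda>s. (x s, x' s)) ` {a..b} \<subseteq> coords c \<times> UNIV" using x_in by auto
      ultimately have "continuous_on {a..b} (\<lambda>s. DY (x s) (x' s))"
        using continuous_on_compose2[OF smooth_on_continuous_derivative[OF Y],
          of "{a..b}" "\<lambda>s. (x s, x' s)"] by (simp add: DY_def)
      then show "continuous_on {a..b} ?y'" by (intro continuous_intros cx')
      show "sqrt (metric_coords c (?y s) (?y' s) (?y' s)) \<le> (1 + \<tau> * (\<nu> + e)) * speed {0..1} \<gamma> s"
        if s: "s \<in> {a..b}" for s
      proof -
        have "speed {0..1} \<gamma> s = sqrt (metric_coords c (x s) (x' s) (x' s))"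
          unfolding x_def x'_def
          by (rule speed_coords[OF \<gamma> zero_less_one _ c]) (use s sub in_c in auto)
        then show ?thesis using \<delta>(3)[of "x s" \<tau> "x' s"] \<tau> s by (simp add: K_def)
      qed
      show "((\<lambda>s. (1 + \<tau> * (\<nu> + e)) * speed {0..1} \<gamma> s) has_integral ?I) {a..b}"
        by (rule has_integral_mult_right[OF int])
    qed
    moreover have "inv_chart c (?y s) = euler_step X c (\<gamma> s) \<tau>" if "s \<in> {a..b}" for s
      using in_c that c by (simp add: euler_step_def x_def Y_def image_subset_iff)
    ultimately show "rdist (euler_step X c (\<gamma> a) \<tau>) (euler_step X c (\<gamma> b) \<tau>) \<le> ereal ?I"
      using ab by simp
  qed
qed

text \<open>Small arcs are transported in a chart by one Euler step; Bolzano's covering argument glues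
  the resulting estimates, since Euler steps taken in different charts differ by \<open>o(\<tau>)\<close>.\<close>

lemma transported_arc_length:
  assumes \<gamma>: "C1_curve A {0..1} \<gamma>" and in_U: "\<gamma> ` {0..1} \<subseteq> U"
    and \<alpha>: "starts_along X (\<gamma> 0) \<alpha>" and \<beta>: "starts_along X (\<gamma> 1) \<beta>" and e: "0 < e"
  obtains \<delta> where "0 < \<delta>" "\<And>\<tau>. 0 < \<tau> \<Longrightarrow> \<tau> < \<delta> \<Longrightarrow>
    rdist (\<alpha> \<tau>) (\<beta> \<tau>) \<le> ereal ((1 + \<tau> * (\<nu> + e)) * arc_length 0 1 \<gamma> + e * \<tau>)"
proof -
  define L where "L a b = integral {a..b} (speed {0..1} \<gamma>)" for a b
  have L_nonneg: "0 \<le> L a b" if "0 \<le> a" "b \<le> 1" for a b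
    unfolding L_def
    using that speed_nonneg[OF \<gamma> zero_less_one]
      continuous_on_subset[OF continuous_on_speed[OF \<gamma> zero_less_one], of "{a..b}"]
    by (intro integral_nonneg integrable_continuous_interval) auto
  have L_add: "L a b + L b c = L a c" if "0 \<le> a" "a \<le> b" "b \<le> c" "c \<le> 1" for a b c
    unfolding L_def
    using that continuous_on_subset[OF continuous_on_speed[OF \<gamma> zero_less_one], of "{a..c}"]
    by (intro Henstock_Kurzweil_Integration.integral_combine integrable_continuous_interval) auto
  \<comment> \<open>Quantifying over all \<alpha>, \<beta> and \<open>e\<close> lets adjacent
    intervals be combined: one auxiliary curve serves both sides at the common point, and each side
    is used with half the error. The guards on \<open>a\<close> and \<open>b\<close> are there
    because the small intervals of Bolzano's argument may stick out of
    \<open>{0..1}\<close>.\<close>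
  define P where "P a b \<longleftrightarrow> (0 \<le> a \<longrightarrow> b \<le> 1 \<longrightarrow>
      (\<forall>\<alpha> \<beta> e. starts_along X (\<gamma> a) \<alpha> \<and> starts_along X (\<gamma> b) \<beta> \<and> 0 < e \<longrightarrow>
        (\<exists>\<delta>>0. \<forall>\<tau>. 0 < \<tau> \<and> \<tau> < \<delta> \<longrightarrow>
          rdist (\<alpha> \<tau>) (\<beta> \<tau>) \<le> ereal ((1 + \<tau> * (\<nu> + e)) * L a b + e * \<tau>))))" for a b
  have "P 0 1"
  proof (rule Bolzano[of 0 1 P])
    fix a b c assume trans: "P a b" "P b c" "a \<le> b" "b \<le> c"
    show "P a c"
      unfolding P_def
    proof (intro impI allI, elim conjE)
      fix \<alpha> \<beta> and e :: real
      assume ac: "0 \<le> a" "c \<le> 1" and \<alpha>: "starts_along X (\<gamma> a) \<alpha>"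
        and \<beta>: "starts_along X (\<gamma> c) \<beta>" and e: "0 < e"
      \<comment> \<open>Any curve that leaves the junction in the direction of \<open>X\<close> will
        do; an Euler step in some chart is one.\<close>
      obtain k where "k \<in> A" "\<gamma> b \<in> fst k" by (rule chart_around)
      then obtain \<mu> where \<mu>: "starts_along X (\<gamma> b) \<mu>"
        using starts_along_euler_step X_tangent by blast
      have e2: "0 < e / 2" using e by simp
      obtain \<delta>1 where \<delta>1: "0 < \<delta>1" "\<And>\<tau>. 0 < \<tau> \<Longrightarrow> \<tau> < \<delta>1 \<Longrightarrow>
          rdist (\<alpha> \<tau>) (\<mu> \<tau>) \<le> ereal ((1 + \<tau> * (\<nu> + e / 2)) * L a b + e / 2 * \<tau>)"
        using trans(1,4) ac \<alpha> \<mu> e2 unfolding P_def by (meson order_trans)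
      obtain \<delta>2 where \<delta>2: "0 < \<delta>2" "\<And>\<tau>. 0 < \<tau> \<Longrightarrow> \<tau> < \<delta>2 \<Longrightarrow>
          rdist (\<mu> \<tau>) (\<beta> \<tau>) \<le> ereal ((1 + \<tau> * (\<nu> + e / 2)) * L b c + e / 2 * \<tau>)"
        using trans(2,3) ac \<beta> \<mu> e2 unfolding P_def by (meson order_trans)
      have "rdist (\<alpha> \<tau>) (\<beta> \<tau>) \<le> ereal ((1 + \<tau> * (\<nu> + e)) * L a c + e * \<tau>)"
        if \<tau>: "0 < \<tau>" "\<tau> < min \<delta>1 \<delta>2" for \<tau>
      proof -
        have "rdist (\<alpha> \<tau>) (\<beta> \<tau>) \<le> ereal (((1 + \<tau> * (\<nu> + e / 2)) * L a b + e / 2 * \<tau>) +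
            ((1 + \<tau> * (\<nu> + e / 2)) * L b c + e / 2 * \<tau>))"
          by (rule rdist_triangle_le[OF \<delta>1(2) \<delta>2(2)]) (use \<tau> in auto)
        also have "\<dots> = ereal ((1 + \<tau> * (\<nu> + e / 2)) * L a c + e * \<tau>)"
          unfolding L_add[OF ac(1) trans(3,4) ac(2), symmetric] by (simp add: field_simps)
        also have "\<dots> \<le> ereal ((1 + \<tau> * (\<nu> + e)) * L a c + e * \<tau>)"
          using \<tau> e L_nonneg[OF ac] by (auto intro!: mult_right_mono)
        finally show ?thesis .
      qed
      then show "\<exists>\<delta>>0. \<forall>\<tau>. 0 < \<tau> \<and> \<tau> < \<delta> \<longrightarrow>
          rdist (\<alpha> \<tau>) (\<beta> \<tau>) \<le> ereal ((1 + \<tau> * (\<nu> + e)) * L a c + e * \<tau>)"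
        using \<delta>1(1) \<delta>2(1) by (intro exI[of _ "min \<delta>1 \<delta>2"]) auto
    qed
  next
    fix s0 :: real assume s0: "0 \<le> s0" "s0 \<le> 1"
    obtain c where c: "c \<in> A" "\<gamma> s0 \<in> fst c" by (rule chart_around)
    obtain V where V: "open V" "\<And>s. s \<in> {0..1} \<Longrightarrow> s \<in> V \<longleftrightarrow> \<gamma> s \<in> fst c"
      using continuous_on_preimage_open[OF C1_curve_continuous[OF \<gamma>] open_chart_domain[OF c(1)]] by metis
    have "s0 \<in> V" using V(2) s0 c by simp
    then obtain d where d: "d > 0" "ball s0 d \<subseteq> V" using V(1) open_contains_ball by blast
    have "P a b" if ab: "a \<le> s0" "s0 \<le> b" "b - a < d" for a b
      unfolding P_def
    proof (intro impI allI, elim conjE)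
      fix \<alpha> \<beta> and e :: real
      assume ab01: "0 \<le> a" "b \<le> 1" and \<alpha>: "starts_along X (\<gamma> a) \<alpha>"
        and \<beta>: "starts_along X (\<gamma> b) \<beta>" and e: "0 < e"
      have "{a..b} \<subseteq> ball s0 d" using ab by (auto simp: dist_real_def)
      then have in_c: "\<gamma> ` {a..b} \<subseteq> fst c" using V(2) d(2) ab01 by force
      have in_U': "\<gamma> ` {a..b} \<subseteq> U" using in_U ab01 by fastforce
      have ends: "\<gamma> a \<in> fst c" "\<gamma> b \<in> fst c" using in_c ab by auto
      have e2: "0 < e / 2" using e by simp
      let ?E = "euler_step X c"
      obtain \<delta>1 where \<delta>1: "0 < \<delta>1"
        "\<And>\<tau>. 0 < \<tau> \<Longrightarrow> \<tau> < \<delta>1 \<Longrightarrow> rdist (\<alpha> \<tau>) (?E (\<gamma> a) \<tau>) \<le> ereal (e / 2 * \<tau>)"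
        using starts_along_near_euler_step[OF \<alpha> c(1) ends(1) e2] by metis
      obtain \<delta>2 where \<delta>2: "0 < \<delta>2"
        "\<And>\<tau>. 0 < \<tau> \<Longrightarrow> \<tau> < \<delta>2 \<Longrightarrow> rdist (?E (\<gamma> b) \<tau>) (\<beta> \<tau>) \<le> ereal (e / 2 * \<tau>)"
        using starts_along_near_euler_step[OF \<beta> c(1) ends(2) e2] by metis
      obtain \<delta>3 where \<delta>3: "0 < \<delta>3" "\<And>\<tau>. 0 < \<tau> \<Longrightarrow> \<tau> < \<delta>3 \<Longrightarrow>
          rdist (?E (\<gamma> a) \<tau>) (?E (\<gamma> b) \<tau>) \<le> ereal ((1 + \<tau> * (\<nu> + e)) * L a b)"
      proof (cases "a = b")
        \<comment> \<open>Curves are measured on intervals of positive length, so the trivial arc is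
          treated apart: both Euler steps coincide.\<close>
        case True
        then show ?thesis using that[of 1] rdist_self by (simp add: L_def zero_ereal_def)
      next
        case False
        then have "a < b" using ab by simp
        from euler_steps_of_arc[OF \<gamma> ab01(1) this ab01(2) c(1) in_c in_U' e]
        obtain \<delta> where "0 < \<delta>" "\<And>\<tau>. 0 < \<tau> \<Longrightarrow> \<tau> < \<delta> \<Longrightarrow>
            rdist (?E (\<gamma> a) \<tau>) (?E (\<gamma> b) \<tau>) \<le> ereal ((1 + \<tau> * (\<nu> + e)) * L a b)"
          unfolding L_def by blast
        then show ?thesis by (rule that)
      qed
      have "rdist (\<alpha> \<tau>) (\<beta> \<tau>) \<le> ereal ((1 + \<tau> * (\<nu> + e)) * L a b + e * \<tau>)"
        if \<tau>: "0 < \<tau>" "\<tau> < min \<delta>1 (min \<delta>2 \<delta>3)" for \<tau>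
      proof -
        have "rdist (\<alpha> \<tau>) (\<beta> \<tau>) \<le> ereal (e / 2 * \<tau> + ((1 + \<tau> * (\<nu> + e)) * L a b + e / 2 * \<tau>))"
          by (rule rdist_triangle_le[OF \<delta>1(2) rdist_triangle_le[OF \<delta>3(2) \<delta>2(2)]]) (use \<tau> in auto)
        also have "e / 2 * \<tau> + ((1 + \<tau> * (\<nu> + e)) * L a b + e / 2 * \<tau>) =
            (1 + \<tau> * (\<nu> + e)) * L a b + e * \<tau>" by simp
        finally show ?thesis .
      qed
      then show "\<exists>\<delta>>0. \<forall>\<tau>. 0 < \<tau> \<and> \<tau> < \<delta> \<longrightarrow>
          rdist (\<alpha> \<tau>) (\<beta> \<tau>) \<le> ereal ((1 + \<tau> * (\<nu> + e)) * L a b + e * \<tau>)"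
        using \<delta>1(1) \<delta>2(1) \<delta>3(1) by (intro exI[of _ "min \<delta>1 (min \<delta>2 \<delta>3)"]) auto
    qed
    then show "\<exists>d>0. \<forall>a b. a \<le> s0 \<and> s0 \<le> b \<and> b - a < d \<longrightarrow> P a b" using d(1) by blast
  qed simp
  from this[unfolded P_def, THEN mp, THEN mp, OF order_refl order_refl] \<alpha> \<beta> e
  obtain \<delta> where "0 < \<delta>" "\<forall>\<tau>. 0 < \<tau> \<and> \<tau> < \<delta> \<longrightarrow>
      rdist (\<alpha> \<tau>) (\<beta> \<tau>) \<le> ereal ((1 + \<tau> * (\<nu> + e)) * L 0 1 + e * \<tau>)"
    by blast
  then show ?thesis
    by (intro that[of \<delta>]) (simp_all add: L_def arc_length_def)
qed

end

section \<open>Integral curves and the global error\<close>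

text \<open>The operator norm of the derivative is at most the sum of the norms of the partial
  derivatives, which is bounded on a compact ball; the mean value inequality on the convex ball does
  the rest.\<close>

lemma smooth_on_locally_lipschitz:
  fixes F :: "'a::euclidean_space \<Rightarrow> 'b::real_normed_vector"
  assumes F: "smooth_on S F" and S: "open S" "x0 \<in> S"
  obtains r K where "0 < r" "0 \<le> K" "ball x0 r \<subseteq> S"
    "\<And>x y. x \<in> ball x0 r \<Longrightarrow> y \<in> ball x0 r \<Longrightarrow> norm (F x - F y) \<le> K * norm (x - y)"
proof -
  obtain r where r: "r > 0" "cball x0 r \<subseteq> S" using S open_contains_cball by blast
  let ?D = "\<lambda>x. frechet_derivative F (at x)"
  have "continuous_on (cball x0 r) (\<lambda>x. \<Sum>b\<in>Basis. norm (?D x b))"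
    using smooth_on_imp_continuous_on[OF smooth_on_frechet_derivative[OF F]] r(2)
    by (intro continuous_on_sum continuous_on_norm) (auto intro: continuous_on_subset)
  from compact_imp_bounded[OF compact_continuous_image[OF this compact_cball]]
  obtain K where K: "K > 0" "\<And>x. x \<in> cball x0 r \<Longrightarrow> \<bar>\<Sum>b\<in>Basis. norm (?D x b)\<bar> \<le> K"
    by (auto simp: bounded_pos)
  have D: "(F has_derivative ?D x) (at x)" if "x \<in> cball x0 r" for x
    using smooth_on_has_derivative[OF F] that r(2) by blast
  have onorm_K: "onorm (?D x) \<le> K" if x: "x \<in> ball x0 r" for x
  proof (rule onorm_le)
    fix v
    have x': "x \<in> cball x0 r" using x by auto
    have "norm (?D x v) = norm (\<Sum>b\<in>Basis. (v \<bullet> b) *\<^sub>R ?D x b)"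
      by (subst linear_eq_sum_Basis[OF has_derivative_linear[OF D[OF x']]]) simp
    also have "\<dots> \<le> (\<Sum>b\<in>Basis. norm v * norm (?D x b))"
      by (intro order_trans[OF norm_sum] sum_mono)
        (auto intro!: mult_right_mono Basis_le_norm)
    also have "\<dots> = (\<Sum>b\<in>Basis. norm (?D x b)) * norm v" by (simp add: sum_distrib_left mult.commute)
    also have "\<dots> \<le> K * norm v" using K(2)[OF x'] by (intro mult_right_mono) auto
    finally show "norm (?D x v) \<le> K * norm v" .
  qed
  have "norm (F x - F y) \<le> K * norm (x - y)" if "x \<in> ball x0 r" "y \<in> ball x0 r" for x y
  proof (rule differentiable_bound[OF convex_ball _ _ that])
    fix z assume z: "z \<in> ball x0 r"
    then have "(F has_derivative ?D z) (at z)" by (intro D) auto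
    then show "(F has_derivative ?D z) (at z within ball x0 r)" by (rule has_derivative_at_withinI)
    show "onorm (?D z) \<le> K" by (rule onorm_K[OF z])
  qed
  moreover have "ball x0 r \<subseteq> S" using r(2) ball_subset_cball by blast
  ultimately show ?thesis using that[of r K] r(1) K(1) by auto
qed

text \<open>At a maximum of the norm of the difference \<open>w\<close>, the mean value inequality
  gives \<open>norm (w t) \<le> K * (b - a) * norm (w t)\<close>, and the factor is less than
  1.\<close>

lemma lipschitz_ode_unique:
  fixes u1 u2 :: "real \<Rightarrow> 'a::real_normed_vector"
  assumes ab: "a \<le> b" and K: "0 \<le> K" "K * (b - a) < 1"
    and lip: "\<And>x y. x \<in> B \<Longrightarrow> y \<in> B \<Longrightarrow> norm (F x - F y) \<le> K * norm (x - y)"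
    and u1: "\<And>s. s \<in> {a..b} \<Longrightarrow> (u1 has_vector_derivative F (u1 s)) (at s within {a..b})"
    and u2: "\<And>s. s \<in> {a..b} \<Longrightarrow> (u2 has_vector_derivative F (u2 s)) (at s within {a..b})"
    and B: "\<And>s. s \<in> {a..b} \<Longrightarrow> u1 s \<in> B" "\<And>s. s \<in> {a..b} \<Longrightarrow> u2 s \<in> B"
    and init: "u1 a = u2 a" and s: "s \<in> {a..b}"
  shows "u1 s = u2 s"
proof -
  define w where "w t = u1 t - u2 t" for t
  have dw: "(w has_vector_derivative F (u1 t) - F (u2 t)) (at t within {a..b})" if "t \<in> {a..b}" for t
    unfolding w_def by (intro has_vector_derivative_diff u1 u2 that)
  have "continuous_on {a..b} w"
    unfolding continuous_on_eq_continuous_within using dw has_vector_derivative_continuous by blast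
  then have "continuous_on {a..b} (\<lambda>t. norm (w t))" by (rule continuous_on_norm)
  then obtain t where t: "t \<in> {a..b}" "\<And>r. r \<in> {a..b} \<Longrightarrow> norm (w r) \<le> norm (w t)"
    using continuous_attains_sup[of "{a..b}" "\<lambda>t. norm (w t)"] ab by auto
  have "norm (w t - w a) \<le> (K * norm (w t)) * norm (t - a)"
  proof (rule differentiable_bound[of "{a..b}" w "\<lambda>r h. h *\<^sub>R (F (u1 r) - F (u2 r))"])
    show "(w has_derivative (\<lambda>h. h *\<^sub>R (F (u1 r) - F (u2 r)))) (at r within {a..b})" if "r \<in> {a..b}" for r
      using dw[OF that] by (simp add: has_vector_derivative_def)
    show "onorm (\<lambda>h. h *\<^sub>R (F (u1 r) - F (u2 r))) \<le> K * norm (w t)" if r: "r \<in> {a..b}" for r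
    proof (rule onorm_le)
      fix h :: real
      have "norm (F (u1 r) - F (u2 r)) \<le> K * norm (w r)"
        unfolding w_def by (rule lip[OF B(1)[OF r] B(2)[OF r]])
      also have "\<dots> \<le> K * norm (w t)" by (rule mult_left_mono[OF t(2)[OF r] K(1)])
      finally have "\<bar>h\<bar> * norm (F (u1 r) - F (u2 r)) \<le> \<bar>h\<bar> * (K * norm (w t))"
        by (rule mult_left_mono) simp
      then show "norm (h *\<^sub>R (F (u1 r) - F (u2 r))) \<le> K * norm (w t) * norm h"
        by (simp add: mult.commute)
    qed
  qed (use t ab in auto)
  then have "norm (w t) \<le> K * norm (w t) * (t - a)" using t(1) init by (simp add: w_def)
  also have "\<dots> \<le> K * norm (w t) * (b - a)" using t(1) K(1) by (intro mult_left_mono) auto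
  finally have "norm (w t) * (1 - K * (b - a)) \<le> 0" by (simp add: algebra_simps)
  then have "norm (w t) \<le> 0" using K(2) by (simp add: mult_le_0_iff)
  then have "norm (w s) \<le> 0" using t(2)[OF s] by linarith
  then show ?thesis by (simp add: w_def)
qed

lemma integral_curve_subset: "integral_curve A X S y \<Longrightarrow> T \<subseteq> S \<Longrightarrow> integral_curve A X T y"
  unfolding integral_curve_def
  by (meson continuous_on_subset has_vector_derivative_within_subset subsetD)

lemma integral_curve_shift:
  assumes "integral_curve A X {a..b} y"
  shows "integral_curve A X {a - t..b - t} (\<lambda>s. y (t + s))"
  unfolding integral_curve_def
proof (intro conjI ballI impI)
  let ?f = "\<lambda>s::real. t + s"
  have im: "?f ` {a - t..b - t} \<subseteq> {a..b}" by auto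
  have "continuous_on {a..b} y" using assms by (simp add: integral_curve_def)
  then show "continuous_on {a - t..b - t} (\<lambda>s. y (t + s))"
    by (rule continuous_on_compose2[OF _ _ im]) (intro continuous_intros)
  fix c s assume c: "c \<in> A" "y (t + s) \<in> fst c" and s: "s \<in> {a - t..b - t}"
  have "((snd c \<circ> y) has_vector_derivative X (y (t + s)) c) (at (t + s) within {a..b})"
    using assms c s unfolding integral_curve_def by auto
  then have "((snd c \<circ> y) has_vector_derivative X (y (t + s)) c) (at (?f s) within ?f ` {a - t..b - t})"
    by (rule has_vector_derivative_within_subset[OF _ im])
  moreover have "(?f has_vector_derivative 1) (at s within {a - t..b - t})"
    unfolding has_real_derivative_iff_has_vector_derivative[symmetric]
    by (auto intro!: derivative_eq_intros)
  ultimately have "((snd c \<circ> y) \<circ> ?f has_vector_derivative 1 *\<^sub>R X (y (t + s)) c) (at s within {a - t..b - t})"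
    by (intro vector_diff_chain_within)
  then show "((snd c \<circ> (\<lambda>s. y (t + s))) has_vector_derivative X (y (t + s)) c) (at s within {a - t..b - t})"
    by (simp add: o_def)
qed

context riemannian
begin

text \<open>Bolzano's argument for the statement that agreement at the left end spreads over the
  interval. Near a time where the curves differ this is vacuous, since disjoint neighbourhoods keep
  them apart; near a time where they agree, both run in one chart, where the field is
  Lipschitz.\<close>

lemma integral_curve_unique:
  assumes X: "smooth_vfield_on A UNIV X"
    and y1: "integral_curve A X {0..T} y1" and y2: "integral_curve A X {0..T} y2"
    and init: "y1 0 = y2 0" and t: "t \<in> {0..T}"
  shows "y1 t = y2 t"
proof -
  have cont: "continuous_on {0..T} y1" "continuous_on {0..T} y2"
    using y1 y2 by (auto simp: integral_curve_def)
  define P where "P a b \<longleftrightarrow> (0 \<le> a \<longrightarrow> b \<le> T \<longrightarrow> y1 a = y2 a \<longrightarrow> (\<forall>s\<in>{a..b}. y1 s = y2 s))" for a b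
  have "P 0 T"
  proof (rule Bolzano[of 0 T P])
    show "0 \<le> T" using t by simp
    fix a b c assume P: "P a b" "P b c" and abc: "a \<le> b" "b \<le> c"
    show "P a c"
      unfolding P_def
    proof (intro impI ballI)
      fix s assume a: "0 \<le> a" "c \<le> T" "y1 a = y2 a" and s: "s \<in> {a..c}"
      have 1: "\<forall>s\<in>{a..b}. y1 s = y2 s" using P(1) a abc by (simp add: P_def)
      then have "\<forall>s\<in>{b..c}. y1 s = y2 s" using P(2) a abc by (simp add: P_def)
      then show "y1 s = y2 s" using 1 s by (cases "s \<le> b") auto
    qed
  next
    fix s0 assume s0: "0 \<le> s0" "s0 \<le> T"
    show "\<exists>d>0. \<forall>a b. a \<le> s0 \<and> s0 \<le> b \<and> b - a < d \<longrightarrow> P a b"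
    proof (cases "y1 s0 = y2 s0")
      case False
      then obtain W1 W2 where W: "open W1" "open W2" "y1 s0 \<in> W1" "y2 s0 \<in> W2" "W1 \<inter> W2 = {}"
        using hausdorff by metis
      obtain V1 where V1: "open V1" "\<And>s. s \<in> {0..T} \<Longrightarrow> s \<in> V1 \<longleftrightarrow> y1 s \<in> W1"
        using continuous_on_preimage_open[OF cont(1) W(1)] by metis
      obtain V2 where V2: "open V2" "\<And>s. s \<in> {0..T} \<Longrightarrow> s \<in> V2 \<longleftrightarrow> y2 s \<in> W2"
        using continuous_on_preimage_open[OF cont(2) W(2)] by metis
      have "open (V1 \<inter> V2)" "s0 \<in> V1 \<inter> V2" using V1 V2 W s0 by auto
      then obtain d where d: "d > 0" "ball s0 d \<subseteq> V1 \<inter> V2" using open_contains_ball by blast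
      have "P a b" if ab: "a \<le> s0" "s0 \<le> b" "b - a < d" for a b
        unfolding P_def
      proof (intro impI)
        assume a: "0 \<le> a" "y1 a = y2 a"
        have "a \<in> ball s0 d" using ab by (simp add: dist_real_def)
        then have "y1 a \<in> W1" "y2 a \<in> W2" using d(2) V1(2)[of a] V2(2)[of a] a ab s0 by auto
        then show "\<forall>s\<in>{a..b}. y1 s = y2 s" using a W(5) by auto
      qed
      then show ?thesis using d(1) by blast
    next
      case True
      obtain c where c: "c \<in> A" "y1 s0 \<in> fst c" by (rule chart_around)
      let ?F = "\<lambda>x. X (inv_chart c x) c" and ?x0 = "snd c (y1 s0)"
      have F: "smooth_on (coords c) ?F" using X c(1) unfolding smooth_vfield_on_def by auto
      obtain r K where rK: "0 < r" "0 \<le> K"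
        "\<And>x y. x \<in> ball ?x0 r \<Longrightarrow> y \<in> ball ?x0 r \<Longrightarrow> norm (?F x - ?F y) \<le> K * norm (x - y)"
        using smooth_on_locally_lipschitz[OF F open_coords[OF c(1)] imageI[OF c(2)]] by metis
      let ?W = "fst c \<inter> snd c -` ball ?x0 r"
      have oW: "open ?W"
        by (rule continuous_open_preimage[OF continuous_on_chart[OF c(1)] open_chart_domain[OF c(1)] open_ball])
      obtain V1 where V1: "open V1" "\<And>s. s \<in> {0..T} \<Longrightarrow> s \<in> V1 \<longleftrightarrow> y1 s \<in> ?W"
        using continuous_on_preimage_open[OF cont(1) oW] by metis
      obtain V2 where V2: "open V2" "\<And>s. s \<in> {0..T} \<Longrightarrow> s \<in> V2 \<longleftrightarrow> y2 s \<in> ?W"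
        using continuous_on_preimage_open[OF cont(2) oW] by metis
      have "y1 s0 \<in> ?W" "y2 s0 \<in> ?W" using c(2) rK(1) True by auto
      then have "open (V1 \<inter> V2)" "s0 \<in> V1 \<inter> V2" using V1 V2 s0 by auto
      then obtain d where d: "d > 0" "ball s0 d \<subseteq> V1 \<inter> V2" using open_contains_ball by blast
      \<comment> \<open>The second bound yields \<open>K * (b - a) < 1\<close>, also for
        \<open>K = 0\<close>.\<close>
      define d' where "d' = min d (1 / (K + 1))"
      have d': "d' > 0" using d rK(2) by (simp add: d'_def)
      have "P a b" if ab: "a \<le> s0" "s0 \<le> b" "b - a < d'" for a b
        unfolding P_def
      proof (intro impI ballI)
        fix s assume a: "0 \<le> a" "b \<le> T" "y1 a = y2 a" and s: "s \<in> {a..b}"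
        have sub: "{a..b} \<subseteq> {0..T}" using a by auto
        have "{a..b} \<subseteq> ball s0 d" using ab by (auto simp: dist_real_def d'_def)
        then have inW: "y1 s \<in> ?W" "y2 s \<in> ?W" if "s \<in> {a..b}" for s
          using V1(2)[of s] V2(2)[of s] d(2) sub that by blast+
        have "(K + 1) * (b - a) < 1" using ab(3) rK(2) by (simp add: d'_def field_simps)
        moreover have "K * (b - a) \<le> (K + 1) * (b - a)" using ab by (intro mult_right_mono) auto
        ultimately have small: "K * (b - a) < 1" by linarith
        have deriv: "((snd c \<circ> y) has_vector_derivative ?F ((snd c \<circ> y) s)) (at s within {a..b})"
          if y: "integral_curve A X {0..T} y" and s: "s \<in> {a..b}" and W: "y s \<in> ?W" for y s
        proof -
          have "((snd c \<circ> y) has_vector_derivative X (y s) c) (at s within {0..T})"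
            using y c(1) s W sub unfolding integral_curve_def by blast
          then show ?thesis
            using W c(1) by (auto intro: has_vector_derivative_within_subset[OF _ sub])
        qed
        have "(snd c \<circ> y1) s = (snd c \<circ> y2) s"
        proof (rule lipschitz_ode_unique[OF _ rK(2) small, where B = "ball ?x0 r" and F = ?F])
          show "norm (?F x - ?F y) \<le> K * norm (x - y)" if "x \<in> ball ?x0 r" "y \<in> ball ?x0 r" for x y
            by (rule rK(3)[OF that])
          show "((snd c \<circ> y1) has_vector_derivative ?F ((snd c \<circ> y1) s)) (at s within {a..b})"
            if "s \<in> {a..b}" for s by (rule deriv[OF y1 that inW(1)[OF that]])
          show "((snd c \<circ> y2) has_vector_derivative ?F ((snd c \<circ> y2) s)) (at s within {a..b})"
            if "s \<in> {a..b}" for s by (rule deriv[OF y2 that inW(2)[OF that]])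
          show "(snd c \<circ> y1) s \<in> ball ?x0 r" "(snd c \<circ> y2) s \<in> ball ?x0 r" if "s \<in> {a..b}" for s
            using inW[OF that] by simp_all
        qed (use ab a(3) s in simp_all)
        then have "inv_chart c (snd c (y1 s)) = inv_chart c (snd c (y2 s))" by simp
        then show "y1 s = y2 s" using inW[OF s] c(1) by simp
      qed
      then show ?thesis using d' by blast
    qed
  qed
  then show ?thesis using init t by (simp add: P_def)
qed

lemma flow_eq:
  assumes X: "smooth_vfield_on A UNIV X" and y: "integral_curve A X {0..T} y" and t: "t \<in> {0..T}"
  shows "flow A X t (y 0) = y t"
proof -
  have seg: "closed_segment 0 t = {0..t}" using t by (simp add: closed_segment_eq_real_ivl)
  have y': "integral_curve A X {0..t} y" using y by (rule integral_curve_subset) (use t in auto)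
  show ?thesis
    unfolding flow_def seg
  proof (rule the_equality)
    show "\<exists>z. integral_curve A X {0..t} z \<and> z 0 = y 0 \<and> z t = y t" using y' by blast
    fix q assume "\<exists>z. integral_curve A X {0..t} z \<and> z 0 = y 0 \<and> z t = q"
    then obtain z where z: "integral_curve A X {0..t} z" "z 0 = y 0" "z t = q" by blast
    then show "q = y t" using integral_curve_unique[OF X z(1) y' z(2), of t] t by simp
  qed
qed

text \<open>\<open>flow_defined\<close> provides a curve up to time \<open>T\<close>; by uniqueness
  its restrictions compute the flow at all earlier times.\<close>

lemma flow_curve:
  assumes X: "smooth_vfield_on A UNIV X" and "flow_defined A X T p" "0 \<le> T"
  obtains y where "integral_curve A X {0..T} y" "y 0 = p" "\<And>t. t \<in> {0..T} \<Longrightarrow> flow A X t p = y t"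
proof -
  have "closed_segment 0 T = {0..T}" using assms(3) by (simp add: closed_segment_eq_real_ivl)
  then obtain y where "integral_curve A X {0..T} y" "y 0 = p"
    using assms(2) by (auto simp: flow_defined_def)
  then show ?thesis using that flow_eq[OF X] by blast
qed

lemma starts_along_integral_curve:
  assumes y: "integral_curve A X {0..h} y" and t: "0 \<le> t" "t < h"
  shows "starts_along X (y t) (\<lambda>\<tau>. y (t + \<tau>))"
proof -
  \<comment> \<open>Limits from the right at 0 see only small \<tau>, so the half-line may be
    replaced by the interval on which the curve is given.\<close>
  have at: "at 0 within {0..} = at 0 within {0..h - t}"
    using t by (simp add: at_within_Icc_at_right at_within_Ici_at_right)
  have 0: "0 \<in> {0..h - t}" using t by simp
  have "integral_curve A X {0..h - t} (\<lambda>\<tau>. y (t + \<tau>))"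
    by (rule integral_curve_subset[OF integral_curve_shift[OF y, of t]]) (use t in auto)
  note y' = this[unfolded integral_curve_def continuous_on_eq_continuous_within]
  show ?thesis
    unfolding starts_along_def at
  proof (intro conjI ballI impI)
    show "continuous (at 0 within {0..h - t}) (\<lambda>\<tau>. y (t + \<tau>))" using y' 0 by blast
    fix c assume "c \<in> A" "y t \<in> fst c"
    then show "((snd c \<circ> (\<lambda>\<tau>. y (t + \<tau>))) has_vector_derivative X (y t) c) (at 0 within {0..h - t})"
      using y'[THEN conjunct2, rule_format, of c 0] 0 by simp
  qed simp
qed

lemma rdist_continuous:
  assumes y: "continuous_on S y" and t: "t \<in> S" and e: "0 < e"
  obtains d where "0 < d" "\<And>s. s \<in> S \<Longrightarrow> dist s t < d \<Longrightarrow> rdist (y t) (y s) \<le> ereal e"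
    "\<And>s. s \<in> S \<Longrightarrow> dist s t < d \<Longrightarrow> rdist (y s) (y t) \<le> ereal e"
proof -
  obtain c where c: "c \<in> A" "y t \<in> fst c" by (rule chart_around)
  let ?x0 = "snd c (y t)"
  obtain r B where rB: "0 < r" "0 \<le> B"
    "\<And>x z. x \<in> ball ?x0 r \<Longrightarrow> z \<in> ball ?x0 r \<Longrightarrow>
      rdist (inv_chart c x) (inv_chart c z) \<le> ereal (B * norm (z - x))"
    using rdist_chart_lipschitz[OF c(1) imageI[OF c(2)]] by metis
  \<comment> \<open>Within radius \<open>e / (B + 1)\<close> the Lipschitz bound gives at most
    \<open>e\<close>.\<close>
  define \<rho> where "\<rho> = min r (e / (B + 1))"
  have \<rho>: "0 < \<rho>" "\<rho> \<le> r" using rB e by (auto simp: \<rho>_def)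
  have "(B + 1) * \<rho> \<le> (B + 1) * (e / (B + 1))"
    using rB(2) by (intro mult_left_mono) (auto simp: \<rho>_def)
  then have \<rho>_le: "(B + 1) * \<rho> \<le> e" using rB(2) by simp
  let ?W = "fst c \<inter> snd c -` ball ?x0 \<rho>"
  have "open ?W"
    by (rule continuous_open_preimage[OF continuous_on_chart[OF c(1)] open_chart_domain[OF c(1)] open_ball])
  from continuous_on_preimage_open[OF y this]
  obtain V where V: "open V" "\<And>s. s \<in> S \<Longrightarrow> s \<in> V \<longleftrightarrow> y s \<in> ?W" by metis
  have "t \<in> V" using V(2)[OF t] c(2) \<rho> by simp
  then obtain d where d: "d > 0" "ball t d \<subseteq> V" using V(1) open_contains_ball by blast
  have *: "rdist (y t) (y s) \<le> ereal e \<and> rdist (y s) (y t) \<le> ereal e"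
    if s: "s \<in> S" "dist s t < d" for s
  proof -
    have "s \<in> V" using d(2) s(2) by (auto simp: dist_commute)
    then have ys: "y s \<in> fst c" "dist ?x0 (snd c (y s)) < \<rho>" using V(2)[OF s(1)] by auto
    have n: "norm (snd c (y s) - ?x0) \<le> \<rho>" "norm (?x0 - snd c (y s)) \<le> \<rho>"
      using ys(2) by (auto simp: dist_norm norm_minus_commute)
    have le: "B * v \<le> e" if "v \<le> \<rho>" "0 \<le> v" for v
      using mult_mono[of B "B + 1" v \<rho>] that rB(2) \<rho>_le by simp
    have b: "?x0 \<in> ball ?x0 r" "snd c (y s) \<in> ball ?x0 r" using ys \<rho> rB by auto
    have "B * norm (snd c (y s) - ?x0) \<le> e" "B * norm (?x0 - snd c (y s)) \<le> e"
      by (rule le[OF n(1)], simp, rule le[OF n(2)], simp)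
    then show ?thesis
      using rB(3)[OF b] rB(3)[OF b(2,1)] c ys by (auto intro: order_trans)
  qed
  show ?thesis by (rule that[OF d(1)]) (use * in auto)
qed

end

section \<open>Exponential growth of the distance between two solutions\<close>

context monotone_vfield
begin

text \<open>The velocity of a geodesic is differentiable, so a geodesic is a C1 curve. Inside
  \<open>U\<close> the distance is therefore realised by an arc to which the transport estimate
  applies.\<close>

lemma convex_minimizing_arc:
  assumes convex: "geodesically_convex A g nabla U" and pq: "p \<in> U" "q \<in> U"
  obtains \<gamma> where "C1_curve A {0..1} \<gamma>" "\<gamma> 0 = p" "\<gamma> 1 = q" "\<gamma> ` {0..1} \<subseteq> U"
    "rdist p q = ereal (arc_length 0 1 \<gamma>)" "0 \<le> arc_length 0 1 \<gamma>"
proof -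
  obtain \<gamma> where \<gamma>: "minimizing_geodesic A g nabla p q \<gamma>" "\<gamma> ` {0..1} \<subseteq> U"
    using convex pq unfolding geodesically_convex_def by blast
  then have geo: "geodesic_segment A nabla \<gamma>" and ends: "\<gamma> 0 = p" "\<gamma> 1 = q"
    and len: "rdist p q = ereal (arc_length 0 1 \<gamma>)"
    by (auto simp: minimizing_geodesic_def arc_length_def curve_length_def)
  have "C1_curve A {0..1} \<gamma>"
    using geo unfolding geodesic_segment_def C1_curve_def
    by (meson has_vector_derivative_continuous)
  then show ?thesis using that ends len \<gamma>(2) arc_length_nonneg by simp
qed

text \<open>A new minimizing arc is chosen at each time \<open>t\<close> and moved for a short time
  only. This bounds the upper right derivative of \<open>D\<close> at \<open>t\<close> without
  relating the arcs of different times.\<close>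

lemma rdist_integral_curves:
  assumes convex: "geodesically_convex A g nabla U" and h: "0 \<le> h"
    and y: "integral_curve A X {0..h} y" "y ` {0..h} \<subseteq> U"
    and z: "integral_curve A X {0..h} z" "z ` {0..h} \<subseteq> U"
    and init: "rdist (y 0) (z 0) \<le> ereal d"
  shows "rdist (y h) (z h) \<le> ereal (exp (\<nu> * h) * d)"
proof -
  define D where "D t = real_of_ereal (rdist (y t) (z t))" for t
  have inU: "y t \<in> U" "z t \<in> U" if "t \<in> {0..h}" for t using y(2) z(2) that by auto
  have D: "rdist (y t) (z t) = ereal (D t)" "0 \<le> D t" if "t \<in> {0..h}" for t
    using convex_minimizing_arc[OF convex inU[OF that]] by (metis D_def real_of_ereal.simps(1))+
  have cont: "continuous_on {0..h} y" "continuous_on {0..h} z"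
    using y(1) z(1) by (auto simp: integral_curve_def)
  have "D h \<le> exp (\<nu> * h) * D 0"
  proof (rule exponential_bound_if_upper_derivative_le[OF h])
    show "continuous_on {0..h} D"
      unfolding continuous_on_iff
    proof (intro ballI allI impI)
      fix t and e :: real assume t: "t \<in> {0..h}" and e: "0 < e"
      \<comment> \<open>The two moving end points contribute \<open>e / 3\<close> each, which leaves
        a strict inequality.\<close>
      have e3: "0 < e / 3" using e by simp
      obtain d1 where d1: "0 < d1"
        "\<And>s. s \<in> {0..h} \<Longrightarrow> dist s t < d1 \<Longrightarrow> rdist (y t) (y s) \<le> ereal (e / 3)"
        "\<And>s. s \<in> {0..h} \<Longrightarrow> dist s t < d1 \<Longrightarrow> rdist (y s) (y t) \<le> ereal (e / 3)"
        using rdist_continuous[OF cont(1) t e3] by metis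
      obtain d2 where d2: "0 < d2"
        "\<And>s. s \<in> {0..h} \<Longrightarrow> dist s t < d2 \<Longrightarrow> rdist (z t) (z s) \<le> ereal (e / 3)"
        "\<And>s. s \<in> {0..h} \<Longrightarrow> dist s t < d2 \<Longrightarrow> rdist (z s) (z t) \<le> ereal (e / 3)"
        using rdist_continuous[OF cont(2) t e3] by metis
      have "dist (D s) (D t) < e" if s: "s \<in> {0..h}" "dist s t < min d1 d2" for s
      proof -
        have "rdist (y s) (z s) \<le> ereal (e / 3 + (D t + e / 3))"
          by (intro rdist_triangle_le[of _ "y t"] rdist_triangle_le[of _ "z t"])
            (use s d1(3) d2(2) D(1)[OF t] in auto)
        moreover have "rdist (y t) (z t) \<le> ereal (e / 3 + (D s + e / 3))"
          by (intro rdist_triangle_le[of _ "y s"] rdist_triangle_le[of _ "z s"])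
            (use s d1(2) d2(3) D(1)[OF s(1)] in auto)
        ultimately have "D s \<le> e / 3 + (D t + e / 3)" "D t \<le> e / 3 + (D s + e / 3)"
          unfolding D(1)[OF t] D(1)[OF s(1)] by simp_all
        then show ?thesis using e unfolding dist_real_def by linarith
      qed
      then show "\<exists>d>0. \<forall>s\<in>{0..h}. dist s t < d \<longrightarrow> dist (D s) (D t) < e"
        using d1(1) d2(1) by (intro exI[of _ "min d1 d2"]) auto
    qed
    show "0 \<le> D t" if "t \<in> {0..h}" for t using D(2)[OF that] .
    fix t e :: real assume t: "0 \<le> t" "t < h" and e: "0 < e"
    have t': "t \<in> {0..h}" using t by simp
    obtain \<gamma> where \<gamma>: "C1_curve A {0..1} \<gamma>" "\<gamma> 0 = y t" "\<gamma> 1 = z t" "\<gamma> ` {0..1} \<subseteq> U"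
      "rdist (y t) (z t) = ereal (arc_length 0 1 \<gamma>)"
      using convex_minimizing_arc[OF convex inU[OF t']] by metis
    have len: "arc_length 0 1 \<gamma> = D t" using \<gamma>(5) by (simp add: D_def)
    \<comment> \<open>The transport estimate has the error \<open>\<tau> * (e' * D t + e')\<close>,
      which this choice makes equal to \<open>\<tau> * e\<close>.\<close>
    define e' where "e' = e / (D t + 1)"
    have e': "0 < e'" "e' * (D t + 1) = e" using e D(2)[OF t'] by (auto simp: e'_def)
    obtain \<delta> where \<delta>: "0 < \<delta>" "\<And>\<tau>. 0 < \<tau> \<Longrightarrow> \<tau> < \<delta> \<Longrightarrow>
        rdist (y (t + \<tau>)) (z (t + \<tau>)) \<le> ereal ((1 + \<tau> * (\<nu> + e')) * D t + e' * \<tau>)"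
      using transported_arc_length[OF \<gamma>(1,4) _ _ e'(1),
        of "\<lambda>\<tau>. y (t + \<tau>)" "\<lambda>\<tau>. z (t + \<tau>)", unfolded \<gamma>(2,3) len]
        starts_along_integral_curve[OF y(1) t] starts_along_integral_curve[OF z(1) t] by metis
    have "D (t + \<tau>) \<le> D t + \<tau> * (\<nu> * D t + e)" if \<tau>: "0 < \<tau>" "\<tau> < \<delta>" "t + \<tau> \<le> h" for \<tau>
    proof -
      have "D (t + \<tau>) \<le> (1 + \<tau> * (\<nu> + e')) * D t + e' * \<tau>"
        using \<delta>(2)[OF \<tau>(1,2)] D(1)[of "t + \<tau>"] \<tau> t by simp
      also have "\<dots> = D t + \<tau> * (\<nu> * D t + e' * (D t + 1))" by (simp add: algebra_simps)
      finally show ?thesis unfolding e'(2) .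
    qed
    then show "\<exists>d>0. \<forall>\<tau>. 0 < \<tau> \<and> \<tau> < d \<and> t + \<tau> \<le> h \<longrightarrow> D (t + \<tau>) \<le> D t + \<tau> * (\<nu> * D t + e)"
      using \<delta>(1) by blast
  qed
  moreover have "D 0 \<le> d" using init D(1)[of 0] h by simp
  ultimately have "D h \<le> exp (\<nu> * h) * d" by (meson exp_ge_zero mult_left_mono order_trans)
  then show ?thesis using D(1)[of h] h by simp
qed

end

section \<open>Accumulation of the local errors\<close>

text \<open>The denominator of the geometric sum is estimated by \<open>1 + x \<le> exp x\<close>.
  For positive \<nu>, \<open>x = \<nu> * h\<close> shows that it is at least
  \<open>\<nu> * h\<close>. For negative \<nu>, \<open>x = - (\<nu> * h)\<close> shows that
  \<open>1 - exp (\<nu> * h)\<close> is at least \<open>- (\<nu> * h) * exp (\<nu> * h)\<close>,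
  which is the source of the factor \<open>exp (- \<nu> * h)\<close>.\<close>

lemma geometric_sum_exp_le:
  fixes \<nu> h :: real
  assumes h: "0 < h"
  shows "(\<Sum>i<k. exp (\<nu> * h) ^ i) \<le>
    (if \<nu> > 0 then (exp (h * real k * \<nu>) - 1) / (\<nu> * h)
     else if \<nu> = 0 then real k
     else exp (- \<nu> * h) * (exp (h * real k * \<nu>) - 1) / (\<nu> * h))"
proof -
  let ?q = "exp (\<nu> * h)" and ?E = "exp (h * real k * \<nu>)"
  have E: "?q ^ k = ?E" by (simp add: exp_of_nat_mult[symmetric] mult_ac)
  have sum: "(\<Sum>i<k. ?q ^ i) = (?E - 1) / (?q - 1)" if "\<nu> \<noteq> 0"
    using geometric_sum[of ?q k] that h by (simp add: E)
  consider "\<nu> > 0" | "\<nu> = 0" | "\<nu> < 0" by linarith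
  then show ?thesis
  proof cases
    case 1
    then have pos: "0 < \<nu> * h" using h by simp
    have q: "\<nu> * h \<le> ?q - 1" using exp_ge_add_one_self[of "\<nu> * h"] by linarith
    have "(?E - 1) / (?q - 1) \<le> (?E - 1) / (\<nu> * h)"
      using pos 1 h by (intro divide_left_mono[OF q] mult_pos_pos) auto
    then show ?thesis using sum 1 by simp
  next
    case 3
    then have neg: "\<nu> * h < 0" using h by (simp add: mult_neg_pos)
    have "exp (- (\<nu> * h)) \<ge> 1 - \<nu> * h" using exp_ge_add_one_self[of "- (\<nu> * h)"] by simp
    then have "?q * (1 - \<nu> * h) \<le> ?q * exp (- (\<nu> * h))" by (intro mult_left_mono) auto
    then have "- (\<nu> * h) * ?q \<le> 1 - ?q" by (simp add: exp_minus algebra_simps)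
    moreover have "?E \<le> 1" using 3 h by (simp add: mult_nonneg_nonpos)
    moreover have "0 < - (\<nu> * h) * ?q" using neg by (simp add: mult_neg_pos)
    ultimately have "(1 - ?E) / (1 - ?q) \<le> (1 - ?E) / (- (\<nu> * h) * ?q)"
      using neg by (intro divide_left_mono mult_pos_pos) auto
    also have "\<dots> = (- (?E - 1)) / (- (\<nu> * h * ?q))" by simp
    also have "\<dots> = exp (- \<nu> * h) * (?E - 1) / (\<nu> * h)"
      unfolding minus_divide_divide by (simp add: exp_minus divide_inverse)
    also have "(1 - ?E) / (1 - ?q) = (?E - 1) / (?q - 1)"
      by (metis minus_diff_eq minus_divide_divide)
    finally show ?thesis using sum 3 by simp
  qed simp
qed

theorem theorem4p1:
  fixes A :: "('m::{second_countable_topology,t2_space}, 'e::euclidean_space) chart set"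
    and g :: "'m \<Rightarrow> ('m, 'e) tvec \<Rightarrow> ('m, 'e) tvec \<Rightarrow> real"
    and nabla :: "'m \<Rightarrow> ('m, 'e) tvec \<Rightarrow> ('m, 'e) vfield \<Rightarrow> ('m, 'e) tvec"
    and y0 :: 'm
    and U :: "'m set"
    and X :: "('m, 'e) vfield"
    and \<nu> C ts hs :: real
    and \<phi> :: "real \<Rightarrow> ('m, 'e) vfield \<Rightarrow> 'm \<Rightarrow> 'm"
    and p :: nat
  assumes manifold: "riemannian_manifold A g"
    and connection: "levi_civita A g nabla"
    and convex: "geodesically_convex A g nabla U"
    and smooth: "smooth_vfield_on A UNIV X"
    and monotone: "\<forall>x\<in>U. \<forall>v\<in>tangent_space A x. g x (nabla x v X) v \<le> \<nu> * (tv_norm g x v)\<^sup>2"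
    and ts_pos: "0 < ts"
    and solution: "\<forall>t\<in>{0..ts}. flow_defined A X t y0 \<and> flow A X t y0 \<in> U"
    and hs_le: "hs \<le> ts"
    and iterates: "\<forall>h k. 0 < h \<and> h \<le> hs \<and> ts = h * real k \<longrightarrow>
      (\<forall>j\<le>k. (\<phi> h X ^^ j) y0 \<in> U)"
    and local_flows: "\<forall>h k. 0 < h \<and> h \<le> hs \<and> ts = h * real k \<longrightarrow>
      (\<forall>j<k. \<forall>s\<in>{0..h}. flow_defined A X s ((\<phi> h X ^^ j) y0) \<and> flow A X s ((\<phi> h X ^^ j) y0) \<in> U)"
    and local_error: "\<forall>y\<in>U. \<forall>h. 0 < h \<and> h \<le> hs \<longrightarrow>
      flow_defined A X h y \<and>
      riemannian_dist A g (flow A X h y) (\<phi> h X y) \<le> ereal (C * h ^ (p + 1))"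
  shows "\<forall>(k::nat) h. 0 < k \<and> 0 < h \<and> h \<le> hs \<and> ts = h * real k \<longrightarrow>
    riemannian_dist A g (flow A X ts y0) ((\<phi> h X ^^ k) y0) \<le> ereal (
      if \<nu> > 0 then C / \<nu> * (exp (ts * \<nu>) - 1) * h ^ p
      else if \<nu> = 0 then C * ts * h ^ p
      else C * exp (- \<nu> * h) / \<nu> * (exp (ts * \<nu>) - 1) * h ^ p)"
proof (intro allI impI, elim conjE)
  fix k :: nat and h :: real
  assume k: "0 < k" and h: "0 < h" "h \<le> hs" and ts: "ts = h * real k"
  interpret monotone_vfield A g nabla U X \<nu>
    by (intro monotone_vfield.intro monotone_vfield_axioms.intro riemannian.intro
      manifold connection smooth monotone)
  let ?y = "\<lambda>j. (\<phi> h X ^^ j) y0"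
  have y_U: "?y j \<in> U" if "j \<le> k" for j using iterates h ts that by blast
  have flow_U: "flow_defined A X s (?y j)" "flow A X s (?y j) \<in> U"
    if "j < k" "s \<in> {0..h}" for j s
    using local_flows h ts that by blast+
  obtain Y where Y: "integral_curve A X {0..ts} Y" "Y 0 = y0"
    "\<And>t. t \<in> {0..ts} \<Longrightarrow> flow A X t y0 = Y t"
    using flow_curve[OF smooth, of ts y0] solution ts_pos by (metis atLeastAtMost_iff less_imp_le order_refl)
  have Y_U: "Y t \<in> U" if "t \<in> {0..ts}" for t using solution Y(3) that by metis
  have err: "rdist (flow A X h (?y j)) (?y (Suc j)) \<le> ereal (C * h ^ (p + 1))" if "j < k" for j
    using local_error y_U[of j] h that by simp
  \<comment> \<open>The sign of \<open>C\<close> comes from the first local error, which is a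
    distance inside \<open>U\<close> and so nonnegative. It permits multiplying the bound on the
    geometric sum by \<open>C\<close>.\<close>
  have C: "0 \<le> C"
  proof -
    have "rdist (flow A X h (?y 0)) (?y (Suc 0)) \<le> ereal (C * h ^ (p + 1))" by (rule err[OF k])
    moreover obtain \<gamma> where "rdist (flow A X h (?y 0)) (?y (Suc 0)) = ereal (arc_length 0 1 \<gamma>)"
      "0 \<le> arc_length 0 1 \<gamma>"
      by (rule convex_minimizing_arc[OF convex flow_U(2)[OF k, of h] y_U[of "Suc 0"]]) (use h k in auto)
    ultimately have "0 \<le> C * h ^ (p + 1)" by simp
    moreover have "0 < h ^ (p + 1)" using h(1) by (rule zero_less_power)
    ultimately show ?thesis by (metis mult_neg_pos not_le)
  qed
  have step: "j \<le> k \<Longrightarrow> rdist (Y (h * real j)) (?y j) \<le>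
      ereal (C * h ^ (p + 1) * (\<Sum>i<j. exp (\<nu> * h) ^ i))" for j
  proof (induction j)
    case 0
    then show ?case using rdist_self[of y0] Y(2) by (simp add: zero_ereal_def)
  next
    case (Suc j)
    then have j: "j < k" by simp
    let ?t = "h * real j"
    have "h * real (Suc j) \<le> h * real k" using Suc.prems h by (intro mult_left_mono) auto
    then have t: "0 \<le> ?t" "?t + h \<le> ts" using h ts by (auto simp: algebra_simps)
    \<comment> \<open>\<open>Z\<close> is the exact solution started at the numerical value. From
      \<open>Y\<close> to \<open>Z\<close> the old error grows by the factor
      \<open>exp (\<nu> * h)\<close>; from \<open>Z\<close> to the next iterate the local error is
      added.\<close>
    obtain Z where Z: "integral_curve A X {0..h} Z" "Z 0 = ?y j"
      "\<And>s. s \<in> {0..h} \<Longrightarrow> flow A X s (?y j) = Z s"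
      using flow_curve[OF smooth flow_U(1)[OF j, of h]] h by auto
    have "rdist (Y (?t + h)) (Z h) \<le> ereal (exp (\<nu> * h) * (C * h ^ (p + 1) * (\<Sum>i<j. exp (\<nu> * h) ^ i)))"
    proof (rule rdist_integral_curves[OF convex _ _ _ Z(1), of "\<lambda>s. Y (?t + s)"])
      show "integral_curve A X {0..h} (\<lambda>s. Y (?t + s))"
        by (rule integral_curve_subset[OF integral_curve_shift[OF Y(1), of ?t]]) (use t in auto)
      show "(\<lambda>s. Y (?t + s)) ` {0..h} \<subseteq> U" using Y_U t by auto
      show "Z ` {0..h} \<subseteq> U" using flow_U(2)[OF j] Z(3) by force
      show "rdist (Y (?t + 0)) (Z 0) \<le> ereal (C * h ^ (p + 1) * (\<Sum>i<j. exp (\<nu> * h) ^ i))"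
        using Suc.IH j Z(2) by simp
    qed (use h in simp)
    moreover have "rdist (Z h) (?y (Suc j)) \<le> ereal (C * h ^ (p + 1))"
      using err[OF j] Z(3)[of h] h by simp
    ultimately have "rdist (Y (?t + h)) (?y (Suc j)) \<le>
        ereal (exp (\<nu> * h) * (C * h ^ (p + 1) * (\<Sum>i<j. exp (\<nu> * h) ^ i)) + C * h ^ (p + 1))"
      by (rule rdist_triangle_le)
    \<comment> \<open>The factor shifts the index of the geometric sum, and the new local error is
      its term with index 0.\<close>
    also have "exp (\<nu> * h) * (C * h ^ (p + 1) * (\<Sum>i<j. exp (\<nu> * h) ^ i)) + C * h ^ (p + 1) =
        C * h ^ (p + 1) * (\<Sum>i<Suc j. exp (\<nu> * h) ^ i)"
      unfolding sum.lessThan_Suc_shift by (simp add: algebra_simps sum_distrib_left)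
    also have "?t + h = h * real (Suc j)" by (simp add: algebra_simps)
    finally show ?case .
  qed
  let ?B = "if \<nu> > 0 then C / \<nu> * (exp (ts * \<nu>) - 1) * h ^ p
      else if \<nu> = 0 then C * ts * h ^ p
      else C * exp (- \<nu> * h) / \<nu> * (exp (ts * \<nu>) - 1) * h ^ p"
  have "rdist (flow A X ts y0) (?y k) \<le> ereal (C * h ^ (p + 1) * (\<Sum>i<k. exp (\<nu> * h) ^ i))"
    using step[of k] Y(3)[of ts] ts_pos ts by simp
  also have "\<dots> \<le> ereal ?B"
  proof -
    \<comment> \<open>One factor \<open>h\<close> of \<open>h ^ (p + 1)\<close> cancels against
      \<open>\<nu> * h\<close>, or for \<nu> = 0 combines with \<open>k\<close> to
      \<open>ts\<close>.\<close>
    have "C * h ^ (p + 1) * (\<Sum>i<k. exp (\<nu> * h) ^ i) \<le> C * h ^ (p + 1) *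
      (if \<nu> > 0 then (exp (h * real k * \<nu>) - 1) / (\<nu> * h)
       else if \<nu> = 0 then real k
       else exp (- \<nu> * h) * (exp (h * real k * \<nu>) - 1) / (\<nu> * h))"
      using C h(1) by (intro mult_left_mono geometric_sum_exp_le) auto
    also have "\<dots> = ?B" using h(1) ts by (simp add: field_simps)
    finally show ?thesis by simp
  qed
  finally show "rdist (flow A X ts y0) (?y k) \<le> ereal ?B" .
qed

end
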